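(* Let $k$ be a field of characteristic $0$, $X$ a smooth algebraic variety over $k$, $U\subset X$ an affine Zariski open subset and $A=\mathcal{O}(U)$. Then the groupoid $\mathcal{A}lg(A)$ of vertex algebroids of the form $(A,\mathrm{Der}_k(A),\Omega^1_{A/k},d_{DR},\gamma,\langle\,,\rangle,c)$ admits a canonical structure of an $\Omega^{[2,3\rangle}(A)$-Torseur. That is, there is a functor $$\dotplus:\ \mathcal{A}lg(A)\times\Omega^{[2,3\rangle}(A)\longrightarrow\mathcal{A}lg(A),\qquad (\mathcal{A},\omega)\mapsto\mathcal{A}\dotplus\omega,$$ given on objects by replacing the component $c$ of $\mathcal{A}$ by $c+\omega$, which defines an Action of the Abelian group in categories $\Omega^{[2,3\rangle}(A)$ on $\mathcal{A}lg(A)$, and such that for each object $\mathcal{A}$ of $\mathcal{A}lg(A)$ the induced functor $\mathcal{A}\dotplus\,?:\ \Omega^{[2,3\rangle}(A)\to\mathcal{A}lg(A)$ is an equivalence of categories.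
   Context: Put $T=\mathrm{Der}_k(A)$, $\Omega=\Omega^1_{A/k}$, $\partial=d_{DR}:A\to\Omega$. $T$ acts on $A$ by derivations and on $\Omega$ by the Lie derivative; $\langle\tau,a\,\partial b\rangle=a\tau(b)$ is the standard $A$-bilinear pairing $T\times\Omega\to A$. Objects of $\mathcal{A}lg(A)$: triples $(\gamma,\langle\,,\rangle,c)$ where $\gamma:A\times T\to\Omega$ is $k$-bilinear; $\langle\,,\rangle:(T\oplus\Omega)\times(T\oplus\Omega)\to A$ is symmetric $k$-bilinear, zero on $\Omega\times\Omega$ and equal to the standard pairing on $T\times\Omega$; $c:T\times T\to\Omega$ is skew symmetric $k$-bilinear; and for all $a,b\in A$, $\tau,\tau_i\in T$: (A1) $\gamma(a,b\tau)=\gamma(ab,\tau)-a\gamma(b,\tau)-\tau(a)\partial b-\tau(b)\partial a$; (A2) $\langle a\tau_1,\tau_2\rangle=a\langle\tau_1,\tau_2\rangle+\langle\gamma(a,\tau_1),\tau_2\rangle-\tau_1\tau_2(a)$; (A3) $c(a\tau_1,\tau_2)=ac(\tau_1,\tau_2)+\gamma(a,[\tau_1,\tau_2])-\gamma(\tau_2(a),\tau_1)+\tau_2(\gamma(a,\tau_1))-\frac12\langle\tau_1,\tau_2\rangle\partial a+\frac12\partial\tau_1\tau_2(a)-\frac12\partial\langle\tau_2,\gamma(a,\tau_1)\rangle$; (A4) $\langle[\tau_1,\tau_2],\tau_3\rangle+\langle\tau_2,[\tau_1,\tau_3]\rangle=\tau_1(\langle\tau_2,\tau_3\rangle)-\frac12\tau_2(\langle\tau_1,\tau_3\rangle)-\frac12\tau_3(\langle\tau_1,\tau_2\rangle)+\langle\tau_2,c(\tau_1,\tau_3)\rangle+\langle\tau_3,c(\tau_1,\tau_2)\rangle$;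 (A5) $d_{Lie}c(\tau_1,\tau_2,\tau_3)=-\frac12\partial\{\langle[\tau_1,\tau_2],\tau_3\rangle+\langle[\tau_1,\tau_3],\tau_2\rangle-\langle[\tau_2,\tau_3],\tau_1\rangle-\tau_1(\langle\tau_2,\tau_3\rangle)+\tau_2(\langle\tau_1,\tau_3\rangle)-2\langle\tau_3,c(\tau_1,\tau_2)\rangle\}$, where $d_{Lie}c(\tau_1,\tau_2,\tau_3)=\tau_1(c(\tau_2,\tau_3))-\tau_2(c(\tau_1,\tau_3))+\tau_3(c(\tau_1,\tau_2))-c([\tau_1,\tau_2],\tau_3)+c([\tau_1,\tau_3],\tau_2)-c([\tau_2,\tau_3],\tau_1)$. Morphisms $(\gamma,\langle\,,\rangle,c)\to(\gamma',\langle\,,\rangle',c')$ in $\mathcal{A}lg(A)$: $k$-linear maps $h:T\to\Omega$ such that $h(a\tau)=ah(\tau)-\gamma'(a,\tau)+\gamma(a,\tau)$; $\langle\tau_1,\tau_2\rangle=\langle\tau_1,\tau_2\rangle'+\langle\tau_1,h(\tau_2)\rangle+\langle\tau_2,h(\tau_1)\rangle$; $c(\tau_1,\tau_2)=c'(\tau_1,\tau_2)+\frac12\partial\langle\tau_1,h(\tau_2)\rangle-\frac12\partial\langle\tau_2,h(\tau_1)\rangle-\tau_1(h(\tau_2))+\tau_2(h(\tau_1))+h([\tau_1,\tau_2])$. Composition is addition of the maps $h$; the identity is $h=0$. A $3$-form $\omega$ is regarded as the map $T\times T\to\Omega$ with $\langle\tau_3,\omega(\tau_1,\tau_2)\rangle=\omega(\tau_1,\tau_2,\tau_3)$.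 $\Omega^{[2,3\rangle}(A)$ is the groupoid whose objects are the closed $3$-forms on $A$ and with $\mathrm{Hom}(\omega,\omega')=\{\eta\in\Omega^2_{A/k}\mid d_{DR}\eta=\omega'-\omega\}$, composition being addition. Addition of forms makes it an Abelian group in categories. An Action of it on a category is a monoidal action in the usual sense. *)

theory Defs
  imports
    "HOL-Library.Poly_Mapping"
    "HOL-Library.Function_Algebras"
    "HOL-Library.Product_Plus"
    "Jordan_Normal_Form.Determinant"
begin

section \<open>Smooth algebras\<close>

definition k_algebra :: "('k::field \<Rightarrow> 'a::comm_ring_1 \<Rightarrow> 'a) \<Rightarrow> bool" where
  "k_algebra sc \<longleftrightarrow> vector_space sc \<and> (\<forall>r a b. sc r (a * b) = sc r a * b)"

definition prime_ideal :: "'a::comm_ring_1 set \<Rightarrow> bool" where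
  "prime_ideal p \<longleftrightarrow> Modules.module.subspace (*) p \<and> 1 \<notin> p \<and> (\<forall>a b. a * b \<in> p \<longrightarrow> a \<in> p \<or> b \<in> p)"

text \<open>A polynomial is a finitely supported family of coefficients, indexed by
  exponent vectors. \<open>polys n\<close> is \<open>k[x\<^sub>0,\<dots>,x\<^sub>n\<^sub>-\<^sub>1]\<close>.\<close>

type_synonym 'k mpoly = "(nat \<Rightarrow>\<^sub>0 nat) \<Rightarrow>\<^sub>0 'k"

definition polys :: "nat \<Rightarrow> 'k::comm_ring_1 mpoly set" where
  "polys n = {p. \<forall>m\<in>Poly_Mapping.keys p. Poly_Mapping.keys m \<subseteq> {..<n}}"

definition poly_ev :: "('k \<Rightarrow> 'a \<Rightarrow> 'a) \<Rightarrow> (nat \<Rightarrow> 'a) \<Rightarrow> 'k::comm_ring_1 mpoly \<Rightarrow> 'a::comm_ring_1" where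
  "poly_ev sc x p = (\<Sum>m\<in>Poly_Mapping.keys p. sc (Poly_Mapping.lookup p m)
     (\<Prod>i\<in>Poly_Mapping.keys m. x i ^ Poly_Mapping.lookup m i))"

definition poly_partial :: "nat \<Rightarrow> 'k::comm_ring_1 mpoly \<Rightarrow> 'k mpoly" where
  "poly_partial i p = (\<Sum>m\<in>Poly_Mapping.keys p.
     Poly_Mapping.single (m - Poly_Mapping.single i 1)
       (of_nat (Poly_Mapping.lookup m i) * Poly_Mapping.lookup p m))"

text \<open>The Jacobian criterion as definition: \<open>A\<close> is of finite type, \<open>A = k[x\<^sub>0,\<dots>,x\<^sub>n\<^sub>-\<^sub>1] / I\<close>,
  and every point \<open>p\<close> of \<open>Spec A\<close> has a principal open neighbourhood \<open>D(g)\<close> on which \<open>I\<close> is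
  generated by \<open>c\<close> polynomials whose Jacobian matrix has a \<open>c \<times> c\<close> minor that is nonzero at \<open>p\<close>.
  As \<open>I\<close> is finitely generated, \<open>g\<close> may be replaced by a power, so that
  generation on \<open>D(g)\<close> reads \<open>g I \<subseteq> (f\<^sub>0,\<dots>,f\<^sub>c\<^sub>-\<^sub>1)\<close>.\<close>

definition smooth_algebra :: "('k::field \<Rightarrow> 'a::comm_ring_1 \<Rightarrow> 'a) \<Rightarrow> bool" where
  "smooth_algebra sc \<longleftrightarrow> (\<exists>n x.
     poly_ev sc x ` polys n = UNIV \<and>
     (\<forall>p. prime_ideal p \<longrightarrow>
       (\<exists>c f g j.
          (\<forall>l<c. f l \<in> polys n \<and> poly_ev sc x (f l) = 0) \<and>
          g \<in> polys n \<and> poly_ev sc x g \<notin> p \<and>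
          (\<forall>q\<in>polys n. poly_ev sc x q = 0 \<longrightarrow>
             (\<exists>b. (\<forall>l<c. b l \<in> polys n) \<and> g * q = (\<Sum>l<c. b l * f l))) \<and>
          (\<forall>i<c. j i < n) \<and>
          det (mat c c (\<lambda>(l, i). poly_ev sc x (poly_partial (j i) (f l)))) \<notin> p)))"


section \<open>Kaehler differentials and exterior powers\<close>

text \<open>Elements of \<open>'g \<Rightarrow>\<^sub>0 'a\<close> supported on \<open>G\<close> form the free \<open>A\<close>-module on \<open>G\<close>.
  \<open>presented_by s e G R\<close> says that \<open>e\<close> identifies the module \<open>(N, s)\<close> with the quotient of this
  free module by the submodule spanned by \<open>R\<close>.\<close>

definition free_scale :: "'a::comm_ring_1 \<Rightarrow> ('g \<Rightarrow>\<^sub>0 'a) \<Rightarrow> ('g \<Rightarrow>\<^sub>0 'a)" where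
  "free_scale a u = Poly_Mapping.map (\<lambda>b. a * b) u"

definition free_ext :: "('a::comm_ring_1 \<Rightarrow> 'n::ab_group_add \<Rightarrow> 'n) \<Rightarrow> ('g \<Rightarrow> 'n) \<Rightarrow> ('g \<Rightarrow>\<^sub>0 'a) \<Rightarrow> 'n" where
  "free_ext s e u = (\<Sum>g\<in>Poly_Mapping.keys u. s (Poly_Mapping.lookup u g) (e g))"

definition presented_by :: "('a::comm_ring_1 \<Rightarrow> 'n::ab_group_add \<Rightarrow> 'n) \<Rightarrow> ('g \<Rightarrow> 'n) \<Rightarrow>
    'g set \<Rightarrow> ('g \<Rightarrow>\<^sub>0 'a) set \<Rightarrow> bool" where
  "presented_by s e G R \<longleftrightarrow> Modules.module s \<and>
     free_ext s e ` {u. Poly_Mapping.keys u \<subseteq> G} = UNIV \<and>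
     {u. Poly_Mapping.keys u \<subseteq> G \<and> free_ext s e u = 0} = Modules.module.span free_scale R"

text \<open>The generator \<open>b\<close> stands for \<open>\<partial>b\<close>.\<close>

definition kaehler_rels :: "('k \<Rightarrow> 'a \<Rightarrow> 'a) \<Rightarrow> ('a \<Rightarrow>\<^sub>0 'a::comm_ring_1) set" where
  "kaehler_rels sc =
     {Poly_Mapping.single (a + b) 1 - Poly_Mapping.single a 1 - Poly_Mapping.single b 1 | a b. True} \<union>
     {Poly_Mapping.single (sc r a) 1 - Poly_Mapping.single a (sc r 1) | r a. True} \<union>
     {Poly_Mapping.single (a * b) 1 - Poly_Mapping.single b a - Poly_Mapping.single a b | a b. True}"

definition kaehler_differentials ::
  "('k \<Rightarrow> 'a \<Rightarrow> 'a) \<Rightarrow> ('a::comm_ring_1 \<Rightarrow> 'w::ab_group_add \<Rightarrow> 'w) \<Rightarrow> ('a \<Rightarrow> 'w) \<Rightarrow> bool" where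
  "kaehler_differentials sc s d \<longleftrightarrow> presented_by s d UNIV (kaehler_rels sc)"

text \<open>The generator \<open>[w\<^sub>1,\<dots>,w\<^sub>p]\<close> stands for \<open>w\<^sub>1 \<and> \<dots> \<and> w\<^sub>p\<close>.\<close>

definition exterior_rels :: "nat \<Rightarrow> ('a \<Rightarrow> 'w \<Rightarrow> 'w) \<Rightarrow> ('w::ab_group_add list \<Rightarrow>\<^sub>0 'a::comm_ring_1) set" where
  "exterior_rels p s =
     {Poly_Mapping.single (xs @ (v + w) # ys) 1 - Poly_Mapping.single (xs @ v # ys) 1
        - Poly_Mapping.single (xs @ w # ys) 1 | xs v w ys. length xs + length ys + 1 = p} \<union>
     {Poly_Mapping.single (xs @ s a v # ys) 1 - Poly_Mapping.single (xs @ v # ys) a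
        | xs a v ys. length xs + length ys + 1 = p} \<union>
     {Poly_Mapping.single ws 1 | ws. length ws = p \<and> \<not> distinct ws}"

definition exterior_power :: "nat \<Rightarrow> ('a::comm_ring_1 \<Rightarrow> 'w::ab_group_add \<Rightarrow> 'w) \<Rightarrow>
    ('a \<Rightarrow> 'n::ab_group_add \<Rightarrow> 'n) \<Rightarrow> ('w list \<Rightarrow> 'n) \<Rightarrow> bool" where
  "exterior_power p s t wedge \<longleftrightarrow> presented_by t wedge {ws. length ws = p} (exterior_rels p s)"


section \<open>Differential forms on a \<open>k\<close>-algebra\<close>

text \<open>A model of the modules \<open>\<Omega>\<^sup>p\<close>, \<open>1 \<le> p \<le> 4\<close>, of a \<open>k\<close>-algebra \<open>A\<close>: \<open>ksc\<close> is the \<open>k\<close>-module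
  structure of \<open>A\<close>, \<open>osc\<^sub>p\<close> the \<open>A\<close>-module structure of \<open>\<Omega>\<^sup>p\<close>.  The degree 4 is needed only to say
  that a 3-form is closed.\<close>

record ('k, 'a, 'w1, 'w2, 'w3, 'w4) forms =
  ksc :: "'k \<Rightarrow> 'a \<Rightarrow> 'a"
  osc1 :: "'a \<Rightarrow> 'w1 \<Rightarrow> 'w1"
  dd :: "'a \<Rightarrow> 'w1"
  osc2 :: "'a \<Rightarrow> 'w2 \<Rightarrow> 'w2"
  wedge2 :: "'w1 list \<Rightarrow> 'w2"
  osc3 :: "'a \<Rightarrow> 'w3 \<Rightarrow> 'w3"
  wedge3 :: "'w1 list \<Rightarrow> 'w3"
  osc4 :: "'a \<Rightarrow> 'w4 \<Rightarrow> 'w4"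
  wedge4 :: "'w1 list \<Rightarrow> 'w4"

definition forms_of_algebra ::
  "('k::field, 'a::comm_ring_1, 'w1::ab_group_add, 'w2::ab_group_add, 'w3::ab_group_add,
    'w4::ab_group_add) forms \<Rightarrow> bool" where
  "forms_of_algebra D \<longleftrightarrow> k_algebra (ksc D) \<and>
     kaehler_differentials (ksc D) (osc1 D) (dd D) \<and>
     exterior_power 2 (osc1 D) (osc2 D) (wedge2 D) \<and>
     exterior_power 3 (osc1 D) (osc3 D) (wedge3 D) \<and>
     exterior_power 4 (osc1 D) (osc4 D) (wedge4 D)"

text \<open>The de Rham differential is the additive map with
  \<open>a \<partial>b\<^sub>1 \<and> \<dots> \<and> \<partial>b\<^sub>p \<mapsto> \<partial>a \<and> \<partial>b\<^sub>1 \<and> \<dots> \<and> \<partial>b\<^sub>p\<close>.\<close>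

definition d2 :: "('k, 'a, 'w1, 'w2::ab_group_add, 'w3::ab_group_add, 'w4) forms \<Rightarrow> 'w2 \<Rightarrow> 'w3" where
  "d2 D = (THE \<phi>. additive \<phi> \<and> (\<forall>a bs. length bs = 2 \<longrightarrow>
     \<phi> (osc2 D a (wedge2 D (map (dd D) bs))) = wedge3 D (map (dd D) (a # bs))))"

definition d3 :: "('k, 'a, 'w1, 'w2, 'w3::ab_group_add, 'w4::ab_group_add) forms \<Rightarrow> 'w3 \<Rightarrow> 'w4" where
  "d3 D = (THE \<phi>. additive \<phi> \<and> (\<forall>a bs. length bs = 3 \<longrightarrow>
     \<phi> (osc3 D a (wedge3 D (map (dd D) bs))) = wedge4 D (map (dd D) (a # bs))))"

definition Der :: "('k::field, 'a::comm_ring_1, 'w1, 'w2, 'w3, 'w4) forms \<Rightarrow> ('a \<Rightarrow> 'a) set" where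
  "Der D = {t. Vector_Spaces.linear (ksc D) (ksc D) t \<and> (\<forall>a b. t (a * b) = a * t b + b * t a)}"

definition bracket :: "('a::comm_ring_1 \<Rightarrow> 'a) \<Rightarrow> ('a \<Rightarrow> 'a) \<Rightarrow> 'a \<Rightarrow> 'a" where
  "bracket s t = (\<lambda>x. s (t x) - t (s x))"

definition tsc :: "'a::comm_ring_1 \<Rightarrow> ('a \<Rightarrow> 'a) \<Rightarrow> 'a \<Rightarrow> 'a" where
  "tsc a t = (\<lambda>x. a * t x)"

text \<open>The standard pairing and the Lie derivative; the second equation for \<open>lie\<close> is
  \<open>\<tau>(a \<partial>b) = \<tau>(a) \<partial>b + a \<partial>\<tau>(b)\<close>.\<close>

definition pair :: "('k, 'a::comm_ring_1, 'w1::ab_group_add, 'w2, 'w3, 'w4) forms \<Rightarrow>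
    ('a \<Rightarrow> 'a) \<Rightarrow> 'w1 \<Rightarrow> 'a" where
  "pair D t = (THE \<phi>. module_hom (osc1 D) (*) \<phi> \<and> (\<forall>b. \<phi> (dd D b) = t b))"

definition lie :: "('k, 'a::comm_ring_1, 'w1::ab_group_add, 'w2, 'w3, 'w4) forms \<Rightarrow>
    ('a \<Rightarrow> 'a) \<Rightarrow> 'w1 \<Rightarrow> 'w1" where
  "lie D t = (THE \<phi>. additive \<phi> \<and>
     (\<forall>a b. \<phi> (osc1 D a (dd D b)) = osc1 D (t a) (dd D b) + osc1 D a (dd D (t b))))"

text \<open>Evaluation of forms on vector fields, normalised without factorials:
  \<open>(w\<^sub>1 \<and> \<dots> \<and> w\<^sub>p)(t\<^sub>1,\<dots>,t\<^sub>p) = det \<langle>t\<^sub>i, w\<^sub>j\<rangle>\<close>.\<close>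

definition eval2 :: "('k, 'a::comm_ring_1, 'w1::ab_group_add, 'w2::ab_group_add, 'w3, 'w4) forms \<Rightarrow>
    'w2 \<Rightarrow> ('a \<Rightarrow> 'a) list \<Rightarrow> 'a" where
  "eval2 D \<eta> ts = (THE \<phi>. module_hom (osc2 D) (*) \<phi> \<and> (\<forall>ws. length ws = 2 \<longrightarrow>
     \<phi> (wedge2 D ws) = det (mat 2 2 (\<lambda>(i, j). pair D (ts ! i) (ws ! j))))) \<eta>"

definition eval3 :: "('k, 'a::comm_ring_1, 'w1::ab_group_add, 'w2, 'w3::ab_group_add, 'w4) forms \<Rightarrow>
    'w3 \<Rightarrow> ('a \<Rightarrow> 'a) list \<Rightarrow> 'a" where
  "eval3 D \<omega> ts = (THE \<phi>. module_hom (osc3 D) (*) \<phi> \<and> (\<forall>ws. length ws = 3 \<longrightarrow>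
     \<phi> (wedge3 D ws) = det (mat 3 3 (\<lambda>(i, j). pair D (ts ! i) (ws ! j))))) \<omega>"

text \<open>Maps defined on \<open>T\<close> (or on \<open>T \<times> T\<close>, \<open>T \<oplus> \<Omega>\<close>, \dots) are total functions with value \<open>0\<close>
  off their domain, so that equality of functions is equality of maps on \<open>T\<close>.
  \<open>form2_map\<close> and \<open>form3_map\<close> are given by \<open>\<langle>t\<^sub>2, \<eta>(t\<^sub>1)\<rangle> = \<eta>(t\<^sub>1,t\<^sub>2)\<close> and
  \<open>\<langle>t\<^sub>3, \<omega>(t\<^sub>1,t\<^sub>2)\<rangle> = \<omega>(t\<^sub>1,t\<^sub>2,t\<^sub>3)\<close>.\<close>

definition form2_map :: "('k::field, 'a::comm_ring_1, 'w1::ab_group_add, 'w2::ab_group_add, 'w3, 'w4) forms \<Rightarrow>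
    'w2 \<Rightarrow> ('a \<Rightarrow> 'a) \<Rightarrow> 'w1" where
  "form2_map D \<eta> t1 = (if t1 \<in> Der D
     then (THE w. \<forall>t2\<in>Der D. pair D t2 w = eval2 D \<eta> [t1, t2]) else 0)"

definition form3_map :: "('k::field, 'a::comm_ring_1, 'w1::ab_group_add, 'w2, 'w3::ab_group_add, 'w4) forms \<Rightarrow>
    'w3 \<Rightarrow> ('a \<Rightarrow> 'a) \<Rightarrow> ('a \<Rightarrow> 'a) \<Rightarrow> 'w1" where
  "form3_map D \<omega> t1 t2 = (if t1 \<in> Der D \<and> t2 \<in> Der D
     then (THE w. \<forall>t3\<in>Der D. pair D t3 w = eval3 D \<omega> [t1, t2, t3]) else 0)"


section \<open>Categories\<close>

text \<open>The same \<open>'m\<close> may represent arrows between different objects; arrows are therefore always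
  considered together with their source and target.\<close>

record ('o, 'm) category =
  Obj :: "'o set"
  Hom :: "'o \<Rightarrow> 'o \<Rightarrow> 'm set"
  Idn :: "'o \<Rightarrow> 'm"
  Cmp :: "'o \<Rightarrow> 'o \<Rightarrow> 'o \<Rightarrow> 'm \<Rightarrow> 'm \<Rightarrow> 'm"  \<comment> \<open>\<open>Cmp C a b c g f\<close> is \<open>g \<circ> f\<close> for \<open>f: a \<rightarrow> b\<close>, \<open>g: b \<rightarrow> c\<close>\<close>

definition is_category :: "('o, 'm) category \<Rightarrow> bool" where
  "is_category C \<longleftrightarrow>
     (\<forall>a\<in>Obj C. Idn C a \<in> Hom C a a) \<and>
     (\<forall>a\<in>Obj C. \<forall>b\<in>Obj C. \<forall>c\<in>Obj C. \<forall>f\<in>Hom C a b. \<forall>g\<in>Hom C b c. Cmp C a b c g f \<in> Hom C a c) \<and>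
     (\<forall>a\<in>Obj C. \<forall>b\<in>Obj C. \<forall>f\<in>Hom C a b.
        Cmp C a a b f (Idn C a) = f \<and> Cmp C a b b (Idn C b) f = f) \<and>
     (\<forall>a\<in>Obj C. \<forall>b\<in>Obj C. \<forall>c\<in>Obj C. \<forall>d\<in>Obj C. \<forall>f\<in>Hom C a b. \<forall>g\<in>Hom C b c. \<forall>h\<in>Hom C c d.
        Cmp C a c d h (Cmp C a b c g f) = Cmp C a b d (Cmp C b c d h g) f)"

definition is_iso :: "('o, 'm) category \<Rightarrow> 'o \<Rightarrow> 'o \<Rightarrow> 'm \<Rightarrow> bool" where
  "is_iso C a b f \<longleftrightarrow> f \<in> Hom C a b \<and>
     (\<exists>g\<in>Hom C b a. Cmp C a b a g f = Idn C a \<and> Cmp C b a b f g = Idn C b)"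

definition is_groupoid :: "('o, 'm) category \<Rightarrow> bool" where
  "is_groupoid C \<longleftrightarrow> is_category C \<and> (\<forall>a\<in>Obj C. \<forall>b\<in>Obj C. \<forall>f\<in>Hom C a b. is_iso C a b f)"

definition prod_category :: "('o, 'm) category \<Rightarrow> ('p, 'n) category \<Rightarrow> ('o \<times> 'p, 'm \<times> 'n) category" where
  "prod_category C D = \<lparr>
     Obj = Obj C \<times> Obj D,
     Hom = (\<lambda>(a, a') (b, b'). Hom C a b \<times> Hom D a' b'),
     Idn = (\<lambda>(a, a'). (Idn C a, Idn D a')),
     Cmp = (\<lambda>(a, a') (b, b') (c, c') (g, g') (f, f'). (Cmp C a b c g f, Cmp D a' b' c' g' f'))\<rparr>"

record ('o, 'm, 'p, 'n) cat_functor =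
  fobj :: "'o \<Rightarrow> 'p"
  fmap :: "'o \<Rightarrow> 'o \<Rightarrow> 'm \<Rightarrow> 'n"

definition is_functor :: "('o, 'm) category \<Rightarrow> ('p, 'n) category \<Rightarrow> ('o, 'm, 'p, 'n) cat_functor \<Rightarrow> bool" where
  "is_functor C D F \<longleftrightarrow>
     (\<forall>a\<in>Obj C. fobj F a \<in> Obj D \<and> fmap F a a (Idn C a) = Idn D (fobj F a)) \<and>
     (\<forall>a\<in>Obj C. \<forall>b\<in>Obj C. \<forall>f\<in>Hom C a b. fmap F a b f \<in> Hom D (fobj F a) (fobj F b)) \<and>
     (\<forall>a\<in>Obj C. \<forall>b\<in>Obj C. \<forall>c\<in>Obj C. \<forall>f\<in>Hom C a b. \<forall>g\<in>Hom C b c.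
        fmap F a c (Cmp C a b c g f) =
          Cmp D (fobj F a) (fobj F b) (fobj F c) (fmap F b c g) (fmap F a b f))"

definition id_functor :: "('o, 'm, 'o, 'm) cat_functor" where
  "id_functor = \<lparr>fobj = (\<lambda>a. a), fmap = (\<lambda>a b f. f)\<rparr>"

definition comp_functor :: "('p, 'n, 'q, 'l) cat_functor \<Rightarrow> ('o, 'm, 'p, 'n) cat_functor \<Rightarrow>
    ('o, 'm, 'q, 'l) cat_functor" where
  "comp_functor G F = \<lparr>fobj = (\<lambda>a. fobj G (fobj F a)),
     fmap = (\<lambda>a b f. fmap G (fobj F a) (fobj F b) (fmap F a b f))\<rparr>"

definition is_natural_iso :: "('o, 'm) category \<Rightarrow> ('p, 'n) category \<Rightarrow> ('o, 'm, 'p, 'n) cat_functor \<Rightarrow>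
    ('o, 'm, 'p, 'n) cat_functor \<Rightarrow> ('o \<Rightarrow> 'n) \<Rightarrow> bool" where
  "is_natural_iso C D F G t \<longleftrightarrow>
     (\<forall>a\<in>Obj C. is_iso D (fobj F a) (fobj G a) (t a)) \<and>
     (\<forall>a\<in>Obj C. \<forall>b\<in>Obj C. \<forall>f\<in>Hom C a b.
        Cmp D (fobj F a) (fobj F b) (fobj G b) (t b) (fmap F a b f) =
        Cmp D (fobj F a) (fobj G a) (fobj G b) (fmap G a b f) (t a))"

definition is_equivalence :: "('o, 'm) category \<Rightarrow> ('p, 'n) category \<Rightarrow> ('o, 'm, 'p, 'n) cat_functor \<Rightarrow> bool" where
  "is_equivalence C D F \<longleftrightarrow> is_functor C D F \<and>
     (\<exists>G s t. is_functor D C G \<and>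
        is_natural_iso C C (comp_functor G F) id_functor s \<and>
        is_natural_iso D D (comp_functor F G) id_functor t)"


section \<open>Abelian groups in categories, Actions, Torseurs\<close>

record ('o, 'm) cat_group =
  carr :: "('o, 'm) category"
  plus_fun :: "('o \<times> 'o, 'm \<times> 'm, 'o, 'm) cat_functor"
  neg_fun :: "('o, 'm, 'o, 'm) cat_functor"
  zero_obj :: "'o"

abbreviation gplus :: "('o, 'm) cat_group \<Rightarrow> 'o \<Rightarrow> 'o \<Rightarrow> 'o" where
  "gplus G a b \<equiv> fobj (plus_fun G) (a, b)"

text \<open>An abelian group object in the category of categories.\<close>

definition abelian_group_in_categories :: "('o, 'm) cat_group \<Rightarrow> bool" where
  "abelian_group_in_categories G \<longleftrightarrow>
     (let C = carr G; z = zero_obj G;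
          m = (\<lambda>a b u a' b' u'. fmap (plus_fun G) (a, a') (b, b') (u, u'))
      in is_category C \<and> is_functor (prod_category C C) C (plus_fun G) \<and>
         is_functor C C (neg_fun G) \<and> z \<in> Obj C \<and>
         (\<forall>a\<in>Obj C. gplus G a z = a \<and> gplus G a (fobj (neg_fun G) a) = z) \<and>
         (\<forall>a\<in>Obj C. \<forall>b\<in>Obj C. gplus G a b = gplus G b a) \<and>
         (\<forall>a\<in>Obj C. \<forall>b\<in>Obj C. \<forall>c\<in>Obj C. gplus G (gplus G a b) c = gplus G a (gplus G b c)) \<and>
         (\<forall>a\<in>Obj C. \<forall>b\<in>Obj C. \<forall>u\<in>Hom C a b.
            m a b u z z (Idn C z) = u \<and>
            m a b u (fobj (neg_fun G) a) (fobj (neg_fun G) b) (fmap (neg_fun G) a b u) = Idn C z) \<and>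
         (\<forall>a\<in>Obj C. \<forall>b\<in>Obj C. \<forall>a'\<in>Obj C. \<forall>b'\<in>Obj C. \<forall>u\<in>Hom C a b. \<forall>u'\<in>Hom C a' b'.
            m a b u a' b' u' = m a' b' u' a b u) \<and>
         (\<forall>a\<in>Obj C. \<forall>b\<in>Obj C. \<forall>a'\<in>Obj C. \<forall>b'\<in>Obj C. \<forall>a''\<in>Obj C. \<forall>b''\<in>Obj C.
          \<forall>u\<in>Hom C a b. \<forall>u'\<in>Hom C a' b'. \<forall>u''\<in>Hom C a'' b''.
            m (gplus G a a') (gplus G b b') (m a b u a' b' u') a'' b'' u'' =
            m a b u (gplus G a' a'') (gplus G b' b'') (m a' b' u' a'' b'' u'')))"

text \<open>A monoidal action \<open>M \<times> G \<rightarrow> M\<close> with associativity constraint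
  \<open>\<alpha> x a b : (x \<cdot> a) \<cdot> b \<rightarrow> x \<cdot> (a + b)\<close> and unit constraint \<open>\<rho> x : x \<cdot> 0 \<rightarrow> x\<close>.  The last three
  conditions are the pentagon and the two triangles; as \<open>G\<close> is strictly associative and unital,
  its own constraints do not appear in them.\<close>

definition is_Action :: "('o, 'm) category \<Rightarrow> ('g, 'u) cat_group \<Rightarrow>
    ('o \<times> 'g, 'm \<times> 'u, 'o, 'm) cat_functor \<Rightarrow> ('o \<Rightarrow> 'g \<Rightarrow> 'g \<Rightarrow> 'm) \<Rightarrow> ('o \<Rightarrow> 'm) \<Rightarrow> bool" where
  "is_Action M G act \<alpha> \<rho> \<longleftrightarrow>
     (let C = carr G; z = zero_obj G;
          ob = (\<lambda>x a. fobj act (x, a));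
          ar = (\<lambda>x y f a b u. fmap act (x, a) (y, b) (f, u))
      in is_category M \<and> abelian_group_in_categories G \<and> is_functor (prod_category M C) M act \<and>
         is_natural_iso (prod_category M (prod_category C C)) M
           \<lparr>fobj = (\<lambda>(x, a, b). ob (ob x a) b),
            fmap = (\<lambda>(x, a, b) (y, a', b') (f, u, v).
              ar (ob x a) (ob y a') (ar x y f a a' u) b b' v)\<rparr>
           \<lparr>fobj = (\<lambda>(x, a, b). ob x (gplus G a b)),
            fmap = (\<lambda>(x, a, b) (y, a', b') (f, u, v).
              ar x y f (gplus G a b) (gplus G a' b') (fmap (plus_fun G) (a, b) (a', b') (u, v)))\<rparr>
           (\<lambda>(x, a, b). \<alpha> x a b) \<and>
         is_natural_iso M M
           \<lparr>fobj = (\<lambda>x. ob x z), fmap = (\<lambda>x y f. ar x y f z z (Idn C z))\<rparr> id_functor \<rho> \<and>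
         (\<forall>x\<in>Obj M. \<forall>a\<in>Obj C. \<forall>b\<in>Obj C. \<forall>c\<in>Obj C.
            Cmp M (ob (ob (ob x a) b) c) (ob (ob x a) (gplus G b c)) (ob x (gplus G a (gplus G b c)))
              (\<alpha> x a (gplus G b c)) (\<alpha> (ob x a) b c) =
            Cmp M (ob (ob (ob x a) b) c) (ob (ob x (gplus G a b)) c) (ob x (gplus G (gplus G a b) c))
              (\<alpha> x (gplus G a b) c)
              (ar (ob (ob x a) b) (ob x (gplus G a b)) (\<alpha> x a b) c c (Idn C c))) \<and>
         (\<forall>x\<in>Obj M. \<forall>a\<in>Obj C. \<alpha> x z a = ar (ob x z) x (\<rho> x) a a (Idn C a)) \<and>
         (\<forall>x\<in>Obj M. \<forall>a\<in>Obj C. \<alpha> x a z = \<rho> (ob x a)))"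

definition is_Torseur :: "('o, 'm) category \<Rightarrow> ('g, 'u) cat_group \<Rightarrow>
    ('o \<times> 'g, 'm \<times> 'u, 'o, 'm) cat_functor \<Rightarrow> ('o \<Rightarrow> 'g \<Rightarrow> 'g \<Rightarrow> 'm) \<Rightarrow> ('o \<Rightarrow> 'm) \<Rightarrow> bool" where
  "is_Torseur M G act \<alpha> \<rho> \<longleftrightarrow> is_Action M G act \<alpha> \<rho> \<and>
     (\<forall>x\<in>Obj M. is_equivalence (carr G) M
        \<lparr>fobj = (\<lambda>a. fobj act (x, a)),
         fmap = (\<lambda>a b u. fmap act (x, a) (x, b) (Idn M x, u))\<rparr>)"


section \<open>The groupoid of vertex algebroids\<close>

record ('a, 'w) valgd =
  gam :: "'a \<Rightarrow> ('a \<Rightarrow> 'a) \<Rightarrow> 'w"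
  frm :: "('a \<Rightarrow> 'a) \<times> 'w \<Rightarrow> ('a \<Rightarrow> 'a) \<times> 'w \<Rightarrow> 'a"
  cc :: "('a \<Rightarrow> 'a) \<Rightarrow> ('a \<Rightarrow> 'a) \<Rightarrow> 'w"

definition linear_map_on :: "'v set \<Rightarrow> ('k \<Rightarrow> 'v \<Rightarrow> 'v) \<Rightarrow> ('k \<Rightarrow> 'z \<Rightarrow> 'z) \<Rightarrow>
    ('v::ab_group_add \<Rightarrow> 'z::ab_group_add) \<Rightarrow> bool" where
  "linear_map_on V s t f \<longleftrightarrow>
     (\<forall>x\<in>V. \<forall>y\<in>V. f (x + y) = f x + f y) \<and> (\<forall>r. \<forall>x\<in>V. f (s r x) = t r (f x))"

definition bilinear_map_on :: "'v set \<Rightarrow> ('k \<Rightarrow> 'v \<Rightarrow> 'v) \<Rightarrow> 'w set \<Rightarrow> ('k \<Rightarrow> 'w \<Rightarrow> 'w) \<Rightarrow>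
    ('k \<Rightarrow> 'z \<Rightarrow> 'z) \<Rightarrow> ('v::ab_group_add \<Rightarrow> 'w::ab_group_add \<Rightarrow> 'z::ab_group_add) \<Rightarrow> bool" where
  "bilinear_map_on V s W s' t f \<longleftrightarrow>
     (\<forall>x\<in>V. linear_map_on W s' t (f x)) \<and> (\<forall>y\<in>W. linear_map_on V s t (\<lambda>x. f x y))"

definition ktsc :: "('k, 'a::comm_ring_1, 'w1, 'w2, 'w3, 'w4) forms \<Rightarrow> 'k \<Rightarrow> ('a \<Rightarrow> 'a) \<Rightarrow> 'a \<Rightarrow> 'a" where
  "ktsc D r t = (\<lambda>x. ksc D r (t x))"

definition kosc :: "('k, 'a::comm_ring_1, 'w1, 'w2, 'w3, 'w4) forms \<Rightarrow> 'k \<Rightarrow> 'w1 \<Rightarrow> 'w1" where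
  "kosc D r w = osc1 D (ksc D r 1) w"

definition half :: "('k::field, 'a::comm_ring_1, 'w1, 'w2, 'w3, 'w4) forms \<Rightarrow> 'w1 \<Rightarrow> 'w1" where
  "half D w = kosc D (1 / 2) w"

definition d_Lie :: "('k, 'a::comm_ring_1, 'w1::ab_group_add, 'w2, 'w3, 'w4) forms \<Rightarrow>
    (('a \<Rightarrow> 'a) \<Rightarrow> ('a \<Rightarrow> 'a) \<Rightarrow> 'w1) \<Rightarrow> ('a \<Rightarrow> 'a) \<Rightarrow> ('a \<Rightarrow> 'a) \<Rightarrow> ('a \<Rightarrow> 'a) \<Rightarrow> 'w1" where
  "d_Lie D c t1 t2 t3 =
     lie D t1 (c t2 t3) - lie D t2 (c t1 t3) + lie D t3 (c t1 t2)
     - c (bracket t1 t2) t3 + c (bracket t1 t3) t2 - c (bracket t2 t3) t1"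

definition is_valgd :: "('k::field, 'a::comm_ring_1, 'w1::ab_group_add, 'w2, 'w3, 'w4) forms \<Rightarrow>
    ('a, 'w1) valgd \<Rightarrow> bool" where
  "is_valgd D V \<longleftrightarrow>
     (let T = Der D; \<gamma> = gam V; c = cc V; h = ksc D (1 / 2);
          TT = (\<lambda>s t. frm V (s, 0) (t, 0)); TO = (\<lambda>t w. frm V (t, 0) (0, w))
      in
        bilinear_map_on UNIV (ksc D) T (ktsc D) (kosc D) \<gamma> \<and>
        (\<forall>a t. t \<notin> T \<longrightarrow> \<gamma> a t = 0) \<and>
        bilinear_map_on (T \<times> UNIV) (\<lambda>r (t, w). (ktsc D r t, kosc D r w))
          (T \<times> UNIV) (\<lambda>r (t, w). (ktsc D r t, kosc D r w)) (ksc D) (frm V) \<and>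
        (\<forall>x y. x \<notin> T \<times> UNIV \<or> y \<notin> T \<times> UNIV \<longrightarrow> frm V x y = 0) \<and>
        (\<forall>x y. frm V x y = frm V y x) \<and>
        (\<forall>w w'. frm V (0, w) (0, w') = 0) \<and>
        (\<forall>t\<in>T. \<forall>w. TO t w = pair D t w) \<and>
        bilinear_map_on T (ktsc D) T (ktsc D) (kosc D) c \<and>
        (\<forall>s t. s \<notin> T \<or> t \<notin> T \<longrightarrow> c s t = 0) \<and>
        (\<forall>s\<in>T. \<forall>t\<in>T. c s t = - c t s) \<and>
        (\<forall>a b. \<forall>t\<in>T. \<gamma> a (tsc b t) =
           \<gamma> (a * b) t - osc1 D a (\<gamma> b t) - osc1 D (t a) (dd D b) - osc1 D (t b) (dd D a)) \<and>
        (\<forall>a. \<forall>t1\<in>T. \<forall>t2\<in>T. TT (tsc a t1) t2 = a * TT t1 t2 + TO t2 (\<gamma> a t1) - t1 (t2 a)) \<and>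
        (\<forall>a. \<forall>t1\<in>T. \<forall>t2\<in>T. c (tsc a t1) t2 =
           osc1 D a (c t1 t2) + \<gamma> a (bracket t1 t2) - \<gamma> (t2 a) t1 + lie D t2 (\<gamma> a t1)
           - half D (osc1 D (TT t1 t2) (dd D a)) + half D (dd D (t1 (t2 a)))
           - half D (dd D (TO t2 (\<gamma> a t1)))) \<and>
        (\<forall>t1\<in>T. \<forall>t2\<in>T. \<forall>t3\<in>T. TT (bracket t1 t2) t3 + TT t2 (bracket t1 t3) =
           t1 (TT t2 t3) - h (t2 (TT t1 t3)) - h (t3 (TT t1 t2))
           + TO t2 (c t1 t3) + TO t3 (c t1 t2)) \<and>
        (\<forall>t1\<in>T. \<forall>t2\<in>T. \<forall>t3\<in>T. d_Lie D c t1 t2 t3 =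
           - half D (dd D (TT (bracket t1 t2) t3 + TT (bracket t1 t3) t2 - TT (bracket t2 t3) t1
             - t1 (TT t2 t3) + t2 (TT t1 t3) - 2 * TO t3 (c t1 t2)))))"

definition is_valgd_hom :: "('k::field, 'a::comm_ring_1, 'w1::ab_group_add, 'w2, 'w3, 'w4) forms \<Rightarrow>
    ('a, 'w1) valgd \<Rightarrow> ('a, 'w1) valgd \<Rightarrow> (('a \<Rightarrow> 'a) \<Rightarrow> 'w1) \<Rightarrow> bool" where
  "is_valgd_hom D V V' h \<longleftrightarrow>
     (let T = Der D in
        linear_map_on T (ktsc D) (kosc D) h \<and>
        (\<forall>t. t \<notin> T \<longrightarrow> h t = 0) \<and>
        (\<forall>a. \<forall>t\<in>T. h (tsc a t) = osc1 D a (h t) - gam V' a t + gam V a t) \<and>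
        (\<forall>t1\<in>T. \<forall>t2\<in>T. frm V (t1, 0) (t2, 0) =
           frm V' (t1, 0) (t2, 0) + pair D t1 (h t2) + pair D t2 (h t1)) \<and>
        (\<forall>t1\<in>T. \<forall>t2\<in>T. cc V t1 t2 =
           cc V' t1 t2 + half D (dd D (pair D t1 (h t2))) - half D (dd D (pair D t2 (h t1)))
           - lie D t1 (h t2) + lie D t2 (h t1) + h (bracket t1 t2)))"

definition Alg :: "('k::field, 'a::comm_ring_1, 'w1::ab_group_add, 'w2, 'w3, 'w4) forms \<Rightarrow>
    (('a, 'w1) valgd, ('a \<Rightarrow> 'a) \<Rightarrow> 'w1) category" where
  "Alg D = \<lparr>
     Obj = {V. is_valgd D V},
     Hom = (\<lambda>V V'. {h. is_valgd_hom D V V' h}),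
     Idn = (\<lambda>V t. 0),
     Cmp = (\<lambda>V V' V'' h' h t. h' t + h t)\<rparr>"

definition Omega23 :: "('k, 'a, 'w1, 'w2::ab_group_add, 'w3::ab_group_add, 'w4::ab_group_add) forms \<Rightarrow>
    ('w3, 'w2) cat_group" where
  "Omega23 D = \<lparr>
     carr = \<lparr>
       Obj = {\<omega>. d3 D \<omega> = 0},
       Hom = (\<lambda>\<omega> \<omega>'. {\<eta>. d2 D \<eta> = \<omega>' - \<omega>}),
       Idn = (\<lambda>\<omega>. 0),
       Cmp = (\<lambda>\<omega> \<omega>' \<omega>'' \<eta>' \<eta>. \<eta>' + \<eta>)\<rparr>,
     plus_fun = \<lparr>fobj = (\<lambda>(\<omega>, \<omega>'). \<omega> + \<omega>'), fmap = (\<lambda>_ _ (\<eta>, \<eta>'). \<eta> + \<eta>')\<rparr>,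
     neg_fun = \<lparr>fobj = (\<lambda>\<omega>. - \<omega>), fmap = (\<lambda>_ _ \<eta>. - \<eta>)\<rparr>,
     zero_obj = 0\<rparr>"

definition dotplus :: "('k::field, 'a::comm_ring_1, 'w1::ab_group_add, 'w2::ab_group_add,
    'w3::ab_group_add, 'w4) forms \<Rightarrow>
    (('a, 'w1) valgd \<times> 'w3, (('a \<Rightarrow> 'a) \<Rightarrow> 'w1) \<times> 'w2, ('a, 'w1) valgd, ('a \<Rightarrow> 'a) \<Rightarrow> 'w1) cat_functor" where
  "dotplus D = \<lparr>
     fobj = (\<lambda>(V, \<omega>). V\<lparr>cc := (\<lambda>t1 t2. cc V t1 t2 + form3_map D \<omega> t1 t2)\<rparr>),
     fmap = (\<lambda>_ _ (h, \<eta>) t. h t + form2_map D \<eta> t)\<rparr>"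

end

theory Submission
  imports Defs
begin

text \<open>The Jacobian criterion makes \<open>\<Omega>\<close> finitely generated projective with dual \<open>T\<close>: there are derivations
  \<open>t\<^sub>i\<close> and elements \<open>y\<^sub>i\<close> with \<open>\<partial>b = \<Sum> t\<^sub>i(b) \<partial>y\<^sub>i\<close> for all \<open>b\<close>.  Locally the \<open>t\<^sub>i\<close> come from Cramer's rule, and the
  \<open>h\<close> for which \<open>h \<partial>b\<close> has such an expansion form an ideal that lies in no prime.  Consequently \<open>p\<close>-forms
  are the same as alternating \<open>A\<close>-multilinear functions on \<open>T\<close>, the de Rham differential being given by the
  Cartan formula, and the conditions on a vertex algebroid or a morphism become identities of functions on \<open>T\<close>.
  Changing \<open>c\<close> by a 3-form preserves the axioms exactly when the form is closed, and the morphisms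
  \<open>\<A> \<dotplus> \<omega> \<rightarrow> \<A> \<dotplus> \<omega>'\<close> are exactly the 2-forms \<open>\<eta>\<close> with \<open>d\<eta> = \<omega>' - \<omega>\<close>.  Any two algebroids are related in this
  way: by projectivity of \<open>T\<close> there is an \<open>h\<close> matching \<open>\<gamma>\<close> and \<open>\<langle>,\<rangle>\<close>, and the remaining defect in \<open>c\<close> is
  a closed 3-form.\<close>

section \<open>Presented modules\<close>

text \<open>All operations on forms are definite descriptions, so unique existence comes first. The
  presentations supply the A-linear maps \<open>pair\<close>, \<open>eval2\<close> and
  \<open>eval3\<close>. They cannot supply \<open>lie\<close>, \<open>d2\<close> and
  \<open>d3\<close>, which are additive without being A-linear: these are written down in dual-basis
  coordinates, from the formula that their values on vector fields have to satisfy. Characteristic 0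
  enters in two ways. Recovering a form from its values sums over all words in the indices of the
  dual basis, not only the increasing ones, and so produces every p-form p! times, for p up to 4.
  Moreover 1/2 occurs in the axioms, corrects a morphism on the pairings, and turns skew maps into
  alternating ones. The maps attached to forms are additive in the form as total functions, so the
  Action is strict: both constraints are identities and coherence is immediate. The content of the
  Torseur property is that adding forms to a fixed algebroid is fully faithful and essentially
  surjective.\<close>

lemma free_scale_lookup: "Poly_Mapping.lookup (free_scale a u) g = a * Poly_Mapping.lookup u g"
  unfolding free_scale_def by (simp add: Poly_Mapping.map.rep_eq when_def)

lemma module_free_scale: "Modules.module free_scale"
  by unfold_locales
    (auto intro!: poly_mapping_eqI simp: free_scale_lookup lookup_add algebra_simps)

lemma free_ext_superset:
  assumes "Modules.module s" "finite K" "Poly_Mapping.keys u \<subseteq> K"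
  shows "free_ext s f u = (\<Sum>g\<in>K. s (Poly_Mapping.lookup u g) (f g))"
  unfolding free_ext_def
  using assms(2,3)
  by (intro sum.mono_neutral_left) (auto simp: module.scale_zero_left[OF assms(1)] in_keys_iff)

lemma module_hom_free_ext:
  fixes s :: "'a::comm_ring_1 \<Rightarrow> 'n::ab_group_add \<Rightarrow> 'n" and f :: "'g \<Rightarrow> 'n"
  assumes s: "Modules.module s"
  shows "module_hom free_scale s (free_ext s f)"
proof -
  interpret s: Modules.module s by fact
  interpret F: Modules.module free_scale by (rule module_free_scale)
  show ?thesis
  proof
    fix u v :: "'g \<Rightarrow>\<^sub>0 'a"
    let ?K = "Poly_Mapping.keys u \<union> Poly_Mapping.keys v"
    have "Poly_Mapping.keys (u + v) \<subseteq> ?K" by (rule Poly_Mapping.keys_add)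
    then show "free_ext s f (u + v) = free_ext s f u + free_ext s f v"
      by (simp add: free_ext_superset[OF s, of ?K] lookup_add s.scale_left_distrib sum.distrib)
  next
    fix a and u :: "'g \<Rightarrow>\<^sub>0 'a"
    have "Poly_Mapping.keys (free_scale a u) \<subseteq> Poly_Mapping.keys u"
      by (auto simp: in_keys_iff free_scale_lookup)
    then show "free_ext s f (free_scale a u) = s a (free_ext s f u)"
      by (simp add: free_ext_superset[OF s, of "Poly_Mapping.keys u"] free_scale_lookup s.scale_sum_right)
  qed
qed

lemma free_ext_single:
  assumes "Modules.module s"
  shows "free_ext s f (Poly_Mapping.single g a) = s a (f g)"
  using assms by (simp add: free_ext_superset[OF assms, of "{g}"])

lemma presented_module: "presented_by s e G R \<Longrightarrow> Modules.module s"
  unfolding presented_by_def by blast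

lemma presented_rel:
  assumes "presented_by s e G R" "u \<in> R"
  shows "free_ext s e u = 0"
proof -
  have "u \<in> Modules.module.span free_scale R"
    by (rule module.span_base[OF module_free_scale assms(2)])
  then show ?thesis using assms(1) unfolding presented_by_def by blast
qed

lemma presented_induct:
  assumes pr: "presented_by s e G R"
    and z: "P 0" and add: "\<And>x y. P x \<Longrightarrow> P y \<Longrightarrow> P (x + y)"
    and g: "\<And>a g. g \<in> G \<Longrightarrow> P (s a (e g))"
  shows "P x"
proof -
  obtain u where u: "Poly_Mapping.keys u \<subseteq> G" "x = free_ext s e u"
    using pr unfolding presented_by_def by (metis (mono_tags, lifting) UNIV_I imageE mem_Collect_eq)
  have "P (\<Sum>g\<in>K. s (Poly_Mapping.lookup u g) (e g))" if "finite K" "K \<subseteq> G" for K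
    using that by induct (auto intro!: z add g)
  then show ?thesis using u by (simp add: free_ext_def)
qed

text \<open>The Lie derivative is additive but not A-linear, so agreement has to be known on all
  multiples of the generators, not only on the generators.\<close>

lemma presented_additive_unique:
  assumes pr: "presented_by s e G R" and "additive \<phi>" "additive \<psi>"
    and "\<And>a g. g \<in> G \<Longrightarrow> \<phi> (s a (e g)) = \<psi> (s a (e g))"
  shows "\<phi> = \<psi>"
proof
  fix x
  show "\<phi> x = \<psi> x"
    by (rule presented_induct[OF pr])
      (simp_all add: assms(4) additive.add[OF assms(2)] additive.add[OF assms(3)]
        additive.zero[OF assms(2)] additive.zero[OF assms(3)])
qed

lemma module_hom_additive: "module_hom s s' \<phi> \<Longrightarrow> additive \<phi>"
  by (simp add: additive_def module_hom.add)

lemma presented_hom_unique: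
  assumes pr: "presented_by s e G R" and h: "module_hom s s' \<phi>" "module_hom s s' \<psi>"
    and "\<And>g. g \<in> G \<Longrightarrow> \<phi> (e g) = \<psi> (e g)"
  shows "\<phi> = \<psi>"
  using presented_additive_unique[OF pr h[THEN module_hom_additive]] assms(4)
  by (simp add: module_hom.scale[OF h(1)] module_hom.scale[OF h(2)])

text \<open>Universal property of generators and relations. The map is \<open>free_ext s' f\<close>
  at a chosen preimage \<open>U x\<close> in the free module; two preimages differ by an element of
  the span of \<open>R\<close>, where \<open>free_ext s' f\<close> vanishes, so the choice does not
  matter.\<close>

lemma presented_ext:
  fixes s :: "'a::comm_ring_1 \<Rightarrow> 'n::ab_group_add \<Rightarrow> 'n" and s' :: "'a \<Rightarrow> 'm::ab_group_add \<Rightarrow> 'm"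
    and e :: "'g \<Rightarrow> 'n" and f :: "'g \<Rightarrow> 'm"
  assumes pr: "presented_by s e G R" and s': "Modules.module s'"
    and rel: "\<And>u. u \<in> R \<Longrightarrow> free_ext s' f u = 0"
  shows "\<exists>!\<phi>. module_hom s s' \<phi> \<and> (\<forall>g\<in>G. \<phi> (e g) = f g)"
proof -
  interpret s: Modules.module s by (rule presented_module[OF pr])
  interpret s': Modules.module s' by fact
  interpret F: Modules.module "free_scale :: 'a \<Rightarrow> ('g \<Rightarrow>\<^sub>0 'a) \<Rightarrow> _" by (rule module_free_scale)
  interpret E: module_hom free_scale s "free_ext s e" by (rule module_hom_free_ext) unfold_locales
  interpret E': module_hom free_scale s' "free_ext s' f" by (rule module_hom_free_ext) unfold_locales
  let ?K = "{u. Poly_Mapping.keys u \<subseteq> G}"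
  have "\<exists>u\<in>?K. free_ext s e u = x" for x
    using pr unfolding presented_by_def by (metis (no_types, lifting) UNIV_I imageE)
  then obtain U where U: "\<And>x. U x \<in> ?K" "\<And>x. free_ext s e (U x) = x" by metis
  have span0: "free_ext s' f u = 0" if "u \<in> F.span R" for u
  proof -
    have "F.subspace {u. free_ext s' f u = 0}"
      by (auto simp: F.subspace_def E'.add E'.scale E'.zero)
    then have "F.span R \<subseteq> {u. free_ext s' f u = 0}"
      using rel by (intro F.span_minimal) auto
    then show ?thesis using that by auto
  qed
  have eq: "free_ext s' f u = free_ext s' f v"
    if "u \<in> ?K" "v \<in> ?K" "free_ext s e u = free_ext s e v" for u v
  proof -
    have "Poly_Mapping.keys (u - v) \<subseteq> G"
      using that by (auto simp: in_keys_iff lookup_minus) (metis in_keys_iff subset_iff)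
    then have "u - v \<in> F.span R"
      using pr that unfolding presented_by_def by (auto simp: E.diff)
    then show ?thesis using span0[of "u - v"] by (simp add: E'.diff)
  qed
  define \<phi> where "\<phi> x = free_ext s' f (U x)" for x
  have "module_hom s s' \<phi>"
  proof
    fix x y
    have "U x + U y \<in> ?K" using U(1)[of x] U(1)[of y] Poly_Mapping.keys_add[of "U x" "U y"] by auto
    then show "\<phi> (x + y) = \<phi> x + \<phi> y"
      unfolding \<phi>_def E'.add[symmetric] by (intro eq U) (simp_all add: U E.add)
  next
    fix a x
    have "free_scale a (U x) \<in> ?K"
      using U(1)[of x] by (auto simp: in_keys_iff free_scale_lookup) (metis in_keys_iff mult_zero_right subset_iff)
    then show "\<phi> (s a x) = s' a (\<phi> x)"
      unfolding \<phi>_def E'.scale[symmetric] by (intro eq U) (simp_all add: U E.scale)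
  qed
  moreover have "\<phi> (e g) = f g" if "g \<in> G" for g
  proof -
    have "free_ext s' f (U (e g)) = free_ext s' f (Poly_Mapping.single g 1)"
      using that by (intro eq U) (simp_all add: U free_ext_single s.module_axioms)
    then show ?thesis by (simp add: \<phi>_def free_ext_single s'.module_axioms)
  qed
  ultimately show ?thesis
    by (intro ex1I[of _ \<phi>]) (auto intro!: presented_hom_unique[OF pr])
qed


section \<open>Alternating maps\<close>

text \<open>The set \<open>S\<close> lets one notion serve both for 1-forms
  (\<open>S = UNIV\<close>) and for vector fields, which are a subset of a function type. Vanishing
  on repeated entries, rather than a change of sign, matches the relations of the exterior
  power.\<close>

definition alt_on :: "nat \<Rightarrow> 'v::ab_group_add set \<Rightarrow> ('a::comm_ring_1 \<Rightarrow> 'v \<Rightarrow> 'v) \<Rightarrow>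
    ('a \<Rightarrow> 'n::ab_group_add \<Rightarrow> 'n) \<Rightarrow> ('v list \<Rightarrow> 'n) \<Rightarrow> bool" where
  "alt_on p S sV sN L \<longleftrightarrow>
     (\<forall>xs x y ys. set (xs @ x # y # ys) \<subseteq> S \<longrightarrow> length xs + length ys + 1 = p \<longrightarrow>
        L (xs @ (x + y) # ys) = L (xs @ x # ys) + L (xs @ y # ys)) \<and>
     (\<forall>xs a x ys. set (xs @ x # ys) \<subseteq> S \<longrightarrow> length xs + length ys + 1 = p \<longrightarrow>
        L (xs @ sV a x # ys) = sN a (L (xs @ x # ys))) \<and>
     (\<forall>xs. set xs \<subseteq> S \<longrightarrow> length xs = p \<longrightarrow> \<not> distinct xs \<longrightarrow> L xs = 0)"

lemma alt_onD:
  assumes "alt_on p S sV sN L"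
  shows "set (xs @ x # y # ys) \<subseteq> S \<Longrightarrow> length xs + length ys + 1 = p \<Longrightarrow>
        L (xs @ (x + y) # ys) = L (xs @ x # ys) + L (xs @ y # ys)"
    and "set (xs @ x # ys) \<subseteq> S \<Longrightarrow> length xs + length ys + 1 = p \<Longrightarrow>
        L (xs @ sV a x # ys) = sN a (L (xs @ x # ys))"
    and "set xs \<subseteq> S \<Longrightarrow> length xs = p \<Longrightarrow> \<not> distinct xs \<Longrightarrow> L xs = 0"
  using assms unfolding alt_on_def by blast+

lemma lists_Suc_eq:
  "{is. length is = Suc k \<and> set is \<subseteq> A} = (\<lambda>(i, is). i # is) ` (A \<times> {is. length is = k \<and> set is \<subseteq> A})"
  by (auto simp: length_Suc_conv image_iff)

lemma sum_lists_Suc: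
  "(\<Sum>is | length is = Suc k \<and> set is \<subseteq> A. f is) = (\<Sum>i\<in>A. \<Sum>is | length is = k \<and> set is \<subseteq> A. f (i # is))"
  unfolding lists_Suc_eq
  by (subst sum.reindex) (auto simp: inj_on_def sum.cartesian_product case_prod_unfold)

locale alternating =
  V: Modules.module sV + N: Modules.module sN
  for sV :: "'a::comm_ring_1 \<Rightarrow> 'v::ab_group_add \<Rightarrow> 'v" and sN :: "'a \<Rightarrow> 'n::ab_group_add \<Rightarrow> 'n" +
  fixes p S L
  assumes sub: "V.subspace S" and alt: "alt_on p S sV sN L"
begin

lemma S_sum: "(\<And>i. i \<in> I \<Longrightarrow> x i \<in> S) \<Longrightarrow> (\<Sum>i\<in>I. sV (c i) (x i)) \<in> S"
  using sub by (auto intro!: V.subspace_sum V.subspace_scale)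

lemma L_zero:
  assumes "set (xs @ ys) \<subseteq> S" "length xs + length ys + 1 = p"
  shows "L (xs @ 0 # ys) = 0"
  using alt_onD(2)[OF alt, of xs 0 ys 0] assms V.subspace_0[OF sub] by simp

lemma L_sum:
  assumes "finite I" "set (xs @ ys) \<subseteq> S" "length xs + length ys + 1 = p" "\<And>i. i \<in> I \<Longrightarrow> x i \<in> S"
  shows "L (xs @ (\<Sum>i\<in>I. sV (c i) (x i)) # ys) = (\<Sum>i\<in>I. sN (c i) (L (xs @ x i # ys)))"
  using assms(1,4)
proof (induct I)
  case empty
  then show ?case using L_zero assms by simp
next
  case (insert i I)
  have *: "(\<Sum>i\<in>I. sV (c i) (x i)) \<in> S" "sV (c i) (x i) \<in> S"
    using insert sub by (auto intro!: S_sum V.subspace_scale)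
  show ?case
    using insert * assms(2,3) by (simp add: alt_onD(1)[OF alt] alt_onD(2)[OF alt])
qed

text \<open>The prefix \<open>xs\<close> collects the entries that are already expanded; this is
  what the induction on \<open>ws\<close> needs. The family \<open>x\<close> only has to generate:
  \<open>c i w\<close> is some chosen coordinate of \<open>w\<close>.\<close>

lemma L_expand:
  assumes "finite A" "\<And>i. i \<in> A \<Longrightarrow> x i \<in> S" "\<And>w. w \<in> set ws \<Longrightarrow> w = (\<Sum>i\<in>A. sV (c i w) (x i))"
    and "set xs \<subseteq> S" "length xs + length ws = p"
  shows "L (xs @ ws) = (\<Sum>is | length is = length ws \<and> set is \<subseteq> A.
           sN (\<Prod>b<length ws. c (is ! b) (ws ! b)) (L (xs @ map x is)))"
  using assms(3-5)
proof (induct ws arbitrary: xs)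
  case Nil
  have "{is. is = [] \<and> set is \<subseteq> A} = {[]}" by auto
  then show ?case by simp
next
  case (Cons w ws)
  have wsS: "set ws \<subseteq> S" using Cons.prems(1) assms(2) by (auto simp del: set_simps) (metis S_sum list.set_intros(2))
  have "L (xs @ w # ws) = L (xs @ (\<Sum>i\<in>A. sV (c i w) (x i)) # ws)"
    using Cons.prems(1)[of w] by simp
  also have "\<dots> = (\<Sum>i\<in>A. sN (c i w) (L ((xs @ [x i]) @ ws)))"
    using assms(1,2) Cons.prems wsS by (subst L_sum) auto
  also have "\<dots> = (\<Sum>i\<in>A. sN (c i w) (\<Sum>is | length is = length ws \<and> set is \<subseteq> A.
           sN (\<Prod>b<length ws. c (is ! b) (ws ! b)) (L ((xs @ [x i]) @ map x is))))"
    using Cons.prems assms(2) by (intro sum.cong refl arg_cong[where f="sN _"] Cons.hyps) auto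
  also have "\<dots> = (\<Sum>is | length is = Suc (length ws) \<and> set is \<subseteq> A.
           sN (\<Prod>b<Suc (length ws). c (is ! b) ((w # ws) ! b)) (L (xs @ map x is)))"
    by (simp add: sum_lists_Suc N.scale_sum_right prod.lessThan_Suc_shift del: prod.lessThan_Suc)
  finally show ?case by simp
qed

text \<open>Polarisation: expand the value at a list with \<open>x + y\<close> in both places, which
  is 0, and drop the two terms with a repeated entry.\<close>

lemma L_swap:
  assumes "set (xs @ x # ys @ y # zs) \<subseteq> S" "length xs + length ys + length zs + 2 = p"
  shows "L (xs @ y # ys @ x # zs) = - L (xs @ x # ys @ y # zs)"
proof -
  have xy: "x + y \<in> S" using assms V.subspace_add[OF sub] by auto
  have "0 = L (xs @ (x + y) # ys @ (x + y) # zs)"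
    using assms xy by (subst alt_onD(3)[OF alt]) auto
  also have "\<dots> = L (xs @ x # ys @ (x + y) # zs) + L (xs @ y # ys @ (x + y) # zs)"
    using assms xy by (intro alt_onD(1)[OF alt]) auto
  also have "L (xs @ x # ys @ (x + y) # zs) = L (xs @ x # ys @ x # zs) + L (xs @ x # ys @ y # zs)"
    using alt_onD(1)[OF alt, of "xs @ x # ys" x y zs] assms xy by auto
  also have "L (xs @ x # ys @ x # zs) = 0"
    using assms by (subst alt_onD(3)[OF alt]) auto
  also have "L (xs @ y # ys @ (x + y) # zs) = L (xs @ y # ys @ x # zs) + L (xs @ y # ys @ y # zs)"
    using alt_onD(1)[OF alt, of "xs @ y # ys" x y zs] assms xy by auto
  also have "L (xs @ y # ys @ y # zs) = 0"
    using assms by (subst alt_onD(3)[OF alt]) auto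
  finally show ?thesis by (simp add: eq_neg_iff_add_eq_0 add.commute)
qed

lemma L_transpose:
  assumes "set ws \<subseteq> S" "length ws = p" "i < j" "j < p"
  shows "L (map (\<lambda>k. ws ! Transposition.transpose i j k) [0..<p]) = - L ws"
proof -
  define xs ys zs where "xs = take i ws" "ys = take (j - Suc i) (drop (Suc i) ws)" "zs = drop (Suc j) ws"
  have ws: "ws = xs @ ws ! i # ys @ ws ! j # zs"
  proof -
    have "drop (Suc i) ws = take (j - Suc i) (drop (Suc i) ws) @ drop (j - Suc i) (drop (Suc i) ws)"
      by (rule append_take_drop_id[symmetric])
    also have "drop (j - Suc i) (drop (Suc i) ws) = drop j ws" using assms by simp
    also have "drop j ws = ws ! j # drop (Suc j) ws" using assms by (simp add: Cons_nth_drop_Suc)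
    finally show ?thesis using assms id_take_nth_drop[of i ws] by (simp add: xs_ys_zs_def)
  qed
  have len: "length xs = i" "length ys = j - Suc i" using assms by (auto simp: xs_ys_zs_def)
  have lz: "i + (j - Suc i) + length zs + 2 = p" using assms by (auto simp: xs_ys_zs_def)
  have "map (\<lambda>k. ws ! Transposition.transpose i j k) [0..<p] = (ws[i := ws ! j])[j := ws ! i]"
    using assms by (intro nth_equalityI) (auto simp: nth_list_update Transposition.transpose_def)
  also have "\<dots> = xs @ ws ! j # ys @ ws ! i # zs"
  proof -
    have upd: "(us @ a # vs @ b # zs)[length us := b, length us + Suc (length vs) := a] = us @ b # vs @ a # zs"
      for us vs and a b :: 'v by (simp add: list_update_append)
    have j: "j = i + Suc (length ys)" using len assms by simp
    have "(xs @ ws ! i # ys @ ws ! j # zs)[i := ws ! j, j := ws ! i] = xs @ ws ! j # ys @ ws ! i # zs"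
      using upd[of xs "ws ! i" ys "ws ! j"] unfolding len(1) j[symmetric] .
    then show ?thesis unfolding ws[symmetric] .
  qed
  also have "L \<dots> = - L (xs @ ws ! i # ys @ ws ! j # zs)"
    using assms ws len lz by (intro L_swap) (metis, simp)
  finally show ?thesis using ws by simp
qed

lemma L_permute:
  assumes "\<pi> permutes {0..<p}" "set ws \<subseteq> S" "length ws = p"
  shows "L (map (\<lambda>k. ws ! \<pi> k) [0..<p]) = sN (signof \<pi>) (L ws)"
  using assms(1) finite_atLeastLessThan assms(2,3)
proof (induct \<pi> arbitrary: ws rule: permutes_induct)
  case id
  then show ?case using map_nth[of ws] by simp
next
  case (swap i j \<pi>)
  let ?\<tau> = "Transposition.transpose i j"
  let ?ws = "map (\<lambda>k. ws ! ?\<tau> k) [0..<p]"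
  have \<pi>: "\<pi> k < p" if "k < p" for k
    using permutes_in_image[OF swap(5), of k] that by auto
  have \<tau>: "?\<tau> k < p" if "k < p" for k
    using swap(1,2) that by (auto simp: Transposition.transpose_def)
  \<comment> \<open>Reading \<open>ws\<close> along the composite is reading the transposed list
    along \<open>\<pi>\<close>, so the induction hypothesis is applied to the transposed
    list.\<close>
  have "L (map (\<lambda>k. ws ! (?\<tau> \<circ> \<pi>) k) [0..<p]) = L (map (\<lambda>k. ?ws ! \<pi> k) [0..<p])"
    using \<pi> by (intro arg_cong[where f=L]) auto
  also have "\<dots> = sN (signof \<pi>) (L ?ws)"
    using swap.prems \<tau> by (intro swap(4)) (auto simp: subset_iff)
  also have "L ?ws = - L ws"
  proof (cases "i < j")
    case True
    then show ?thesis using swap by (intro L_transpose) auto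
  next
    case False
    then show ?thesis using swap by (subst transpose_commute) (intro L_transpose, auto)
  qed
  moreover have "sign (?\<tau> \<circ> \<pi>) = - sign \<pi>"
    using swap(3,5) by (subst sign_compose)
      (auto simp: sign_swap_id permutation_swap_id intro: permutes_imp_permutation[OF finite_atLeastLessThan])
  ultimately show ?case by (simp add: N.scale_minus_left N.scale_minus_right del: o_apply)
qed

text \<open>In the Leibniz formula the summand of a permutation \<open>\<pi>\<close> is, up to its
  sign, the multilinear expansion of \<open>L\<close> at the permuted list, that is, once more the
  sign of \<open>\<pi>\<close> times \<open>L ws\<close>. The two signs cancel, and each of the p!
  permutations contributes \<open>L ws\<close>.\<close>

lemma det_expand:
  assumes "finite A" "\<And>i. i \<in> A \<Longrightarrow> x i \<in> S" "\<And>w. w \<in> set ws \<Longrightarrow> w = (\<Sum>i\<in>A. sV (c i w) (x i))"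
    and ws: "length ws = p"
  shows "(\<Sum>is | length is = p \<and> set is \<subseteq> A.
           sN (det (mat p p (\<lambda>(a, b). c (is ! a) (ws ! b)))) (L (map x is))) = sN (of_nat (fact p)) (L ws)"
proof -
  have wsS: "set ws \<subseteq> S" using assms(2,3) by (metis S_sum subsetI)
  let ?P = "{\<pi>. \<pi> permutes {0..<p}}" and ?I = "{is. length is = p \<and> set is \<subseteq> A}"
  have "(\<Sum>is\<in>?I. sN (det (mat p p (\<lambda>(a, b). c (is ! a) (ws ! b)))) (L (map x is)))
    = (\<Sum>is\<in>?I. \<Sum>\<pi>\<in>?P. sN (signof \<pi>) (sN (\<Prod>a<p. c (is ! a) (ws ! \<pi> a)) (L (map x is))))"
  proof (intro sum.cong refl)
    fix js
    have "det (mat p p (\<lambda>(a, b). c (js ! a) (ws ! b))) =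
      (\<Sum>\<pi>\<in>?P. signof \<pi> * (\<Prod>a<p. c (js ! a) (ws ! \<pi> a)))"
      by (subst det_def'[where n=p], simp)
       (auto intro!: sum.cong prod.cong arg_cong2[where f="(*)"] simp: permutes_in_image atLeast0LessThan[symmetric])
    then show "sN (det (mat p p (\<lambda>(a, b). c (js ! a) (ws ! b)))) (L (map x js)) =
        (\<Sum>\<pi>\<in>?P. sN (signof \<pi>) (sN (\<Prod>a<p. c (js ! a) (ws ! \<pi> a)) (L (map x js))))"
      by (simp add: N.scale_sum_left)
  qed
  also have "\<dots> = (\<Sum>\<pi>\<in>?P. sN (signof \<pi>) (\<Sum>is\<in>?I. sN (\<Prod>a<p. c (is ! a) (ws ! \<pi> a)) (L (map x is))))"
    by (subst sum.swap) (simp only: N.scale_sum_right)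
  also have "\<dots> = (\<Sum>\<pi>\<in>?P. L ws)"
  proof (intro sum.cong refl)
    fix \<pi> assume "\<pi> \<in> ?P"
    then have \<pi>: "\<pi> permutes {0..<p}" by simp
    let ?ws = "map (\<lambda>k. ws ! \<pi> k) [0..<p]"
    have "set ?ws \<subseteq> set ws"
      using permutes_in_image[OF \<pi>] ws by (auto simp: set_conv_nth)
    then have "L ([] @ ?ws) = (\<Sum>is | length is = length ?ws \<and> set is \<subseteq> A.
           sN (\<Prod>b<length ?ws. c (is ! b) (?ws ! b)) (L ([] @ map x is)))"
      using assms by (intro L_expand) auto
    moreover have "(\<Prod>b<length ?ws. c (js ! b) (?ws ! b)) = (\<Prod>a<p. c (js ! a) (ws ! \<pi> a))" for js
      by (intro prod.cong) auto
    ultimately have "L ?ws = (\<Sum>is\<in>?I. sN (\<Prod>a<p. c (is ! a) (ws ! \<pi> a)) (L (map x is)))"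
      by simp
    then have "(\<Sum>is\<in>?I. sN (\<Prod>a<p. c (is ! a) (ws ! \<pi> a)) (L (map x is))) = sN (signof \<pi>) (L ws)"
      using L_permute[OF \<pi> wsS ws] by simp
    then show "sN (signof \<pi>) (\<Sum>is\<in>?I. sN (\<Prod>a<p. c (is ! a) (ws ! \<pi> a)) (L (map x is))) = L ws"
      by (simp flip: of_int_mult)
  qed
  also have "\<dots> = sN (of_nat (fact p)) (L ws)"
  proof -
    have "(\<Sum>\<pi>\<in>Q. L ws) = sN (of_nat (card Q)) (L ws)" if "finite Q" for Q :: "(nat \<Rightarrow> nat) set"
      using that by induct (auto simp: N.scale_left_distrib)
    from this[of ?P] show ?thesis by (simp add: finite_permutations card_permutations[of "{0..<p}" p])
  qed
  finally show ?thesis .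
qed

end

lemma alt_on_det:
  assumes "\<And>j x y. j < p \<Longrightarrow> x \<in> S \<Longrightarrow> y \<in> S \<Longrightarrow> f (x + y) j = f x j + f y j"
    and "\<And>j a x. j < p \<Longrightarrow> x \<in> S \<Longrightarrow> f (sV a x) j = a * f x j"
  shows "alt_on p S sV (*) (\<lambda>ws. det (mat p p (\<lambda>(i, j). f (ws ! i) j)))"
  unfolding alt_on_def
proof (intro conjI allI impI)
  fix xs ys x y assume S: "set (xs @ x # y # ys) \<subseteq> S" and l: "length xs + length ys + 1 = p"
  let ?k = "length xs"
  have *: "mat p p (\<lambda>(i, j). f ((xs @ z # ys) ! i) j) =
     mat\<^sub>r p p (\<lambda>i. if i = ?k then vec p (f z) else vec p (f ((xs @ x # ys) ! i)))" for z
    using l by (intro eq_matI) (simp_all add: nth_append nth_Cons')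
  have **: "mat\<^sub>r p p (\<lambda>i. if i = ?k then vec p (f (x + y)) else vec p (f ((xs @ x # ys) ! i))) =
    mat\<^sub>r p p (\<lambda>i. if i = ?k then vec p (f x) + vec p (f y) else vec p (f ((xs @ x # ys) ! i)))"
    using S assms(1)[of _ x y] by (intro eq_matI) auto
  show "det (mat p p (\<lambda>(i, j). f ((xs @ (x + y) # ys) ! i) j)) =
    det (mat p p (\<lambda>(i, j). f ((xs @ x # ys) ! i) j)) + det (mat p p (\<lambda>(i, j). f ((xs @ y # ys) ! i) j))"
    unfolding *[of x] *[of y] *[of "x + y"] ** using l
    by (intro det_row_add[where a="\<lambda>_. vec p (f x)" and b="\<lambda>_. vec p (f y)"]) auto
next
  fix xs a x ys assume S: "set (xs @ x # ys) \<subseteq> S" and l: "length xs + length ys + 1 = p"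
  let ?k = "length xs" and ?M = "mat p p (\<lambda>(i, j). f ((xs @ x # ys) ! i) j)"
  have "mat p p (\<lambda>(i, j). f ((xs @ sV a x # ys) ! i) j) = multrow ?k a ?M"
    using l S assms(2) by (intro eq_matI) (auto simp: nth_append)
  then show "det (mat p p (\<lambda>(i, j). f ((xs @ sV a x # ys) ! i) j)) = a * det ?M"
    using l by (simp add: det_multrow[of ?k p])
next
  fix xs assume "set xs \<subseteq> S" "length xs = p" "\<not> distinct xs"
  then obtain i j where "i < p" "j < p" "i \<noteq> j" "xs ! i = xs ! j"
    by (auto simp: distinct_conv_nth)
  then show "det (mat p p (\<lambda>(i, j). f (xs ! i) j)) = 0"
    by (intro det_identical_rows[where i=i and j=j and n=p]) auto
qed

text \<open>The determinants that evaluate forms have vector fields on the rows and 1-forms on the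
  columns; this version gives alternation in the 1-forms.\<close>

lemma alt_on_det_transpose:
  assumes "\<And>i x y. i < p \<Longrightarrow> x \<in> S \<Longrightarrow> y \<in> S \<Longrightarrow> f i (x + y) = f i x + f i y"
    and "\<And>i a x. i < p \<Longrightarrow> x \<in> S \<Longrightarrow> f i (sV a x) = a * f i x"
  shows "alt_on p S sV (*) (\<lambda>ws. det (mat p p (\<lambda>(i, j). f i (ws ! j))))"
proof -
  have *: "det (mat p p (\<lambda>(i, j). f i (ws ! j))) = det (mat p p (\<lambda>(i, j). f j (ws ! i)))" for ws
    by (subst det_transpose[symmetric, where n=p], simp) (intro arg_cong[where f=det], auto)
  show ?thesis unfolding * using assms by (intro alt_on_det) auto
qed

text \<open>Each of the three families in \<open>exterior_rels\<close> yields one clause of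
  \<open>alt_on\<close>.\<close>

lemma exterior_wedge:
  fixes s :: "'a::comm_ring_1 \<Rightarrow> 'w::ab_group_add \<Rightarrow> 'w" and t :: "'a \<Rightarrow> 'n::ab_group_add \<Rightarrow> 'n"
  assumes s: "Modules.module s" and ext: "exterior_power p s t w"
  shows "alternating s t p UNIV w"
proof -
  note pr = ext[unfolded exterior_power_def]
  note m = presented_module[OF pr]
  interpret t: Modules.module t by fact
  interpret s: Modules.module s by (rule s)
  interpret E: module_hom free_scale t "free_ext t w" by (rule module_hom_free_ext[OF m])
  note rel = presented_rel[OF pr, unfolded exterior_rels_def]
  have "alt_on p UNIV s t w"
    unfolding alt_on_def
  proof (intro conjI allI impI)
    fix xs ys :: "'w list" and x y assume "length xs + length ys + 1 = p"
    then have "free_ext t w (Poly_Mapping.single (xs @ (x + y) # ys) 1 - Poly_Mapping.single (xs @ x # ys) 1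
        - Poly_Mapping.single (xs @ y # ys) 1) = 0" by (intro rel) blast
    then show "w (xs @ (x + y) # ys) = w (xs @ x # ys) + w (xs @ y # ys)"
      by (simp add: E.diff E.add free_ext_single[OF m] diff_diff_eq)
  next
    fix xs ys :: "'w list" and a x assume "length xs + length ys + 1 = p"
    then have "free_ext t w (Poly_Mapping.single (xs @ s a x # ys) 1 - Poly_Mapping.single (xs @ x # ys) a) = 0"
      by (intro rel) blast
    then show "w (xs @ s a x # ys) = t a (w (xs @ x # ys))"
      by (simp add: E.diff free_ext_single[OF m])
  next
    fix xs :: "'w list" assume "length xs = p" "\<not> distinct xs"
    then have "free_ext t w (Poly_Mapping.single xs 1) = 0"
      by (intro rel) blast
    then show "w xs = 0"
      by (simp add: free_ext_single[OF m])
  qed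
  then show ?thesis by unfold_locales auto
qed

text \<open>Conversely the clauses of \<open>alt_on\<close> make \<open>L\<close> vanish on the
  relations, so the universal property of the presentation applies.\<close>

lemma exterior_ext:
  assumes ext: "exterior_power p s t w" and t': "Modules.module t'" and alt: "alt_on p UNIV s t' L"
  shows "\<exists>!\<phi>. module_hom t t' \<phi> \<and> (\<forall>ws. length ws = p \<longrightarrow> \<phi> (w ws) = L ws)"
proof -
  note pr = ext[unfolded exterior_power_def]
  interpret E: module_hom free_scale t' "free_ext t' L" by (rule module_hom_free_ext[OF t'])
  have "\<exists>!\<phi>. module_hom t t' \<phi> \<and> (\<forall>ws\<in>{ws. length ws = p}. \<phi> (w ws) = L ws)"
  proof (rule presented_ext[OF pr t'])
    fix u assume "u \<in> exterior_rels p s"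
    then show "free_ext t' L u = 0"
      unfolding exterior_rels_def
      by (auto simp: E.diff free_ext_single[OF t'] module.scale_one[OF t'] alt_onD[OF alt])
  qed
  then show ?thesis by simp
qed

section \<open>Prime ideals\<close>

lemma module_mult: "Modules.module ((*) :: 'a::comm_ring_1 \<Rightarrow> 'a \<Rightarrow> 'a)"
  by unfold_locales (simp_all add: algebra_simps)

lemma subspace_mult_iff:
  "Modules.module.subspace (*) I \<longleftrightarrow>
    (0::'a::comm_ring_1) \<in> I \<and> (\<forall>x\<in>I. \<forall>y\<in>I. x + y \<in> I) \<and> (\<forall>c. \<forall>x\<in>I. c * x \<in> I)"
  by (rule module.subspace_def[OF module_mult])

text \<open>Zorn's lemma gives \<open>M\<close> maximal among the ideals that contain
  \<open>J\<close> and avoid 1. For \<open>a\<close> outside \<open>M\<close> the ideal generated by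
  \<open>M\<close> and \<open>a\<close> contains 1. If \<open>a\<close> and \<open>b\<close> were
  both outside with product in \<open>M\<close>, multiplying the two resulting expressions for 1
  would put 1 into \<open>M\<close>.\<close>

lemma ex_prime_ideal_superset:
  fixes J :: "'a::comm_ring_1 set"
  assumes J: "Modules.module.subspace (*) J" and "1 \<notin> J"
  obtains p where "prime_ideal p" "J \<subseteq> p"
proof -
  let ?A = "{I. Modules.module.subspace (*) I \<and> J \<subseteq> I \<and> 1 \<notin> I}"
  have "\<exists>M\<in>?A. \<forall>X\<in>?A. M \<subseteq> X \<longrightarrow> X = M"
  proof (rule subset_Zorn_nonempty)
    show "?A \<noteq> {}" using assms by auto
  next
    fix C assume C: "C \<noteq> {}" "subset.chain ?A C"
    then have sub: "Modules.module.subspace (*) I" "J \<subseteq> I" "1 \<notin> I" if "I \<in> C" for I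
      using that by (auto simp: subset.chain_def)
    have tot: "I \<subseteq> I' \<or> I' \<subseteq> I" if "I \<in> C" "I' \<in> C" for I I'
      using that C(2) by (auto simp: subset_chain_def)
    have "x + y \<in> \<Union>C" if "x \<in> \<Union>C" "y \<in> \<Union>C" for x y
    proof -
      from that obtain I I' where I: "x \<in> I" "I \<in> C" "y \<in> I'" "I' \<in> C" by auto
      with tot[of I I'] consider "x \<in> I'" | "y \<in> I" by blast
      then show ?thesis using I sub(1)[unfolded subspace_mult_iff] by cases blast+
    qed
    moreover have "c * x \<in> \<Union>C" if "x \<in> \<Union>C" for c x
      using that sub(1)[unfolded subspace_mult_iff] by blast
    moreover obtain I where "I \<in> C" using C(1) by blast
    moreover from this have "0 \<in> \<Union>C" "J \<subseteq> \<Union>C"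
      using sub(2) sub(1)[unfolded subspace_mult_iff] by blast+
    moreover have "1 \<notin> \<Union>C" using sub(3) by blast
    ultimately show "\<Union>C \<in> ?A"
      unfolding subspace_mult_iff mem_Collect_eq by blast
  qed
  then obtain M where M: "Modules.module.subspace (*) M" "J \<subseteq> M" "1 \<notin> M"
    and max: "\<And>X. Modules.module.subspace (*) X \<Longrightarrow> 1 \<notin> X \<Longrightarrow> M \<subseteq> X \<Longrightarrow> X = M"
    by (smt (verit, ccfv_SIG) mem_Collect_eq order_trans)
  note Ms = M(1)[unfolded subspace_mult_iff]
  have one: "\<exists>x\<in>M. \<exists>r. 1 = x + r * a" if "a \<notin> M" for a
  proof (rule ccontr)
    let ?X = "{x + r * a | x r. x \<in> M}"
    assume "\<not> ?thesis"
    then have "1 \<notin> ?X" by auto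
    moreover have "Modules.module.subspace (*) ?X"
      unfolding subspace_mult_iff
    proof (intro conjI ballI allI)
      show "0 \<in> ?X" using Ms by (auto intro!: exI[of _ 0])
      fix u v assume "u \<in> ?X" "v \<in> ?X"
      then obtain x r y s where "u = x + r * a" "v = y + s * a" "x \<in> M" "y \<in> M" by auto
      then have "u + v = (x + y) + (r + s) * a" "x + y \<in> M" using Ms by (auto simp: algebra_simps)
      then show "u + v \<in> ?X" by blast
    next
      fix c u assume "u \<in> ?X"
      then obtain x r where "u = x + r * a" "x \<in> M" by auto
      then have "c * u = c * x + (c * r) * a" "c * x \<in> M" using Ms by (auto simp: algebra_simps)
      then show "c * u \<in> ?X" by blast
    qed
    moreover have "M \<subseteq> ?X"
    proof
      fix x assume "x \<in> M"
      then have "x = x + 0 * a \<and> x \<in> M" by simp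
      then show "x \<in> ?X" by blast
    qed
    ultimately have "?X = M" by (intro max) auto
    moreover have "a \<in> ?X"
    proof -
      have "a = 0 + 1 * a \<and> 0 \<in> M" using Ms by simp
      then show ?thesis by blast
    qed
    ultimately show False using that by auto
  qed
  have "prime_ideal M"
    unfolding prime_ideal_def
  proof (intro conjI M allI impI)
    fix a b assume ab: "a * b \<in> M"
    show "a \<in> M \<or> b \<in> M"
    proof (rule ccontr)
      assume "\<not> ?thesis"
      then obtain x r y s where *: "x \<in> M" "y \<in> M" "1 = x + r * a" "1 = y + s * b"
        using one by blast
      then have "1 = (x + r * a) * (y + s * b)" by (metis mult_1)
      also have "\<dots> = (y + s * b) * x + ((r * a) * y + (r * s) * (a * b))" by (simp add: algebra_simps)
      finally show False using * ab Ms M(3) by metis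
    qed
  qed
  then show thesis using M(2) that by blast
qed


section \<open>Polynomials\<close>

lemma poly_mapping_sum_single:
  fixes p :: "'g \<Rightarrow>\<^sub>0 'b::comm_monoid_add"
  shows "p = (\<Sum>m\<in>Poly_Mapping.keys p. Poly_Mapping.single m (Poly_Mapping.lookup p m))"
  by (intro poly_mapping_eqI) (auto simp: lookup_sum lookup_single when_def in_keys_iff)

lemma poly_mapping_single_induct:
  fixes p :: "'g \<Rightarrow>\<^sub>0 'b::comm_monoid_add"
  assumes "P 0" "\<And>m a. P (Poly_Mapping.single m a)" "\<And>p q. P p \<Longrightarrow> P q \<Longrightarrow> P (p + q)"
  shows "P p"
proof -
  have "P (\<Sum>m\<in>K. Poly_Mapping.single m (Poly_Mapping.lookup p m))" if "finite K" for K
    using that by induct (auto intro: assms)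
  then show ?thesis by (metis poly_mapping_sum_single finite_keys)
qed

definition monom_ev :: "(nat \<Rightarrow> 'a::comm_ring_1) \<Rightarrow> (nat \<Rightarrow>\<^sub>0 nat) \<Rightarrow> 'a" where
  "monom_ev x m = (\<Prod>i\<in>Poly_Mapping.keys m. x i ^ Poly_Mapping.lookup m i)"

lemma monom_ev_superset:
  "finite K \<Longrightarrow> Poly_Mapping.keys m \<subseteq> K \<Longrightarrow> monom_ev x m = (\<Prod>i\<in>K. x i ^ Poly_Mapping.lookup m i)"
  unfolding monom_ev_def by (intro prod.mono_neutral_left) (auto simp: in_keys_iff)

lemma monom_ev_add: "monom_ev x (m + m') = monom_ev x m * monom_ev x m'"
proof -
  let ?K = "Poly_Mapping.keys m \<union> Poly_Mapping.keys m'"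
  have "Poly_Mapping.keys (m + m') \<subseteq> ?K" by (rule Poly_Mapping.keys_add)
  then show ?thesis
    by (simp add: monom_ev_superset[of ?K] lookup_add power_add prod.distrib)
qed

lemma monom_ev_0 [simp]: "monom_ev x 0 = 1"
  by (simp add: monom_ev_def)

lemma monom_ev_single: "monom_ev x (Poly_Mapping.single i 1) = x i"
  by (simp add: monom_ev_def)

lemma polys_add: "p \<in> polys n \<Longrightarrow> q \<in> polys n \<Longrightarrow> p + q \<in> polys n"
  unfolding polys_def using Poly_Mapping.keys_add[of p q] by blast

lemma polys_const: "Poly_Mapping.single 0 r \<in> polys n"
  unfolding polys_def by simp

lemma polys_mult: "p \<in> polys n \<Longrightarrow> q \<in> polys n \<Longrightarrow> p * q \<in> polys n"
  unfolding polys_def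
proof (intro CollectI ballI)
  fix m assume p: "p \<in> {p. \<forall>m\<in>Poly_Mapping.keys p. Poly_Mapping.keys m \<subseteq> {..<n}}"
      "q \<in> {p. \<forall>m\<in>Poly_Mapping.keys p. Poly_Mapping.keys m \<subseteq> {..<n}}"
    and "m \<in> Poly_Mapping.keys (p * q)"
  then obtain a b where "m = a + b" "a \<in> Poly_Mapping.keys p" "b \<in> Poly_Mapping.keys q"
    using keys_mult[of p q] by blast
  then show "Poly_Mapping.keys m \<subseteq> {..<n}"
    using p Poly_Mapping.keys_add[of a b] by blast
qed

lemma polys_diff: "p \<in> polys n \<Longrightarrow> q \<in> polys n \<Longrightarrow> p - q \<in> polys n"
proof -
  assume p: "p \<in> polys n" and q: "q \<in> polys n"
  have "p - q = p + Poly_Mapping.single 0 (-1) * q" by (simp add: single_uminus)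
  then show ?thesis using polys_add[OF p polys_mult[OF polys_const q]] by metis
qed

section \<open>Values of polynomials and of their partial derivatives at a tuple of elements of
  A\<close>

context
  fixes sc :: "'k::field \<Rightarrow> 'a::comm_ring_1 \<Rightarrow> 'a" and x :: "nat \<Rightarrow> 'a"
  assumes kalg: "k_algebra sc"
begin

interpretation vs: vector_space sc
  using kalg by (simp add: k_algebra_def)

lemma sc_conv_mult: "sc r a = sc r 1 * a"
  using kalg unfolding k_algebra_def by (metis mult_1)

lemma sc_mult_sc: "sc r a * sc r' b = sc (r * r') (a * b)"
proof -
  have "sc r a * sc r' b = sc r 1 * sc r' 1 * (a * b)"
    by (subst sc_conv_mult, subst (2) sc_conv_mult) (simp add: algebra_simps)
  also have "sc r 1 * sc r' 1 = sc (r * r') 1"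
    by (metis sc_conv_mult vs.scale_scale)
  finally show ?thesis by (metis sc_conv_mult)
qed

abbreviation (input) ev where "ev \<equiv> poly_ev sc x"

abbreviation (input) dv where "dv i p \<equiv> poly_ev sc x (poly_partial i p)"

lemma ev_eq: "ev p = (\<Sum>m\<in>Poly_Mapping.keys p. sc (Poly_Mapping.lookup p m) (monom_ev x m))"
  by (simp add: poly_ev_def monom_ev_def)

lemma ev_add: "ev (p + q) = ev p + ev q"
  unfolding ev_eq by (rule setsum_keys_plus_distrib) (simp_all add: vs.scale_left_distrib)

lemma ev_0 [simp]: "ev 0 = 0" by (simp add: ev_eq)

lemma ev_single: "ev (Poly_Mapping.single m a) = sc a (monom_ev x m)"
  by (simp add: ev_eq)

lemma ev_sum: "ev (\<Sum>i\<in>I. f i) = (\<Sum>i\<in>I. ev (f i))"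
  by (induct I rule: infinite_finite_induct) (simp_all add: ev_add)

lemma ev_mult: "ev (p * q) = ev p * ev q"
proof (induct p rule: poly_mapping_single_induct)
  case (2 m a)
  show ?case
    by (induct q rule: poly_mapping_single_induct)
      (simp_all add: ev_single mult_single monom_ev_add sc_mult_sc distrib_left ev_add)
qed (simp_all add: distrib_right ev_add)

lemma ev_diff: "ev (p - q) = ev p - ev q"
  using ev_add[of "p - q" q] by simp

lemma dv_eq: "dv i p = (\<Sum>m\<in>Poly_Mapping.keys p.
    sc (of_nat (Poly_Mapping.lookup m i) * Poly_Mapping.lookup p m) (monom_ev x (m - Poly_Mapping.single i 1)))"
  by (simp add: poly_partial_def ev_sum ev_single)

lemma dv_add: "dv i (p + q) = dv i p + dv i q"
  unfolding dv_eq
  by (rule setsum_keys_plus_distrib) (simp_all add: vs.scale_left_distrib distrib_left)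

lemma dv_0 [simp]: "dv i 0 = 0" by (simp add: dv_eq)

lemma dv_single: "dv i (Poly_Mapping.single m a) =
    sc (of_nat (Poly_Mapping.lookup m i) * a) (monom_ev x (m - Poly_Mapping.single i 1))"
  by (simp add: dv_eq)

text \<open>Partial derivatives enter only through their values at \<open>x\<close>, so the product
  rule is stated for \<open>dv i\<close> as a derivation along the evaluation map.\<close>

lemma dv_mult_single:
  "dv i (Poly_Mapping.single m a * Poly_Mapping.single m' b) =
    ev (Poly_Mapping.single m a) * dv i (Poly_Mapping.single m' b) +
    ev (Poly_Mapping.single m' b) * dv i (Poly_Mapping.single m a)"
proof -
  let ?e = "Poly_Mapping.single i 1"
  \<comment> \<open>Subtraction of exponents is truncated. It misbehaves only when the exponent of
    the variable is 0, and then the coefficient vanishes.\<close>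
  have *: "sc (of_nat (Poly_Mapping.lookup m i) * c) (monom_ev x (m + m' - ?e)) =
      sc (of_nat (Poly_Mapping.lookup m i) * c) (monom_ev x m' * monom_ev x (m - ?e))" for m m' c
  proof (cases "Poly_Mapping.lookup m i = 0")
    case False
    then have "m + m' - ?e = m' + (m - ?e)"
      by (intro poly_mapping_eqI) (auto simp: lookup_add lookup_minus lookup_single when_def)
    then show ?thesis by (simp add: monom_ev_add)
  qed simp
  have "dv i (Poly_Mapping.single m a * Poly_Mapping.single m' b) =
      sc (of_nat (Poly_Mapping.lookup m i) * (a * b)) (monom_ev x (m + m' - ?e)) +
      sc (of_nat (Poly_Mapping.lookup m' i) * (a * b)) (monom_ev x (m' + m - ?e))"
    by (simp only: mult_single dv_single lookup_add of_nat_add distrib_right vs.scale_left_distrib add.commute[of m' m])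
  then show ?thesis
    unfolding * dv_single ev_single sc_mult_sc by (simp add: mult_ac add.commute)
qed

lemma dv_mult: "dv i (p * q) = ev p * dv i q + ev q * dv i p"
proof (induct p rule: poly_mapping_single_induct)
  case (2 m a)
  show ?case
    by (induct q rule: poly_mapping_single_induct)
      (simp_all add: dv_mult_single dv_add ev_add algebra_simps)
qed (simp_all add: algebra_simps ev_add dv_add)

lemma dv_const: "dv i (Poly_Mapping.single 0 r) = 0"
  by (simp add: dv_single)

lemma ev_const: "ev (Poly_Mapping.single 0 r) = sc r 1"
  by (simp add: ev_single)

text \<open>The polynomials for which the formula holds contain the constants and the variables with
  index below \<open>n\<close>, and are closed under sums and products because both sides are
  derivations along the evaluation map.\<close>

lemma chain_rule:
  fixes s :: "'a \<Rightarrow> 'w::ab_group_add \<Rightarrow> 'w" and \<delta> :: "'a \<Rightarrow> 'w"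
  assumes s: "Modules.module s" and add: "\<And>a b. \<delta> (a + b) = \<delta> a + \<delta> b"
    and scale: "\<And>r a. \<delta> (sc r a) = s (sc r 1) (\<delta> a)"
    and leib: "\<And>a b. \<delta> (a * b) = s a (\<delta> b) + s b (\<delta> a)"
    and p: "p \<in> polys n"
  shows "\<delta> (ev p) = (\<Sum>i<n. s (dv i p) (\<delta> (x i)))"
proof -
  interpret s: Modules.module s by fact
  let ?R = "\<lambda>p. \<Sum>i<n. s (dv i p) (\<delta> (x i))"
  let ?P = "\<lambda>p. \<delta> (ev p) = ?R p"
  have P_mult: "?P (p * q)" if "?P p" "?P q" for p q
    using that by (simp add: ev_mult dv_mult leib s.scale_left_distrib sum.distrib s.scale_sum_right)
  have \<delta>0: "\<delta> 0 = 0" using add[of 0 0] by simp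
  have \<delta>1: "\<delta> 1 = 0" using leib[of 1 1] by simp
  have P_const: "?P (Poly_Mapping.single 0 r)" for r
    using scale[of r 1] by (simp add: dv_const ev_const \<delta>1)
  have P_add: "?P (p + q)" if "?P p" "?P q" for p q
    using that by (simp add: ev_add dv_add add s.scale_left_distrib sum.distrib)
  have P_var: "?P (Poly_Mapping.single (Poly_Mapping.single i 1) 1)" if "i < n" for i
  proof -
    have "s (dv j (Poly_Mapping.single (Poly_Mapping.single i 1) 1)) (\<delta> (x j)) = (if j = i then \<delta> (x j) else 0)" for j
      by (auto simp: dv_single lookup_single when_def)
    then show ?thesis using that by (simp add: ev_single monom_ev_single del: One_nat_def)
  qed
  have P_pow: "?P (Poly_Mapping.single (Poly_Mapping.single i k) 1)" if "i < n" for i k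
  proof (induct k)
    case 0
    then show ?case using P_const[of 1] by simp
  next
    case (Suc k)
    have "(Poly_Mapping.single (Poly_Mapping.single i (Suc k)) 1 :: 'k mpoly) =
      Poly_Mapping.single (Poly_Mapping.single i k) 1 * Poly_Mapping.single (Poly_Mapping.single i 1) 1"
      by (simp add: mult_single flip: single_add)
    then show ?case using P_mult[OF Suc P_var[OF that]] by simp
  qed
  have P_mon: "?P (Poly_Mapping.single m 1)" if "Poly_Mapping.keys m \<subseteq> {..<n}" for m
  proof -
    have "?P (Poly_Mapping.single (\<Sum>i\<in>K. Poly_Mapping.single i (Poly_Mapping.lookup m i)) 1)"
      if "finite K" "K \<subseteq> {..<n}" for K
      using that
    proof induct
      case empty
      then show ?case using P_const[of 1] by simp
    next
      case (insert i K)
      have "(Poly_Mapping.single (\<Sum>i\<in>insert i K. Poly_Mapping.single i (Poly_Mapping.lookup m i)) 1 :: 'k mpoly) =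
        Poly_Mapping.single (Poly_Mapping.single i (Poly_Mapping.lookup m i)) 1 *
        Poly_Mapping.single (\<Sum>i\<in>K. Poly_Mapping.single i (Poly_Mapping.lookup m i)) 1"
        using insert by (simp add: mult_single)
      then show ?case using P_mult[OF P_pow] insert by auto
    qed
    from this[OF finite_keys that] show ?thesis by (simp flip: poly_mapping_sum_single)
  qed
  have P_sing: "?P (Poly_Mapping.single m a)" if "Poly_Mapping.keys m \<subseteq> {..<n}" for m a
  proof -
    have "(Poly_Mapping.single m a :: 'k mpoly) = Poly_Mapping.single 0 a * Poly_Mapping.single m 1"
      by (simp add: mult_single)
    then show ?thesis using P_mult[OF P_const P_mon[OF that]] by simp
  qed
  have "?P (\<Sum>m\<in>K. Poly_Mapping.single m (Poly_Mapping.lookup p m))"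
    if "finite K" "K \<subseteq> Poly_Mapping.keys p" for K
    using that
  proof induct
    case empty
    then show ?case by (simp add: \<delta>0)
  next
    case (insert m K)
    then have "Poly_Mapping.keys m \<subseteq> {..<n}" using p by (auto simp: polys_def)
    then show ?case using insert P_add[OF P_sing] by auto
  qed
  from this[OF finite_keys order_refl] show ?thesis by (simp flip: poly_mapping_sum_single)
qed

text \<open>A is the quotient of \<open>polys n\<close> by the kernel of evaluation, so a derivation
  along evaluation that kills this kernel descends to A. Linearity over k follows from the Leibniz
  rule once constants are killed.\<close>

lemma descend_derivation:
  assumes surj: "ev ` polys n = UNIV"
    and add: "\<And>p q. E (p + q) = E p + E q" and mult: "\<And>p q. E (p * q) = ev p * E q + ev q * E p"
    and const: "\<And>r. E (Poly_Mapping.single 0 r) = 0"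
    and ker: "\<And>q. q \<in> polys n \<Longrightarrow> ev q = 0 \<Longrightarrow> E q = 0"
  obtains t where "Vector_Spaces.linear sc sc t" "\<And>a b. t (a * b) = a * t b + b * t a"
    "\<And>p. p \<in> polys n \<Longrightarrow> t (ev p) = E p"
proof -
  have "\<forall>a. \<exists>p\<in>polys n. ev p = a" using surj by (metis UNIV_I imageE)
  then obtain P where P: "\<And>a. P a \<in> polys n" "\<And>a. ev (P a) = a" by metis
  have E_diff: "E (p - q) = E p - E q" for p q
    using add[of "p - q" q] by simp
  have eq: "E p = E q" if "p \<in> polys n" "q \<in> polys n" "ev p = ev q" for p q
    using ker[of "p - q"] that by (simp add: polys_diff ev_diff E_diff)
  define t where "t a = E (P a)" for a
  have t: "t (ev p) = E p" if "p \<in> polys n" for p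
    unfolding t_def using P that by (intro eq) auto
  have t_add: "t (a + b) = t a + t b" for a b
    using t[of "P a + P b"] P by (simp add: polys_add ev_add add t_def)
  have t_mult: "t (a * b) = a * t b + b * t a" for a b
    using t[of "P a * P b"] P by (simp add: polys_mult ev_mult mult t_def)
  have t_const: "t (sc r 1) = 0" for r
    using t[OF polys_const, of r] by (simp add: ev_const const)
  have t_scale: "t (sc r a) = sc r (t a)" for r a
    using t_mult[of "sc r 1" a] by (simp add: sc_conv_mult[of r a] sc_conv_mult[of r "t a"] t_const)
  have "Vector_Spaces.linear sc sc t"
    by unfold_locales (simp_all add: t_add t_scale)
  then show thesis using t_mult t that by blast
qed

end


section \<open>Kaehler differentials and derivations\<close>

locale algebra_forms =
  fixes D :: "('k::field_char_0, 'a::comm_ring_1, 'w1::ab_group_add, 'w2::ab_group_add,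
                'w3::ab_group_add, 'w4::ab_group_add) forms"
  assumes forms: "forms_of_algebra D"
begin

lemma kalg: "k_algebra (ksc D)"
  using forms by (simp add: forms_of_algebra_def)

sublocale K: vector_space "ksc D"
  using kalg by (simp add: k_algebra_def)

lemma kaehler: "presented_by (osc1 D) (dd D) UNIV (kaehler_rels (ksc D))"
  using forms by (simp add: forms_of_algebra_def kaehler_differentials_def)

sublocale O1: Modules.module "osc1 D"
  by (rule presented_module[OF kaehler])

sublocale TS: Modules.module "tsc :: 'a \<Rightarrow> ('a \<Rightarrow> 'a) \<Rightarrow> _"
  by unfold_locales (auto simp: tsc_def fun_eq_iff algebra_simps)

lemma ksc_mult: "ksc D r a = ksc D r 1 * a"
  by (rule sc_conv_mult[OF kalg])

lemma dd_add: "dd D (a + b) = dd D a + dd D b"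
proof -
  interpret E: module_hom free_scale "osc1 D" "free_ext (osc1 D) (dd D)"
    by (rule module_hom_free_ext) unfold_locales
  have "free_ext (osc1 D) (dd D) (Poly_Mapping.single (a + b) 1 - Poly_Mapping.single a 1 - Poly_Mapping.single b 1) = 0"
    by (rule presented_rel[OF kaehler]) (auto simp: kaehler_rels_def)
  then show ?thesis by (simp add: E.diff E.add free_ext_single O1.module_axioms diff_diff_eq)
qed

lemma dd_ksc: "dd D (ksc D r a) = osc1 D (ksc D r 1) (dd D a)"
proof -
  interpret E: module_hom free_scale "osc1 D" "free_ext (osc1 D) (dd D)"
    by (rule module_hom_free_ext) unfold_locales
  have "free_ext (osc1 D) (dd D) (Poly_Mapping.single (ksc D r a) 1 - Poly_Mapping.single a (ksc D r 1)) = 0"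
    by (rule presented_rel[OF kaehler]) (auto simp: kaehler_rels_def)
  then show ?thesis by (simp add: E.diff free_ext_single O1.module_axioms)
qed

lemma dd_mult: "dd D (a * b) = osc1 D a (dd D b) + osc1 D b (dd D a)"
proof -
  interpret E: module_hom free_scale "osc1 D" "free_ext (osc1 D) (dd D)"
    by (rule module_hom_free_ext) unfold_locales
  have "free_ext (osc1 D) (dd D) (Poly_Mapping.single (a * b) 1 - Poly_Mapping.single b a - Poly_Mapping.single a b) = 0"
    by (rule presented_rel[OF kaehler]) (auto simp: kaehler_rels_def)
  then show ?thesis by (simp add: E.diff E.add free_ext_single O1.module_axioms diff_diff_eq)
qed

lemma DerI:
  "Vector_Spaces.linear (ksc D) (ksc D) t \<Longrightarrow> (\<And>a b. t (a * b) = a * t b + b * t a) \<Longrightarrow> t \<in> Der D"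
  by (simp add: Der_def)

lemma DerI':
  "(\<And>a b. t (a + b) = t a + t b) \<Longrightarrow> (\<And>r a. t (ksc D r a) = ksc D r (t a)) \<Longrightarrow>
    (\<And>a b. t (a * b) = a * t b + b * t a) \<Longrightarrow> t \<in> Der D"
  by (intro DerI) (unfold_locales, auto)

lemma
  assumes "t \<in> Der D"
  shows Der_add: "t (a + b) = t a + t b" and Der_ksc: "t (ksc D r a) = ksc D r (t a)"
    and Der_mult: "t (a * b) = a * t b + b * t a"
    and Der_0: "t 0 = 0" and Der_minus: "t (- a) = - t a" and Der_diff: "t (a - b) = t a - t b"
proof -
  interpret module_hom "ksc D" "ksc D" t
    using assms by (simp add: Der_def Vector_Spaces.linear_def)
  show "t (a + b) = t a + t b" "t (ksc D r a) = ksc D r (t a)" "t 0 = 0" "t (- a) = - t a"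
    "t (a - b) = t a - t b"
    by (simp_all add: add scale zero neg diff)
  show "t (a * b) = a * t b + b * t a" using assms by (simp add: Der_def)
qed

lemma Der_tsc: "t \<in> Der D \<Longrightarrow> tsc a t \<in> Der D"
  by (intro DerI') (simp_all add: tsc_def Der_add Der_ksc Der_mult algebra_simps ksc_mult[of _ "t _"] ksc_mult[of _ "_ * _"])

lemma Der_plus: "s \<in> Der D \<Longrightarrow> t \<in> Der D \<Longrightarrow> s + t \<in> Der D"
  by (intro DerI') (simp_all add: Der_add Der_ksc Der_mult algebra_simps K.scale_right_distrib)

lemma Der_zero: "0 \<in> Der D"
  by (intro DerI') simp_all

lemma subspace_Der: "TS.subspace (Der D)"
  by (simp add: TS.subspace_def Der_zero Der_plus Der_tsc)

lemma bracket_Der: "s \<in> Der D \<Longrightarrow> t \<in> Der D \<Longrightarrow> bracket s t \<in> Der D"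
  by (intro DerI') (simp_all add: bracket_def Der_add Der_ksc Der_mult algebra_simps K.scale_right_diff_distrib)

text \<open>A list of pairs, rather than an indexed family, makes closure under addition a
  concatenation. The case \<open>h = 1\<close> is the dual basis that is sought.\<close>

definition spans_dd :: "'a \<Rightarrow> (('a \<Rightarrow> 'a) \<times> 'a) list \<Rightarrow> bool" where
  "spans_dd h L \<longleftrightarrow> fst ` set L \<subseteq> Der D \<and> (\<forall>b. osc1 D h (dd D b) = (\<Sum>(t, y)\<leftarrow>L. osc1 D (t b) (dd D y)))"

lemma subspace_spans_dd: "Modules.module.subspace (*) {h. \<exists>L. spans_dd h L}"
  unfolding subspace_mult_iff
proof (intro conjI ballI allI)
  show "0 \<in> {h. \<exists>L. spans_dd h L}" by (auto simp: spans_dd_def intro!: exI[of _ "[]"])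
next
  fix h h' assume "h \<in> {h. \<exists>L. spans_dd h L}" "h' \<in> {h. \<exists>L. spans_dd h L}"
  then obtain L L' where "spans_dd h L" "spans_dd h' L'" by blast
  then have "spans_dd (h + h') (L @ L')"
    by (auto simp: spans_dd_def O1.scale_left_distrib)
  then show "h + h' \<in> {h. \<exists>L. spans_dd h L}" by blast
next
  fix c h assume "h \<in> {h. \<exists>L. spans_dd h L}"
  then obtain L where L: "spans_dd h L" by blast
  have "osc1 D c (\<Sum>(t, y)\<leftarrow>L. osc1 D (t b) (dd D y)) =
    (\<Sum>(t, y)\<leftarrow>map (\<lambda>(t, y). (tsc c t, y)) L. osc1 D (t b) (dd D y))" for b
    by (induct L) (auto simp: O1.scale_right_distrib tsc_def)
  then have "spans_dd (c * h) (map (\<lambda>(t, y). (tsc c t, y)) L)"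
    using L unfolding spans_dd_def by (auto simp: Der_tsc image_subset_iff simp flip: O1.scale_scale)
  then show "c * h \<in> {h. \<exists>L. spans_dd h L}" by blast
qed

end

section \<open>From the Jacobian criterion to a global dual basis\<close>

context algebra_forms
begin

text \<open>At a point where the minor \<open>\<Delta>\<close> is invertible, Cramer's rule corrects \<open>\<Delta> \<partial>/\<partial>x\<^sub>m\<close> by a combination of
  the \<open>\<partial>/\<partial>x\<^sub>j\<^sub>i\<close> to a derivation that annihilates the equations \<open>f\<^sub>l\<close>.\<close>

lemma spans_dd_minor:
  fixes x :: "nat \<Rightarrow> 'a" and f b :: "nat \<Rightarrow> 'k mpoly" and j :: "nat \<Rightarrow> nat" and c n :: nat
  defines "\<Delta> \<equiv> det (mat c c (\<lambda>(l, i). poly_ev (ksc D) x (poly_partial (j i) (f l))))"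
  assumes surj: "poly_ev (ksc D) x ` polys n = UNIV"
    and f: "\<And>l. l < c \<Longrightarrow> f l \<in> polys n" "\<And>l. l < c \<Longrightarrow> poly_ev (ksc D) x (f l) = 0"
    and gen: "\<And>q. q \<in> polys n \<Longrightarrow> poly_ev (ksc D) x q = 0 \<Longrightarrow> \<exists>b. g * q = (\<Sum>l<c. b l * f l)"
  shows "\<exists>L. spans_dd (poly_ev (ksc D) x g * \<Delta>) L"
proof -
  let ?ev = "poly_ev (ksc D) x" and ?dv = "\<lambda>i p. poly_ev (ksc D) x (poly_partial i p)"
  note ev_simps = ev_add[OF kalg] ev_mult[OF kalg] dv_add[OF kalg] dv_mult[OF kalg] dv_const[OF kalg]
  define M where "M = mat c c (\<lambda>(l, i). ?dv (j i) (f l))"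
  have Mc: "M \<in> carrier_mat c c" by (simp add: M_def)
  let ?Adj = "\<lambda>i l. adj_mat M $$ (i, l)"
  have Adj: "(\<Sum>i<c. ?dv (j i) (f l') * ?Adj i l) = (if l' = l then \<Delta> else 0)" if "l' < c" "l < c" for l l'
  proof -
    have "(M * adj_mat M) $$ (l', l) = (\<Sum>i<c. ?dv (j i) (f l') * ?Adj i l)"
      using that adj_mat(1)[OF Mc] Mc by (simp add: scalar_prod_def M_def atLeast0LessThan)
    moreover have "(M * adj_mat M) $$ (l', l) = (\<Delta> \<cdot>\<^sub>m 1\<^sub>m c) $$ (l', l)"
      by (simp only: adj_mat(2)[OF Mc] \<Delta>_def flip: M_def)
    ultimately show ?thesis using that by (cases "l' = l") simp_all
  qed
  \<comment> \<open>By Cramer's rule \<open>N i m\<close> is \<open>\<Delta>\<close> times the i-th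
    coordinate of the solution of the linear system with matrix \<open>M\<close> and right-hand side
    the m-th partial derivatives of the \<open>f l\<close>. Multiplying through by
    \<open>\<Delta>\<close> avoids any inversion.\<close>
  define N where "N i m = (\<Sum>l<c. ?Adj i l * ?dv m (f l))" for i m
  define E where "E m p = \<Delta> * ?dv m p - (\<Sum>i<c. N i m * ?dv (j i) p)" for m p
  have E_add: "E m (p + q) = E m p + E m q" for m p q
    by (simp add: E_def ev_simps distrib_left sum.distrib)
  have E_mult: "E m (p * q) = ?ev p * E m q + ?ev q * E m p" for m p q
    by (simp add: E_def ev_simps algebra_simps sum.distrib sum_distrib_left)
  have E_const: "E m (Poly_Mapping.single 0 r) = 0" for m r
    by (simp add: E_def dv_const[OF kalg])
  have E_f: "E m (f l') = 0" if l': "l' < c" for m l'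
  proof -
    have "(\<Sum>i<c. N i m * ?dv (j i) (f l')) = (\<Sum>i<c. \<Sum>l<c. ?dv m (f l) * (?dv (j i) (f l') * ?Adj i l))"
      unfolding N_def sum_distrib_right by (intro sum.cong refl) (simp only: mult_ac)
    also have "\<dots> = (\<Sum>l<c. ?dv m (f l) * (if l' = l then \<Delta> else 0))"
      using l' by (subst sum.swap) (intro sum.cong refl, subst sum_distrib_left[symmetric], simp only: Adj lessThan_iff)
    also have "\<dots> = (\<Sum>l<c. if l' = l then \<Delta> * ?dv m (f l) else 0)"
      by (intro sum.cong refl) simp
    also have "\<dots> = \<Delta> * ?dv m (f l')" using l' by simp
    finally show ?thesis by (simp add: E_def)
  qed
  have E_sum: "E m (\<Sum>l\<in>I. p l) = (\<Sum>l\<in>I. E m (p l))" for m p and I :: "nat set"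
    using E_add[of m 0 0] by (induct I rule: infinite_finite_induct) (simp_all add: E_add)
  \<comment> \<open>This is where the factor \<open>?ev g\<close> comes from: only
    \<open>g * q\<close> is known to be a combination of the \<open>f l\<close>, and
    \<open>E m\<close> kills such a combination because both \<open>E m\<close> and evaluation
    vanish on each \<open>f l\<close>. On the other side \<open>?ev q = 0\<close> leaves only
    \<open>?ev g * E m q\<close>.\<close>
  have E_ker: "?ev g * E m q = 0" if q: "q \<in> polys n" "?ev q = 0" for m q
  proof -
    obtain b where b: "g * q = (\<Sum>l<c. b l * f l)" using gen[OF q] by blast
    have "?ev g * E m q = E m (g * q)" using q by (simp add: E_mult)
    also have "\<dots> = 0" unfolding b E_sum by (simp add: E_mult E_f f)
    finally show ?thesis .
  qed
  have "\<exists>t. t \<in> Der D \<and> (\<forall>p\<in>polys n. t (?ev p) = ?ev g * E m p)" for m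
  proof -
    have add: "?ev g * E m (p + q) = ?ev g * E m p + ?ev g * E m q" for p q
      by (simp add: E_add distrib_left)
    have mult: "?ev g * E m (p * q) = ?ev p * (?ev g * E m q) + ?ev q * (?ev g * E m p)" for p q
      by (simp add: E_mult algebra_simps)
    have const: "?ev g * E m (Poly_Mapping.single 0 r) = 0" for r
      by (simp add: E_const)
    obtain t where "Vector_Spaces.linear (ksc D) (ksc D) t" "\<And>a b. t (a * b) = a * t b + b * t a"
      "\<And>p. p \<in> polys n \<Longrightarrow> t (?ev p) = ?ev g * E m p"
      using descend_derivation[OF kalg surj, of "\<lambda>p. ?ev g * E m p", OF add mult const E_ker] by blast
    then show ?thesis by (intro exI[of _ t]) (simp add: DerI)
  qed
  then obtain t where t: "\<And>m. t m \<in> Der D" "\<And>m p. p \<in> polys n \<Longrightarrow> t m (?ev p) = ?ev g * E m p"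
    by metis
  have chain: "dd D (?ev p) = (\<Sum>m<n. osc1 D (?dv m p) (dd D (x m)))" if "p \<in> polys n" for p
    using that by (intro chain_rule[OF kalg O1.module_axioms]) (auto simp: dd_add dd_ksc dd_mult)
  have "osc1 D (?ev g * \<Delta>) (dd D b) = (\<Sum>m<n. osc1 D (t m b) (dd D (x m)))" for b
  proof -
    obtain p where p: "p \<in> polys n" "b = ?ev p" using surj by (metis UNIV_I imageE)
    \<comment> \<open>Summed against the \<open>dd D (x m)\<close>, the Cramer corrections become
      combinations of the differentials of \<open>?ev (f l) = 0\<close>. Hence they drop out of the
      expansion of \<open>dd D b\<close>.\<close>
    have "(\<Sum>m<n. osc1 D (N i m) (dd D (x m))) = 0" for i
    proof -
      have "(\<Sum>m<n. osc1 D (N i m) (dd D (x m))) =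
          (\<Sum>l<c. osc1 D (?Adj i l) (\<Sum>m<n. osc1 D (?dv m (f l)) (dd D (x m))))"
        unfolding N_def O1.scale_sum_left O1.scale_sum_right O1.scale_scale by (rule sum.swap)
      also have "\<dots> = (\<Sum>l<c. osc1 D (?Adj i l) (dd D (?ev (f l))))"
        by (intro sum.cong refl) (simp add: f(1) flip: chain)
      also have "\<dots> = 0" using dd_add[of 0 0] by (simp add: f)
      finally show ?thesis .
    qed
    note N = this
    have N0: "(\<Sum>m<n. osc1 D (\<Sum>i<c. N i m * ?dv (j i) p) (dd D (x m))) = 0"
    proof -
      have "(\<Sum>m<n. osc1 D (\<Sum>i<c. N i m * ?dv (j i) p) (dd D (x m))) =
          (\<Sum>m<n. \<Sum>i<c. osc1 D (?dv (j i) p) (osc1 D (N i m) (dd D (x m))))"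
        unfolding O1.scale_sum_left by (intro sum.cong refl) (simp add: mult.commute)
      also have "\<dots> = (\<Sum>i<c. osc1 D (?dv (j i) p) (\<Sum>m<n. osc1 D (N i m) (dd D (x m))))"
        by (subst sum.swap) (simp only: O1.scale_sum_right)
      finally show ?thesis by (simp add: N)
    qed
    have "(\<Sum>m<n. osc1 D (t m b) (dd D (x m))) = (\<Sum>m<n. osc1 D (?ev g * E m p) (dd D (x m)))"
      using p t by simp
    also have "\<dots> = osc1 D (?ev g) (osc1 D \<Delta> (\<Sum>m<n. osc1 D (?dv m p) (dd D (x m))) -
       (\<Sum>m<n. osc1 D (\<Sum>i<c. N i m * ?dv (j i) p) (dd D (x m))))"
      by (simp add: E_def O1.scale_left_diff_distrib O1.scale_right_diff_distrib sum_subtractf O1.scale_sum_right right_diff_distrib)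
    also have "\<dots> = osc1 D (?ev g * \<Delta>) (dd D b)"
      by (simp add: N0 chain p)
    finally show ?thesis by simp
  qed
  then have "spans_dd (?ev g * \<Delta>) (map (\<lambda>m. (t m, x m)) [0..<n])"
    unfolding spans_dd_def using t(1)
    by (auto simp: comp_def interv_sum_list_conv_sum_set_nat atLeast0LessThan)
  then show ?thesis by blast
qed

text \<open>This replaces gluing by a partition of unity: if the ideal of all \<open>h\<close> with
  an expansion were proper, a prime \<open>p\<close> above it would contain the product of
  \<open>g\<close> and the minor supplied by the criterion at \<open>p\<close>, although neither
  factor lies in \<open>p\<close>.\<close>

theorem smooth_dual_basis:
  assumes "smooth_algebra (ksc D)"
  obtains n t y where "\<And>i. i < n \<Longrightarrow> t i \<in> Der D"
    "\<And>b. dd D b = (\<Sum>i<(n::nat). osc1 D (t i b) (dd D (y i)))"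
proof -
  let ?J = "{h. \<exists>L. spans_dd h L}"
  have "1 \<in> ?J"
  proof (rule ccontr)
    assume "1 \<notin> ?J"
    then obtain p where p: "prime_ideal p" "?J \<subseteq> p"
      using ex_prime_ideal_superset[OF subspace_spans_dd] by blast
    obtain n x where surj: "poly_ev (ksc D) x ` polys n = UNIV"
      and jac: "\<forall>p. prime_ideal p \<longrightarrow> (\<exists>c f g j.
          (\<forall>l<c. f l \<in> polys n \<and> poly_ev (ksc D) x (f l) = 0) \<and>
          g \<in> polys n \<and> poly_ev (ksc D) x g \<notin> p \<and>
          (\<forall>q\<in>polys n. poly_ev (ksc D) x q = 0 \<longrightarrow>
             (\<exists>b. (\<forall>l<c. b l \<in> polys n) \<and> g * q = (\<Sum>l<c. b l * f l))) \<and>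
          (\<forall>i<c. j i < n) \<and>
          det (mat c c (\<lambda>(l, i). poly_ev (ksc D) x (poly_partial (j i) (f l)))) \<notin> p)"
      using assms unfolding smooth_algebra_def by (elim exE conjE) (rule that)
    obtain c f g j where f: "\<forall>l<c. f l \<in> polys n \<and> poly_ev (ksc D) x (f l) = 0"
      and "g \<in> polys n" and g: "poly_ev (ksc D) x g \<notin> p"
      and gen: "\<forall>q\<in>polys n. poly_ev (ksc D) x q = 0 \<longrightarrow>
             (\<exists>b. (\<forall>l<c. b l \<in> polys n) \<and> g * q = (\<Sum>l<c. b l * f l))"
      and "\<forall>i<c. j i < n"
      and det: "det (mat c c (\<lambda>(l, i). poly_ev (ksc D) x (poly_partial (j i) (f l)))) \<notin> p"
      using jac[rule_format, OF p(1)] by (elim exE conjE) (rule that)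
    have "\<exists>L. spans_dd (poly_ev (ksc D) x g *
        det (mat c c (\<lambda>(l, i). poly_ev (ksc D) x (poly_partial (j i) (f l))))) L"
      using f gen by (intro spans_dd_minor[OF surj]) blast+
    then have "poly_ev (ksc D) x g *
        det (mat c c (\<lambda>(l, i). poly_ev (ksc D) x (poly_partial (j i) (f l)))) \<in> p"
      using p(2) by blast
    then show False using p(1) g det unfolding prime_ideal_def by blast
  qed
  then obtain L where L: "spans_dd 1 L" by blast
  show thesis
  proof (rule that[of "length L" "\<lambda>i. fst (L ! i)" "\<lambda>i. snd (L ! i)"])
    show "fst (L ! i) \<in> Der D" if "i < length L" for i
      using L that unfolding spans_dd_def by (meson image_subset_iff nth_mem)
    have "osc1 D 1 (dd D b) = (\<Sum>(t, y)\<leftarrow>L. osc1 D (t b) (dd D y))" for b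
      using L unfolding spans_dd_def by blast
    moreover have "(\<Sum>(t, y)\<leftarrow>L. osc1 D (t b) (dd D y)) =
        (\<Sum>i<length L. osc1 D (fst (L ! i) b) (dd D (snd (L ! i))))" for b
      by (simp add: sum_list_sum_nth atLeast0LessThan case_prod_unfold)
    ultimately show "dd D b = (\<Sum>i<length L. osc1 D (fst (L ! i) b) (dd D (snd (L ! i))))" for b
      unfolding O1.scale_one by metis
  qed
qed

end

text \<open>Evaluation of forms is controlled only on lists of derivations of the right length, so
  alternation has to be transferable from agreement on such lists.\<close>

lemma alt_on_cong:
  assumes S: "Modules.module.subspace sV S" "Modules.module sV"
    and eq: "\<And>ts. set ts \<subseteq> S \<Longrightarrow> length ts = p \<Longrightarrow> L ts = L' ts" and alt: "alt_on p S sV sN L"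
  shows "alt_on p S sV sN L'"
  unfolding alt_on_def
proof (intro conjI allI impI)
  note add = module.subspace_add[OF S(2,1)] and scale = module.subspace_scale[OF S(2,1)]
  show "L' (xs @ (x + y) # ys) = L' (xs @ x # ys) + L' (xs @ y # ys)"
    if "set (xs @ x # y # ys) \<subseteq> S" "length xs + length ys + 1 = p" for xs x y ys
    using alt_onD(1)[OF alt that] that add[of x y] by (simp add: eq[symmetric])
  show "L' (xs @ sV a x # ys) = sN a (L' (xs @ x # ys))"
    if "set (xs @ x # ys) \<subseteq> S" "length xs + length ys + 1 = p" for xs a x ys
    using alt_onD(2)[OF alt that] that scale[of x a] by (simp add: eq[symmetric])
  show "L' xs = 0" if "set xs \<subseteq> S" "length xs = p" "\<not> distinct xs" for xs
    using alt_onD(3)[OF alt that] that by (simp add: eq[symmetric])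
qed

lemma alt_on_plus:
  "alt_on p S sV (*) L \<Longrightarrow> alt_on p S sV (*) L' \<Longrightarrow> alt_on p S sV (*) (\<lambda>ts. L ts + L' ts)"
  unfolding alt_on_def by (simp add: algebra_simps)

lemma alt_on_mult:
  "alt_on p S sV (*) L \<Longrightarrow> alt_on p S sV (*) (\<lambda>ts. a * L ts)"
  unfolding alt_on_def by (simp add: algebra_simps)

lemma alt_on_zero: "alt_on p S sV (*) (\<lambda>ts. 0)"
  unfolding alt_on_def by simp

lemma det_mat_cong: "(\<And>i j. i < p \<Longrightarrow> j < p \<Longrightarrow> f i j = g i j) \<Longrightarrow>
    det (mat p p (\<lambda>(i, j). f i j)) = det (mat p p (\<lambda>(i, j). g i j))"
  by (intro arg_cong[where f=det] eq_matI) auto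

section \<open>The pairing of derivations with 1-forms\<close>

context algebra_forms
begin

lemma O1_induct [case_names 0 add gen]:
  "P 0 \<Longrightarrow> (\<And>x y. P x \<Longrightarrow> P y \<Longrightarrow> P (x + y)) \<Longrightarrow> (\<And>a b. P (osc1 D a (dd D b))) \<Longrightarrow> P w"
  by (rule presented_induct[OF kaehler])

lemma dd_0: "dd D 0 = 0" using dd_add[of 0 0] by simp
lemma dd_minus: "dd D (- a) = - dd D a" using dd_add[of a "- a"] by (simp add: dd_0 eq_neg_iff_add_eq_0 add.commute)
lemma dd_diff: "dd D (a - b) = dd D a - dd D b" using dd_add[of "a - b" b] by simp

lemma pair_spec:
  assumes t: "t \<in> Der D"
  shows "module_hom (osc1 D) (*) (pair D t) \<and> (\<forall>b. pair D t (dd D b) = t b)"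
proof -
  interpret E: module_hom free_scale "(*)" "free_ext (*) t"
    by (rule module_hom_free_ext[OF module_mult])
  have "\<exists>!\<phi>. module_hom (osc1 D) (*) \<phi> \<and> (\<forall>b\<in>UNIV. \<phi> (dd D b) = t b)"
  proof (rule presented_ext[OF kaehler module_mult])
    fix u assume "u \<in> kaehler_rels (ksc D)"
    then show "free_ext (*) t u = 0"
      unfolding kaehler_rels_def
      by (auto simp: E.diff E.add free_ext_single module_mult Der_add[OF t] Der_ksc[OF t] Der_mult[OF t]
          ksc_mult[of _ "t _"])
  qed
  then have "\<exists>!\<phi>. module_hom (osc1 D) (*) \<phi> \<and> (\<forall>b. \<phi> (dd D b) = t b)" by simp
  from theI'[OF this] show ?thesis unfolding pair_def .
qed

lemma
  assumes t: "t \<in> Der D"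
  shows pair_hom: "module_hom (osc1 D) (*) (pair D t)" and pair_dd: "pair D t (dd D b) = t b"
  using pair_spec[OF t] by auto

lemma
  assumes t: "t \<in> Der D"
  shows pair_add: "pair D t (v + w) = pair D t v + pair D t w"
    and pair_osc: "pair D t (osc1 D a w) = a * pair D t w"
    and pair_0: "pair D t 0 = 0"
    and pair_minus: "pair D t (- w) = - pair D t w"
    and pair_diff: "pair D t (v - w) = pair D t v - pair D t w"
    and pair_sum: "pair D t (sum f I) = (\<Sum>i\<in>I. pair D t (f i))"
proof -
  interpret module_hom "osc1 D" "(*)" "pair D t" by (rule pair_hom[OF t])
  show "pair D t (v + w) = pair D t v + pair D t w" "pair D t (osc1 D a w) = a * pair D t w"
    "pair D t 0 = 0" "pair D t (- w) = - pair D t w" "pair D t (v - w) = pair D t v - pair D t w"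
    "pair D t (sum f I) = (\<Sum>i\<in>I. pair D t (f i))"
    by (simp_all add: add scale zero neg diff sum)
qed

lemmas pair_simps = pair_add pair_osc pair_0 pair_minus pair_diff pair_dd

lemma pair_plus_left: "s \<in> Der D \<Longrightarrow> t \<in> Der D \<Longrightarrow> pair D (s + t) w = pair D s w + pair D t w"
  by (induct w rule: O1_induct) (simp_all add: pair_simps Der_plus algebra_simps)

lemma pair_tsc: "t \<in> Der D \<Longrightarrow> pair D (tsc a t) w = a * pair D t w"
  by (induct w rule: O1_induct) (simp_all add: pair_simps Der_tsc, simp_all add: tsc_def algebra_simps)

end

text \<open>A dual basis in the sense of projective modules: the \<open>dd D (yb i)\<close> generate
  the 1-forms and the \<open>tb i\<close> are coordinate functionals for them. Linear independence
  is not part of the notion.\<close>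

locale smooth_forms = algebra_forms D
  for D :: "('k::field_char_0, 'a::comm_ring_1, 'w1::ab_group_add, 'w2::ab_group_add,
                'w3::ab_group_add, 'w4::ab_group_add) forms" +
  fixes n :: nat and tb :: "nat \<Rightarrow> 'a \<Rightarrow> 'a" and yb :: "nat \<Rightarrow> 'a"
  assumes tb: "\<And>i. i < n \<Longrightarrow> tb i \<in> Der D"
    and dd_expand: "\<And>b. dd D b = (\<Sum>i<n. osc1 D (tb i b) (dd D (yb i)))"
begin

lemma O1_expand: "w = (\<Sum>i<n. osc1 D (pair D (tb i) w) (dd D (yb i)))"
proof (induct w rule: O1_induct)
  case 0
  show ?case by (simp add: pair_0 tb)
next
  case (add x y)
  have "(\<Sum>i<n. osc1 D (pair D (tb i) (x + y)) (dd D (yb i))) =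
    (\<Sum>i<n. osc1 D (pair D (tb i) x) (dd D (yb i))) + (\<Sum>i<n. osc1 D (pair D (tb i) y) (dd D (yb i)))"
    by (simp add: pair_add tb O1.scale_left_distrib sum.distrib)
  then show ?case using add by simp
next
  case (gen a b)
  have "(\<Sum>i<n. osc1 D (pair D (tb i) (osc1 D a (dd D b))) (dd D (yb i))) =
      osc1 D a (\<Sum>i<n. osc1 D (tb i b) (dd D (yb i)))"
    by (simp add: pair_simps tb O1.scale_sum_right)
  then show ?case using dd_expand[of b] by simp
qed

text \<open>Pairing \<open>s\<close> with the expansion of \<open>dd D b\<close>: the same data
  expand vector fields, with coordinates \<open>s (yb i)\<close>.\<close>

lemma Der_expand:
  assumes "s \<in> Der D"
  shows "s = (\<Sum>i<n. tsc (s (yb i)) (tb i))"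
proof
  fix b
  have *: "(\<Sum>i<m. tsc (s (yb i)) (tb i)) b = (\<Sum>i<m. tb i b * s (yb i))" for m
    by (induct m) (simp_all add: tsc_def mult.commute)
  have "s b = pair D s (dd D b)" by (simp add: pair_dd assms)
  also have "\<dots> = pair D s (\<Sum>i<n. osc1 D (tb i b) (dd D (yb i)))"
    using dd_expand[of b] by simp
  also have "\<dots> = (\<Sum>i<n. tb i b * s (yb i))"
    by (simp add: pair_sum pair_simps assms)
  finally show "s b = (\<Sum>i<n. tsc (s (yb i)) (tb i)) b" by (simp only: *)
qed

text \<open>The coordinates in \<open>O1_expand\<close> are pairings with the \<open>tb i\<close>.
  This is the tool that turns equations between 1-forms into scalar identities.\<close>

lemma pair_separates:
  assumes "\<And>t. t \<in> Der D \<Longrightarrow> pair D t v = pair D t w"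
  shows "v = w"
  using O1_expand[of v] O1_expand[of w] assms tb by simp

text \<open>The defining rule is not A-linear, so the presentation gives uniqueness but not
  existence. The map \<open>\<psi>\<close> has as i-th coordinate the value that the identity of
  \<open>pair_lie\<close> prescribes for the pairing with \<open>tb i\<close>.\<close>

lemma lie_spec:
  assumes t: "t \<in> Der D"
  shows "additive (lie D t) \<and>
    (\<forall>a b. lie D t (osc1 D a (dd D b)) = osc1 D (t a) (dd D b) + osc1 D a (dd D (t b)))"
proof -
  define \<psi> where "\<psi> w = (\<Sum>i<n. osc1 D (t (pair D (tb i) w) - pair D (bracket t (tb i)) w) (dd D (yb i)))" for w
  have add: "additive \<psi>"
    unfolding additive_def \<psi>_def
    by (simp add: pair_add tb bracket_Der t Der_add[OF t] O1.scale_left_distrib O1.scale_left_diff_distrib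
        sum.distrib sum_subtractf)
  have "t (pair D s (osc1 D a (dd D b))) - pair D (bracket t s) (osc1 D a (dd D b)) =
    pair D s (osc1 D (t a) (dd D b) + osc1 D a (dd D (t b)))" if "s \<in> Der D" for s a b
    using that t by (simp add: pair_simps bracket_Der Der_mult) (simp add: bracket_def algebra_simps)
  then have gen: "\<psi> (osc1 D a (dd D b)) = osc1 D (t a) (dd D b) + osc1 D a (dd D (t b))" for a b
    unfolding \<psi>_def using O1_expand[of "osc1 D (t a) (dd D b) + osc1 D a (dd D (t b))"] tb by simp
  have "\<exists>!\<phi>. additive \<phi> \<and>
      (\<forall>a b. \<phi> (osc1 D a (dd D b)) = osc1 D (t a) (dd D b) + osc1 D a (dd D (t b)))"
    using add gen by (intro ex1I[of _ \<psi>]) (auto intro!: presented_additive_unique[OF kaehler])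
  from theI'[OF this] show ?thesis unfolding lie_def .
qed

lemma
  assumes t: "t \<in> Der D"
  shows lie_add: "lie D t (v + w) = lie D t v + lie D t w"
    and lie_0: "lie D t 0 = 0"
    and lie_minus: "lie D t (- w) = - lie D t w"
    and lie_diff: "lie D t (v - w) = lie D t v - lie D t w"
  using lie_spec[OF t] additive.add additive.zero additive.minus additive.diff by blast+

lemma pair_lie:
  assumes s: "s \<in> Der D" and t: "t \<in> Der D"
  shows "pair D s (lie D t w) = t (pair D s w) - pair D (bracket t s) w"
proof (induct w rule: O1_induct)
  case (gen a b)
  show ?case using s t lie_spec[OF t] by (simp add: pair_simps bracket_Der Der_mult) (simp add: bracket_def algebra_simps)
qed (simp_all add: lie_0 lie_add pair_simps s t bracket_Der Der_0[OF t] Der_add[OF t])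

end


section \<open>Evaluation of forms\<close>

locale exterior_forms = smooth_forms D n tb yb
  for D :: "('k::field_char_0, 'a::comm_ring_1, 'w1::ab_group_add, 'w2::ab_group_add,
                'w3::ab_group_add, 'w4::ab_group_add) forms" and n tb yb +
  fixes p :: nat and osc :: "'a \<Rightarrow> 'n::ab_group_add \<Rightarrow> 'n" and wedge :: "'w1 list \<Rightarrow> 'n"
  assumes ext: "exterior_power p (osc1 D) osc wedge"
begin

lemmas presented = ext[unfolded exterior_power_def]

sublocale N: Modules.module osc by (rule presented_module[OF presented])

sublocale W: alternating "osc1 D" osc p UNIV wedge
  by (rule exterior_wedge[OF O1.module_axioms ext])

text \<open>The common form of \<open>eval2\<close> and \<open>eval3\<close>; the case p = 4 is
  needed to test whether the differential of a 3-form vanishes.\<close>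

definition ev :: "('a \<Rightarrow> 'a) list \<Rightarrow> 'n \<Rightarrow> 'a" where
  "ev ts = (THE \<phi>. module_hom osc (*) \<phi> \<and> (\<forall>ws. length ws = p \<longrightarrow>
     \<phi> (wedge ws) = det (mat p p (\<lambda>(i, j). pair D (ts ! i) (ws ! j)))))"

abbreviation vectors :: "('a \<Rightarrow> 'a) list \<Rightarrow> bool" where
  "vectors ts \<equiv> set ts \<subseteq> Der D \<and> length ts = p"

lemma ev_spec:
  assumes "vectors ts"
  shows "module_hom osc (*) (ev ts) \<and> (\<forall>ws. length ws = p \<longrightarrow>
     ev ts (wedge ws) = det (mat p p (\<lambda>(i, j). pair D (ts ! i) (ws ! j))))"
proof -
  have ts: "ts ! i \<in> Der D" if "i < p" for i using assms that by (auto simp: subset_iff)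
  have "alt_on p UNIV (osc1 D) (*) (\<lambda>ws. det (mat p p (\<lambda>(i, j). pair D (ts ! i) (ws ! j))))"
    using ts by (intro alt_on_det_transpose) (auto simp: pair_simps)
  from theI'[OF exterior_ext[OF ext module_mult this]] show ?thesis unfolding ev_def .
qed

lemma
  assumes "vectors ts"
  shows ev_wedge: "length ws = p \<Longrightarrow> ev ts (wedge ws) = det (mat p p (\<lambda>(i, j). pair D (ts ! i) (ws ! j)))"
    and ev_add: "ev ts (\<omega> + \<omega>') = ev ts \<omega> + ev ts \<omega>'"
    and ev_osc: "ev ts (osc a \<omega>) = a * ev ts \<omega>"
    and ev_0: "ev ts 0 = 0"
    and ev_diff: "ev ts (\<omega> - \<omega>') = ev ts \<omega> - ev ts \<omega>'"
    and ev_sum: "ev ts (sum f I) = (\<Sum>i\<in>I. ev ts (f i))"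
proof -
  show "length ws = p \<Longrightarrow> ev ts (wedge ws) = det (mat p p (\<lambda>(i, j). pair D (ts ! i) (ws ! j)))"
    using ev_spec[OF assms] by simp
  interpret module_hom osc "(*)" "ev ts" using ev_spec[OF assms] by simp
  show "ev ts (\<omega> + \<omega>') = ev ts \<omega> + ev ts \<omega>'" "ev ts (osc a \<omega>) = a * ev ts \<omega>" "ev ts 0 = 0"
    "ev ts (\<omega> - \<omega>') = ev ts \<omega> - ev ts \<omega>'"
    "ev ts (sum f I) = (\<Sum>i\<in>I. ev ts (f i))"
    by (simp_all add: add scale zero diff sum)
qed

lemma alt_on_ev: "alt_on p (Der D) tsc (*) (\<lambda>ts. ev ts \<omega>)"
proof -
  note cong = alt_on_cong[OF subspace_Der TS.module_axioms]
  show ?thesis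
  proof (induct \<omega> rule: presented_induct[OF presented])
    case 1
    show ?case by (rule cong[OF _ alt_on_zero]) (simp add: ev_0)
  next
    case (2 x y)
    show ?case by (rule cong[OF _ alt_on_plus[OF 2]]) (simp add: ev_add)
  next
    case (3 a ws)
    have "alt_on p (Der D) tsc (*) (\<lambda>ts. det (mat p p (\<lambda>(i, j). pair D (ts ! i) (ws ! j))))"
      by (rule alt_on_det) (simp_all only: pair_plus_left pair_tsc)
    from alt_on_mult[OF this, of a] show ?case
      by (rule cong[rotated]) (use 3 in \<open>simp add: ev_osc ev_wedge\<close>)
  qed
qed

text \<open>The inverse of evaluation. The division by p! compensates for summing over all words of
  indices instead of the strictly increasing ones.\<close>

definition of_alt :: "(('a \<Rightarrow> 'a) list \<Rightarrow> 'a) \<Rightarrow> 'n" where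
  "of_alt L = osc (ksc D (1 / fact p) 1)
     (\<Sum>is | length is = p \<and> set is \<subseteq> {..<n}. osc (L (map tb is)) (wedge (map (\<lambda>i. dd D (yb i)) is)))"

lemma inverse_fact: "ksc D (1 / fact p) 1 * of_nat (fact p) = 1"
proof -
  have "ksc D r 1 * of_nat m = ksc D (r * of_nat m) 1" for r m
    by (induct m) (simp_all add: distrib_left K.scale_left_distrib)
  from this[of "1 / fact p" "fact p"] show ?thesis by simp
qed

lemma vectors_tb: "length is = p \<and> set is \<subseteq> {..<n} \<Longrightarrow> vectors (map tb is)"
  using tb by auto

text \<open>\<open>det_expand\<close> for the wedge product, with 1-forms expanded in the
  \<open>dd D (yb i)\<close>.\<close>

lemma of_alt_ev: "of_alt (\<lambda>ts. ev ts \<omega>) = \<omega>"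
proof -
  let ?S = "\<lambda>\<omega>. \<Sum>is | length is = p \<and> set is \<subseteq> {..<n}.
       osc (ev (map tb is) \<omega>) (wedge (map (\<lambda>i. dd D (yb i)) is))"
  have "?S \<omega> = osc (of_nat (fact p)) \<omega>"
  proof (induct \<omega> rule: presented_induct[OF presented])
    case 1
    show ?case by (simp add: ev_0[OF vectors_tb])
  next
    case (2 x y)
    have "?S (x + y) = ?S x + ?S y"
      by (simp add: ev_add[OF vectors_tb] N.scale_left_distrib sum.distrib)
    then show ?case using 2 by (simp add: N.scale_right_distrib)
  next
    case (3 a ws)
    then have ws: "length ws = p" by simp
    have "?S (osc a (wedge ws)) = osc a (?S (wedge ws))"
      by (simp add: ev_osc[OF vectors_tb] N.scale_sum_right)
    also have "?S (wedge ws) = (\<Sum>is | length is = p \<and> set is \<subseteq> {..<n}.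
      osc (det (mat p p (\<lambda>(i, j). pair D (tb (is ! i)) (ws ! j)))) (wedge (map (\<lambda>i. dd D (yb i)) is)))"
      by (intro sum.cong refl arg_cong2[where f=osc])
        (auto simp: ev_wedge[OF vectors_tb] ws intro!: det_mat_cong)
    also have "\<dots> = osc (of_nat (fact p)) (wedge ws)"
      by (rule W.det_expand[where c="\<lambda>i w. pair D (tb i) w"]) (use ws O1_expand in auto)
    finally show ?case by (simp add: mult.commute)
  qed
  then show ?thesis
    unfolding of_alt_def by (simp add: inverse_fact del: of_nat_fact)
qed

text \<open>\<open>det_expand\<close> for \<open>L\<close>, with vector fields expanded in the
  \<open>tb i\<close>.\<close>

lemma ev_of_alt:
  assumes alt: "alt_on p (Der D) tsc (*) L" and ts: "vectors ts"
  shows "ev ts (of_alt L) = L ts"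
proof -
  interpret T: alternating "tsc :: 'a \<Rightarrow> ('a \<Rightarrow> 'a) \<Rightarrow> _" "(*)" p "Der D" L
    by (intro alternating.intro alternating_axioms.intro TS.module_axioms module_mult subspace_Der alt)
  have "ev ts (of_alt L) = ksc D (1 / fact p) 1 * (\<Sum>is | length is = p \<and> set is \<subseteq> {..<n}.
     det (mat p p (\<lambda>(a, b). (ts ! b) (yb (is ! a)))) * L (map tb is))"
    unfolding of_alt_def ev_osc[OF ts] ev_sum[OF ts]
  proof (rule arg_cong[where f="\<lambda>z. ksc D (1 / fact p) 1 * z"], rule sum.cong[OF refl])
    fix js assume js: "js \<in> {is. length is = p \<and> set is \<subseteq> {..<n}}"
    have "ev ts (wedge (map (\<lambda>i. dd D (yb i)) js)) =
        det (mat p p (\<lambda>(i, j). pair D (ts ! i) (map (\<lambda>i. dd D (yb i)) js ! j)))"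
      using js ts by (intro ev_wedge) auto
    also have "\<dots> = det (mat p p (\<lambda>(i, j). (ts ! i) (yb (js ! j))))"
      using js ts by (intro det_mat_cong) (auto simp: subset_iff pair_dd)
    \<comment> \<open>Evaluation has the index word on the columns, \<open>det_expand\<close> has it
      on the rows.\<close>
    also have "\<dots> = det (mat p p (\<lambda>(a, b). (ts ! b) (yb (js ! a))))"
      by (subst det_transpose[symmetric, where n=p], simp) (intro arg_cong[where f=det], auto)
    finally show "L (map tb js) * ev ts (wedge (map (\<lambda>i. dd D (yb i)) js)) =
        det (mat p p (\<lambda>(a, b). (ts ! b) (yb (js ! a)))) * L (map tb js)" by simp
  qed
  also have "\<dots> = ksc D (1 / fact p) 1 * (of_nat (fact p) * L ts)"
    by (subst T.det_expand[where c="\<lambda>i s. s (yb i)"])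
      (use ts tb Der_expand in \<open>auto simp: subset_iff\<close>)
  finally show ?thesis using inverse_fact by (simp add: mult.assoc[symmetric] del: of_nat_fact)
qed

lemma of_alt_cong: "(\<And>ts. vectors ts \<Longrightarrow> L ts = L' ts) \<Longrightarrow> of_alt L = of_alt L'"
  unfolding of_alt_def using vectors_tb by (intro arg_cong2[where f=osc] refl sum.cong) auto

lemma of_alt_add: "of_alt (\<lambda>ts. L ts + L' ts) = of_alt L + of_alt L'"
  by (simp add: of_alt_def N.scale_left_distrib N.scale_right_distrib sum.distrib)

lemma ev_inject: "(\<And>ts. vectors ts \<Longrightarrow> ev ts \<omega> = ev ts \<omega>') \<Longrightarrow> \<omega> = \<omega>'"
  using of_alt_cong[of "\<lambda>ts. ev ts \<omega>" "\<lambda>ts. ev ts \<omega>'"] by (simp add: of_alt_ev)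

text \<open>The unique existence behind \<open>form2_map\<close> and \<open>form3_map\<close>:
  filling all slots but the last leaves an A-linear functional on vector fields, represented by the
  1-form whose coordinates are its values on the \<open>tb i\<close>.\<close>

lemma ev_contract:
  assumes xs: "set xs \<subseteq> Der D" "length xs + 1 = p"
  shows "\<exists>!w. \<forall>t\<in>Der D. pair D t w = ev (xs @ [t]) \<omega>"
proof -
  interpret T: alternating "tsc :: 'a \<Rightarrow> ('a \<Rightarrow> 'a) \<Rightarrow> _" "(*)" p "Der D" "\<lambda>ts. ev ts \<omega>"
    by (intro alternating.intro alternating_axioms.intro TS.module_axioms module_mult subspace_Der alt_on_ev)
  define w where "w = (\<Sum>i<n. osc1 D (ev (xs @ [tb i]) \<omega>) (dd D (yb i)))"
  have "pair D t w = ev (xs @ [t]) \<omega>" if t: "t \<in> Der D" for t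
  proof -
    have "pair D t w = (\<Sum>i<n. t (yb i) * ev (xs @ [tb i]) \<omega>)"
      by (simp add: w_def pair_sum pair_simps t mult.commute)
    also have "\<dots> = ev (xs @ [\<Sum>i<n. tsc (t (yb i)) (tb i)]) \<omega>"
      by (rule T.L_sum[symmetric]) (use xs tb in auto)
    finally show ?thesis using Der_expand[OF t] by simp
  qed
  then show ?thesis by (intro ex1I[of _ w]) (auto intro: pair_separates)
qed

text \<open>The presentation generates by wedges of arbitrary 1-forms, whereas the de Rham
  differential is specified on wedges of exact ones. These suffice because \<open>of_alt_ev\<close>
  writes every form as a combination of wedges of the \<open>dd D (yb i)\<close>.\<close>

lemma forms_induct [case_names 0 add gen]:
  assumes "P 0" "\<And>x y. P x \<Longrightarrow> P y \<Longrightarrow> P (x + y)"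
    and "\<And>a bs. length bs = p \<Longrightarrow> P (osc a (wedge (map (dd D) bs)))"
  shows "P \<omega>"
proof -
  have "P (\<Sum>is\<in>I. osc (c is) (wedge (map (dd D) (map yb is))))"
    if "finite I" "I \<subseteq> {is. length is = p \<and> set is \<subseteq> {..<n}}" for I :: "nat list set" and c
    using that by (induct I) (auto intro!: assms simp del: map_map)
  from this[of "{is. length is = p \<and> set is \<subseteq> {..<n}}" "\<lambda>is. ksc D (1 / fact p) 1 * ev (map tb is) \<omega>"]
  moreover have "finite {is. length is = p \<and> set is \<subseteq> {..<n}}"
    using finite_lists_length_eq[of "{..<n}" p] by (simp add: conj_commute)
  ultimately have "P (of_alt (\<lambda>ts. ev ts \<omega>))"
    by (simp add: of_alt_def N.scale_sum_right comp_def)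
  then show ?thesis by (simp add: of_alt_ev)
qed

lemma additive_unique:
  assumes "additive \<phi>" "additive \<psi>"
    and "\<And>a bs. length bs = p \<Longrightarrow> \<phi> (osc a (wedge (map (dd D) bs))) = \<psi> (osc a (wedge (map (dd D) bs)))"
  shows "\<phi> = \<psi>"
proof
  fix \<omega>
  show "\<phi> \<omega> = \<psi> \<omega>"
    by (induct \<omega> rule: forms_induct)
      (simp_all add: assms(3) additive.add[OF assms(1)] additive.add[OF assms(2)]
        additive.zero[OF assms(1)] additive.zero[OF assms(2)])
qed

end


section \<open>The de Rham differential\<close>

lemma det_mat_Suc:
  "det (mat (Suc p) (Suc p) (\<lambda>(i, j). f i j :: 'a::comm_ring_1)) =
    (\<Sum>i<Suc p. f i 0 * ((-1) ^ i * det (mat p p (\<lambda>(i', j'). f (if i' < i then i' else Suc i') (Suc j')))))"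
proof -
  let ?M = "mat (Suc p) (Suc p) (\<lambda>(i, j). f i j)"
  have "det ?M = (\<Sum>i<Suc p. ?M $$ (i, 0) * cofactor ?M i 0)"
    by (rule laplace_expansion_column) simp_all
  also have "\<dots> = (\<Sum>i<Suc p. f i 0 * ((-1) ^ i * det (mat p p (\<lambda>(i', j'). f (if i' < i then i' else Suc i') (Suc j')))))"
  proof (intro sum.cong refl)
    fix i assume "i \<in> {..<Suc p}"
    then have "mat_delete ?M i 0 = mat p p (\<lambda>(i', j'). f (if i' < i then i' else Suc i') (Suc j'))"
      by (intro eq_matI) (auto simp: mat_delete_def)
    then show "?M $$ (i, 0) * cofactor ?M i 0 =
        f i 0 * ((-1) ^ i * det (mat p p (\<lambda>(i', j'). f (if i' < i then i' else Suc i') (Suc j'))))"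
      using \<open>i \<in> {..<Suc p}\<close> by (simp add: cofactor_def)
  qed
  finally show ?thesis .
qed

lemma det_mat_1: "det (mat (Suc 0) (Suc 0) (\<lambda>(i, j). f i j :: 'a::comm_ring_1)) = f 0 0"
  unfolding det_mat_Suc by (simp add: det_dim_zero)

lemma det_mat_2: "det (mat 2 2 (\<lambda>(i, j). f i j :: 'a::comm_ring_1)) = f 0 0 * f 1 1 - f 1 0 * f 0 1"
  unfolding numeral_2_eq_2 det_mat_Suc[of "Suc _"] by (simp add: det_mat_1)

lemma det_mat_3: "det (mat 3 3 (\<lambda>(i, j). f i j :: 'a::comm_ring_1)) =
    f 0 0 * (f 1 1 * f 2 2 - f 2 1 * f 1 2) - f 1 0 * (f 0 1 * f 2 2 - f 2 1 * f 0 2) +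
    f 2 0 * (f 0 1 * f 1 2 - f 1 1 * f 0 2)"
proof -
  have *: "(3::nat) = Suc 2" "{..<Suc 2} = {0, 1, 2}" by auto
  show ?thesis unfolding *(1) det_mat_Suc[of 2] det_mat_2 *(2) by (simp add: numeral_2_eq_2[symmetric] algebra_simps)
qed

lemma det_mat_4: "det (mat 4 4 (\<lambda>(i, j). f i j :: 'a::comm_ring_1)) =
    f 0 0 * det (mat 3 3 (\<lambda>(i, j). f (Suc i) (Suc j)))
    - f 1 0 * det (mat 3 3 (\<lambda>(i, j). f (if i < 1 then i else Suc i) (Suc j)))
    + f 2 0 * det (mat 3 3 (\<lambda>(i, j). f (if i < 2 then i else Suc i) (Suc j)))
    - f 3 0 * det (mat 3 3 (\<lambda>(i, j). f (if i < 3 then i else Suc i) (Suc j)))"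
proof -
  have *: "(4::nat) = Suc 3" "{..<Suc 3} = {0, 1, 2, 3}" by auto
  show ?thesis unfolding *(1) det_mat_Suc[of 3] *(2) by simp
qed

text \<open>Here \<open>\<beta>\<close> is the value of the wedge of the differentials of b, c and e
  on three vector fields. The identity is the Cartan formula for the differential of this closed
  form: the second derivatives cancel against the bracket terms.\<close>

lemma koszul_identity:
  fixes s t u v :: "'a::comm_ring_1 \<Rightarrow> 'a"
  assumes mult: "\<And>x y. s (x * y) = x * s y + y * s x" "\<And>x y. t (x * y) = x * t y + y * t x"
      "\<And>x y. u (x * y) = x * u y + y * u x" "\<And>x y. v (x * y) = x * v y + y * v x"
    and diff: "\<And>x y. s (x - y) = s x - s y" "\<And>x y. t (x - y) = t x - t y"
      "\<And>x y. u (x - y) = u x - u y" "\<And>x y. v (x - y) = v x - v y"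
    and add: "\<And>x y. s (x + y) = s x + s y" "\<And>x y. t (x + y) = t x + t y"
      "\<And>x y. u (x + y) = u x + u y" "\<And>x y. v (x + y) = v x + v y"
    and \<beta>: "\<And>s t u. \<beta> s t u =
      s b * (t c * u e - t e * u c) - t b * (s c * u e - s e * u c) + u b * (s c * t e - s e * t c)"
    and br: "\<And>s t. br s t = (\<lambda>x. s (t x) - t (s x))"
  shows "s (\<beta> t u v) - t (\<beta> s u v) + u (\<beta> s t v) - v (\<beta> s t u)
    - \<beta> (br s t) u v + \<beta> (br s u) t v - \<beta> (br s v) t u
    - \<beta> (br t u) s v + \<beta> (br t v) s u - \<beta> (br u v) s t = 0"
  by (simp only: \<beta> br mult diff add, simp only: algebra_simps, simp)

context smooth_forms
begin

sublocale E2: exterior_forms D n tb yb 2 "osc2 D" "wedge2 D"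
  by unfold_locales (use forms in \<open>simp add: forms_of_algebra_def\<close>)

sublocale E3: exterior_forms D n tb yb 3 "osc3 D" "wedge3 D"
  by unfold_locales (use forms in \<open>simp add: forms_of_algebra_def\<close>)

sublocale E4: exterior_forms D n tb yb 4 "osc4 D" "wedge4 D"
  by unfold_locales (use forms in \<open>simp add: forms_of_algebra_def\<close>)

lemma eval2_eq: "eval2 D \<eta> ts = E2.ev ts \<eta>"
  by (simp add: eval2_def E2.ev_def)

lemma eval3_eq: "eval3 D \<omega> ts = E3.ev ts \<omega>"
  by (simp add: eval3_def E3.ev_def)

text \<open>The Cartan formula for the differential, evaluated on vector fields. It carries no
  factorials, in agreement with evaluation by determinants.\<close>

definition cartan2 :: "(('a \<Rightarrow> 'a) list \<Rightarrow> 'a) \<Rightarrow> ('a \<Rightarrow> 'a) \<Rightarrow> ('a \<Rightarrow> 'a) \<Rightarrow> ('a \<Rightarrow> 'a) \<Rightarrow> 'a" where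
  "cartan2 \<beta> s t u = s (\<beta> [t, u]) - t (\<beta> [s, u]) + u (\<beta> [s, t])
    - \<beta> [bracket s t, u] + \<beta> [bracket s u, t] - \<beta> [bracket t u, s]"

definition cartan3 :: "(('a \<Rightarrow> 'a) list \<Rightarrow> 'a) \<Rightarrow> ('a \<Rightarrow> 'a) \<Rightarrow> ('a \<Rightarrow> 'a) \<Rightarrow> ('a \<Rightarrow> 'a) \<Rightarrow> ('a \<Rightarrow> 'a) \<Rightarrow> 'a" where
  "cartan3 \<beta> s t u v = s (\<beta> [t, u, v]) - t (\<beta> [s, u, v]) + u (\<beta> [s, t, v]) - v (\<beta> [s, t, u])
    - \<beta> [bracket s t, u, v] + \<beta> [bracket s u, t, v] - \<beta> [bracket s v, t, u]
    - \<beta> [bracket t u, s, v] + \<beta> [bracket t v, s, u] - \<beta> [bracket u v, s, t]"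

lemma E2_ev_gen:
  assumes "s \<in> Der D" "t \<in> Der D"
  shows "E2.ev [s, t] (osc2 D a (wedge2 D [dd D b, dd D c])) = a * (s b * t c - s c * t b)"
  using assms by (simp add: E2.ev_osc E2.ev_wedge det_mat_2 pair_dd algebra_simps)

lemma E3_ev_gen:
  assumes "s \<in> Der D" "t \<in> Der D" "u \<in> Der D"
  shows "E3.ev [s, t, u] (osc3 D a (wedge3 D [dd D b, dd D c, dd D e])) =
    a * (s b * (t c * u e - t e * u c) - t b * (s c * u e - s e * u c) + u b * (s c * t e - s e * t c))"
  using assms by (simp add: E3.ev_osc E3.ev_wedge det_mat_3 pair_dd algebra_simps)

lemma E4_ev_gen:
  assumes "s \<in> Der D" "t \<in> Der D" "u \<in> Der D" "v \<in> Der D"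
  shows "E4.ev [s, t, u, v] (wedge4 D [dd D a, dd D b, dd D c, dd D e]) =
    s a * E3.ev [t, u, v] (osc3 D 1 (wedge3 D [dd D b, dd D c, dd D e])) -
    t a * E3.ev [s, u, v] (osc3 D 1 (wedge3 D [dd D b, dd D c, dd D e])) +
    u a * E3.ev [s, t, v] (osc3 D 1 (wedge3 D [dd D b, dd D c, dd D e])) -
    v a * E3.ev [s, t, u] (osc3 D 1 (wedge3 D [dd D b, dd D c, dd D e]))"
  using assms unfolding E3_ev_gen[OF assms(2-4)] E3_ev_gen[OF assms(1,3,4)] E3_ev_gen[OF assms(1,2,4)] E3_ev_gen[OF assms(1-3)]
  by (simp add: E4.ev_wedge det_mat_4 det_mat_3 pair_dd algebra_simps)

lemma cartan2_gen:
  assumes "s \<in> Der D" "t \<in> Der D" "u \<in> Der D"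
  shows "cartan2 (\<lambda>ts. E2.ev ts (osc2 D a (wedge2 D [dd D b, dd D c]))) s t u =
    E3.ev [s, t, u] (osc3 D 1 (wedge3 D [dd D a, dd D b, dd D c]))"
  unfolding cartan2_def
  by (simp add: E2_ev_gen E3_ev_gen bracket_Der assms del: O1.scale_one E3.N.scale_one,
    simp add: bracket_def Der_mult Der_diff assms, simp add: algebra_simps)

text \<open>By the Leibniz rule the Cartan expression of \<open>a\<close> times
  \<open>\<beta>\<close> splits into the terms that differentiate \<open>a\<close>, which are the
  expansion of the 4x4 determinant along its first column, and \<open>a\<close> times the expression
  that vanishes by \<open>koszul_identity\<close>.\<close>

lemma cartan3_gen:
  assumes "s \<in> Der D" "t \<in> Der D" "u \<in> Der D" "v \<in> Der D"
  shows "cartan3 (\<lambda>ts. E3.ev ts (osc3 D a (wedge3 D [dd D b, dd D c, dd D e]))) s t u v =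
    E4.ev [s, t, u, v] (wedge4 D [dd D a, dd D b, dd D c, dd D e])"
proof -
  define \<beta> where "\<beta> = (\<lambda>s t u. s b * (t c * u e - t e * u c) - t b * (s c * u e - s e * u c) + u b * (s c * t e - s e * t c) :: 'a)"
  have ev: "E3.ev [s, t, u] (osc3 D a (wedge3 D [dd D b, dd D c, dd D e])) = a * \<beta> s t u"
    if "s \<in> Der D" "t \<in> Der D" "u \<in> Der D" for a s t u
    using that by (simp only: E3_ev_gen \<beta>_def)
  have "s (\<beta> t u v) - t (\<beta> s u v) + u (\<beta> s t v) - v (\<beta> s t u)
    - \<beta> (bracket s t) u v + \<beta> (bracket s u) t v - \<beta> (bracket s v) t u
    - \<beta> (bracket t u) s v + \<beta> (bracket t v) s u - \<beta> (bracket u v) s t = 0" (is "?k = 0")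
    by (rule koszul_identity[where br=bracket and \<beta>=\<beta> and s=s and t=t and u=u and v=v and b=b and c=c and e=e])
      (simp_all only: Der_mult Der_diff Der_add assms \<beta>_def bracket_def)
  moreover have "cartan3 (\<lambda>ts. E3.ev ts (osc3 D a (wedge3 D [dd D b, dd D c, dd D e]))) s t u v =
    (s a * \<beta> t u v - t a * \<beta> s u v + u a * \<beta> s t v - v a * \<beta> s t u) + a * ?k"
    unfolding cartan3_def by (simp only: ev bracket_Der assms Der_mult, simp only: algebra_simps)
  moreover have "E4.ev [s, t, u, v] (wedge4 D [dd D a, dd D b, dd D c, dd D e]) =
    s a * \<beta> t u v - t a * \<beta> s u v + u a * \<beta> s t v - v a * \<beta> s t u"
    unfolding E4_ev_gen[OF assms] by (simp only: ev assms mult_1_left)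
  ultimately show ?thesis by simp
qed

lemma length_2_conv: "length bs = 2 \<longleftrightarrow> (\<exists>b c. bs = [b, c])"
  by (auto simp: length_Suc_conv eval_nat_numeral)

lemma length_3_conv: "length bs = 3 \<longleftrightarrow> (\<exists>b c e. bs = [b, c, e])"
  by (auto simp: length_Suc_conv eval_nat_numeral)

lemma length_4_conv: "length bs = 4 \<longleftrightarrow> (\<exists>b c e f. bs = [b, c, e, f])"
  by (auto simp: length_Suc_conv eval_nat_numeral)

lemma cartan2_add:
  assumes "s \<in> Der D" "t \<in> Der D" "u \<in> Der D"
  shows "cartan2 (\<lambda>ts. E2.ev ts (\<eta> + \<eta>')) s t u =
    cartan2 (\<lambda>ts. E2.ev ts \<eta>) s t u + cartan2 (\<lambda>ts. E2.ev ts \<eta>') s t u"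
  by (simp add: cartan2_def E2.ev_add assms bracket_Der Der_add)

lemma cartan3_add:
  assumes "s \<in> Der D" "t \<in> Der D" "u \<in> Der D" "v \<in> Der D"
  shows "cartan3 (\<lambda>ts. E3.ev ts (\<eta> + \<eta>')) s t u v =
    cartan3 (\<lambda>ts. E3.ev ts \<eta>) s t u v + cartan3 (\<lambda>ts. E3.ev ts \<eta>') s t u v"
  by (simp add: cartan3_def E3.ev_add assms bracket_Der Der_add)

text \<open>Existence of the differential: the Cartan expression is transported by
  \<open>of_alt\<close>, which is additive. On a generator the expression gives the values of the
  prescribed 3-form, and \<open>of_alt_ev\<close> returns that form. The degree 3 case below is
  parallel.\<close>

lemma
  shows additive_d2: "additive (d2 D)"
    and d2_gen: "length bs = 2 \<Longrightarrow> d2 D (osc2 D a (wedge2 D (map (dd D) bs))) = wedge3 D (map (dd D) (a # bs))"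
proof -
  define \<psi> where "\<psi> \<eta> = E3.of_alt (\<lambda>ts. cartan2 (\<lambda>vs. E2.ev vs \<eta>) (ts ! 0) (ts ! 1) (ts ! 2))" for \<eta>
  have add: "additive \<psi>"
    unfolding additive_def \<psi>_def E3.of_alt_add[symmetric]
    by (intro allI E3.of_alt_cong) (auto simp: length_3_conv cartan2_add)
  have gen: "\<psi> (osc2 D a (wedge2 D (map (dd D) bs))) = wedge3 D (map (dd D) (a # bs))" if bs: "length bs = 2" for a bs
  proof -
    from bs obtain b c where bs: "bs = [b, c]" by (auto simp: length_2_conv)
    have "\<psi> (osc2 D a (wedge2 D (map (dd D) bs))) = E3.of_alt (\<lambda>ts. E3.ev ts (wedge3 D (map (dd D) (a # bs))))"
      unfolding \<psi>_def bs by (intro E3.of_alt_cong) (auto simp: length_3_conv cartan2_gen)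
    then show ?thesis by (simp add: E3.of_alt_ev)
  qed
  have "\<exists>!\<phi>. additive \<phi> \<and> (\<forall>a bs. length bs = 2 \<longrightarrow>
     \<phi> (osc2 D a (wedge2 D (map (dd D) bs))) = wedge3 D (map (dd D) (a # bs)))"
    using add gen by (intro ex1I[of _ \<psi>]) (auto intro!: E2.additive_unique)
  from theI'[OF this] have "additive (d2 D) \<and> (\<forall>a bs. length bs = 2 \<longrightarrow>
     d2 D (osc2 D a (wedge2 D (map (dd D) bs))) = wedge3 D (map (dd D) (a # bs)))"
    unfolding d2_def .
  then show "additive (d2 D)"
    "length bs = 2 \<Longrightarrow> d2 D (osc2 D a (wedge2 D (map (dd D) bs))) = wedge3 D (map (dd D) (a # bs))"
    by auto
qed

lemma
  shows additive_d3: "additive (d3 D)"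
    and d3_gen: "length bs = 3 \<Longrightarrow> d3 D (osc3 D a (wedge3 D (map (dd D) bs))) = wedge4 D (map (dd D) (a # bs))"
proof -
  define \<psi> where "\<psi> \<eta> = E4.of_alt (\<lambda>ts. cartan3 (\<lambda>vs. E3.ev vs \<eta>) (ts ! 0) (ts ! 1) (ts ! 2) (ts ! 3))" for \<eta>
  have add: "additive \<psi>"
    unfolding additive_def \<psi>_def E4.of_alt_add[symmetric]
    by (intro allI E4.of_alt_cong) (auto simp: length_4_conv cartan3_add)
  have gen: "\<psi> (osc3 D a (wedge3 D (map (dd D) bs))) = wedge4 D (map (dd D) (a # bs))" if bs: "length bs = 3" for a bs
  proof -
    from bs obtain b c e where bs: "bs = [b, c, e]" by (auto simp: length_3_conv)
    have "\<psi> (osc3 D a (wedge3 D (map (dd D) bs))) = E4.of_alt (\<lambda>ts. E4.ev ts (wedge4 D (map (dd D) (a # bs))))"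
      unfolding \<psi>_def bs by (intro E4.of_alt_cong) (auto simp: length_4_conv cartan3_gen)
    then show ?thesis by (simp add: E4.of_alt_ev)
  qed
  have "\<exists>!\<phi>. additive \<phi> \<and> (\<forall>a bs. length bs = 3 \<longrightarrow>
     \<phi> (osc3 D a (wedge3 D (map (dd D) bs))) = wedge4 D (map (dd D) (a # bs)))"
    using add gen by (intro ex1I[of _ \<psi>]) (auto intro!: E3.additive_unique)
  from theI'[OF this] have "additive (d3 D) \<and> (\<forall>a bs. length bs = 3 \<longrightarrow>
     d3 D (osc3 D a (wedge3 D (map (dd D) bs))) = wedge4 D (map (dd D) (a # bs)))"
    unfolding d3_def .
  then show "additive (d3 D)"
    "length bs = 3 \<Longrightarrow> d3 D (osc3 D a (wedge3 D (map (dd D) bs))) = wedge4 D (map (dd D) (a # bs))"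
    by auto
qed

lemma ev_d2:
  assumes "s \<in> Der D" "t \<in> Der D" "u \<in> Der D"
  shows "E3.ev [s, t, u] (d2 D \<eta>) = cartan2 (\<lambda>vs. E2.ev vs \<eta>) s t u"
proof (induct \<eta> rule: E2.forms_induct)
  case 0
  show ?case using assms by (simp add: additive.zero[OF additive_d2] E3.ev_0 E2.ev_0 cartan2_def bracket_Der Der_0)
next
  case (add x y)
  then show ?case using assms by (simp add: additive.add[OF additive_d2] E3.ev_add cartan2_add)
next
  case (gen a bs)
  then show ?case using assms d2_gen[OF gen, of a] by (auto simp: length_2_conv cartan2_gen)
qed

lemma ev_d3:
  assumes "s \<in> Der D" "t \<in> Der D" "u \<in> Der D" "v \<in> Der D"
  shows "E4.ev [s, t, u, v] (d3 D \<omega>) = cartan3 (\<lambda>vs. E3.ev vs \<omega>) s t u v"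
proof (induct \<omega> rule: E3.forms_induct)
  case 0
  show ?case using assms by (simp add: additive.zero[OF additive_d3] E4.ev_0 E3.ev_0 cartan3_def bracket_Der Der_0)
next
  case (add x y)
  then show ?case using assms by (simp add: additive.add[OF additive_d3] E4.ev_add cartan3_add)
next
  case (gen a bs)
  then show ?case using assms d3_gen[OF gen, of a] by (auto simp: length_3_conv cartan3_gen)
qed

section \<open>Forms contracted with vector fields\<close>

lemma form2_map_spec:
  assumes s: "s \<in> Der D" and t: "t \<in> Der D"
  shows "pair D t (form2_map D \<eta> s) = E2.ev [s, t] \<eta>"
proof -
  have "\<exists>!w. \<forall>t\<in>Der D. pair D t w = eval2 D \<eta> [s, t]"
    unfolding eval2_eq using E2.ev_contract[of "[s]"] s by simp
  from theI'[OF this] show ?thesis using s t by (simp add: form2_map_def eval2_eq)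
qed

lemma form3_map_spec:
  assumes s: "s \<in> Der D" and t: "t \<in> Der D" and u: "u \<in> Der D"
  shows "pair D u (form3_map D \<omega> s t) = E3.ev [s, t, u] \<omega>"
proof -
  have "\<exists>!w. \<forall>u\<in>Der D. pair D u w = eval3 D \<omega> [s, t, u]"
    unfolding eval3_eq using E3.ev_contract[of "[s, t]"] s t by simp
  from theI'[OF this] show ?thesis using s t u by (simp add: form3_map_def eval3_eq)
qed

lemma
  assumes "s \<in> Der D" "t \<in> Der D"
  shows E2_plus: "s' \<in> Der D \<Longrightarrow> E2.ev [s + s', t] \<eta> = E2.ev [s, t] \<eta> + E2.ev [s', t] \<eta>"
    and E2_tsc: "E2.ev [tsc a s, t] \<eta> = a * E2.ev [s, t] \<eta>"
    and E2_swap: "E2.ev [t, s] \<eta> = - E2.ev [s, t] \<eta>"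
proof -
  interpret T: alternating "tsc :: 'a \<Rightarrow> ('a \<Rightarrow> 'a) \<Rightarrow> _" "(*)" 2 "Der D" "\<lambda>ts. E2.ev ts \<eta>"
    by (intro alternating.intro alternating_axioms.intro TS.module_axioms module_mult subspace_Der E2.alt_on_ev)
  show "s' \<in> Der D \<Longrightarrow> E2.ev [s + s', t] \<eta> = E2.ev [s, t] \<eta> + E2.ev [s', t] \<eta>"
    using alt_onD(1)[OF T.alt, of "[]" s s' "[t]"] assms by simp
  show "E2.ev [tsc a s, t] \<eta> = a * E2.ev [s, t] \<eta>"
    using alt_onD(2)[OF T.alt, of "[]" s "[t]" a] assms by simp
  show "E2.ev [t, s] \<eta> = - E2.ev [s, t] \<eta>"
    using T.L_swap[of "[]" s "[]" t "[]"] assms by simp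
qed

lemma
  assumes "s \<in> Der D" "t \<in> Der D" "u \<in> Der D"
  shows E3_plus: "s' \<in> Der D \<Longrightarrow> E3.ev [s + s', t, u] \<omega> = E3.ev [s, t, u] \<omega> + E3.ev [s', t, u] \<omega>"
    and E3_tsc: "E3.ev [tsc a s, t, u] \<omega> = a * E3.ev [s, t, u] \<omega>"
    and E3_swap12: "E3.ev [t, s, u] \<omega> = - E3.ev [s, t, u] \<omega>"
    and E3_swap23: "E3.ev [s, u, t] \<omega> = - E3.ev [s, t, u] \<omega>"
proof -
  interpret T: alternating "tsc :: 'a \<Rightarrow> ('a \<Rightarrow> 'a) \<Rightarrow> _" "(*)" 3 "Der D" "\<lambda>ts. E3.ev ts \<omega>"
    by (intro alternating.intro alternating_axioms.intro TS.module_axioms module_mult subspace_Der E3.alt_on_ev)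
  show "s' \<in> Der D \<Longrightarrow> E3.ev [s + s', t, u] \<omega> = E3.ev [s, t, u] \<omega> + E3.ev [s', t, u] \<omega>"
    using alt_onD(1)[OF T.alt, of "[]" s s' "[t, u]"] assms by simp
  show "E3.ev [tsc a s, t, u] \<omega> = a * E3.ev [s, t, u] \<omega>"
    using alt_onD(2)[OF T.alt, of "[]" s "[t, u]" a] assms by simp
  show "E3.ev [t, s, u] \<omega> = - E3.ev [s, t, u] \<omega>"
    using T.L_swap[of "[]" s "[]" t "[u]"] assms by simp
  show "E3.ev [s, u, t] \<omega> = - E3.ev [s, t, u] \<omega>"
    using T.L_swap[of "[s]" t "[]" u "[]"] assms by simp
qed

end

section \<open>Forms as maps on vector fields\<close>

context smooth_forms
begin

definition hh :: 'a where "hh = ksc D (1 / 2) 1"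

lemma hh_double: "hh * x + hh * x = x"
proof -
  have "hh * x + hh * x = ksc D (1 / 2 + 1 / 2) x"
    unfolding hh_def ksc_mult[of _ x, symmetric] by (simp only: K.scale_left_distrib)
  then show ?thesis by simp
qed

lemma hh_double': "hh * x + (hh * x + y) = x + y"
  by (simp add: hh_double flip: add.assoc)

text \<open>Scalar identities with halves are proved after doubling, when \<open>hh_double\<close>
  and its reassociated variant \<open>hh_double'\<close> remove every \<open>hh\<close>.\<close>

lemma double_cancel: "x + x = y + y \<Longrightarrow> x = (y :: 'a)"
proof -
  assume "x + x = y + y"
  then have "hh * (x + x) = hh * (y + y)" by simp
  then show "x = y" by (simp only: distrib_left hh_double)
qed

lemma double_0: "x + x = 0 \<Longrightarrow> x = (0 :: 'a)"
  using double_cancel[of x 0] by simp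

lemma eq_minus_self: "x = - x \<Longrightarrow> x = (0 :: 'a)"
  by (rule double_0) (metis add.right_inverse)

lemma Der_hh: "s \<in> Der D \<Longrightarrow> s (hh * x) = hh * s x"
  unfolding hh_def ksc_mult[symmetric] by (rule Der_ksc)

lemma ksc_half: "ksc D (1 / 2) x = hh * x"
  by (simp add: hh_def flip: ksc_mult)

lemma half_osc: "half D w = osc1 D hh w"
  by (simp add: half_def kosc_def hh_def)

lemma pair_half: "s \<in> Der D \<Longrightarrow> pair D s (half D w) = hh * pair D s w"
  by (simp add: half_osc pair_osc)

lemma ktsc_eq: "ktsc D r t = tsc (ksc D r 1) t"
  unfolding ktsc_def tsc_def by (rule ext) (rule ksc_mult)

lemma bracket_tsc: "s \<in> Der D \<Longrightarrow> t \<in> Der D \<Longrightarrow> bracket (tsc a s) t = tsc a (bracket s t) + tsc (- t a) s"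
  by (auto simp: bracket_def tsc_def fun_eq_iff Der_mult algebra_simps)

lemma bracket_plus: "s \<in> Der D \<Longrightarrow> s' \<in> Der D \<Longrightarrow> t \<in> Der D \<Longrightarrow> bracket (s + s') t = bracket s t + bracket s' t"
  by (auto simp: bracket_def fun_eq_iff Der_add algebra_simps)

lemma pair_bracket_swap:
  assumes "s \<in> Der D" "t \<in> Der D"
  shows "pair D (bracket t s) w = - pair D (bracket s t) w"
proof -
  have "bracket t s = tsc (-1) (bracket s t)" by (auto simp: bracket_def tsc_def fun_eq_iff)
  then show ?thesis by (simp only: pair_tsc bracket_Der assms) simp
qed

lemma lie_dd: "s \<in> Der D \<Longrightarrow> lie D s (dd D a) = dd D (s a)"
  by (rule pair_separates) (simp add: pair_lie pair_dd bracket_Der, simp add: bracket_def)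

text \<open>Describes the image of \<open>form2_map\<close>. Linearity in the second argument is
  built in, since the values are 1-forms evaluated by the pairing.\<close>

definition form2_like :: "(('a \<Rightarrow> 'a) \<Rightarrow> 'w1) \<Rightarrow> bool" where
  "form2_like H \<longleftrightarrow> (\<forall>s. s \<notin> Der D \<longrightarrow> H s = 0) \<and>
     (\<forall>s\<in>Der D. \<forall>s'\<in>Der D. H (s + s') = H s + H s') \<and>
     (\<forall>a. \<forall>s\<in>Der D. H (tsc a s) = osc1 D a (H s)) \<and>
     (\<forall>s\<in>Der D. \<forall>t\<in>Der D. pair D t (H s) = - pair D s (H t))"

text \<open>Describes the image of \<open>form3_map\<close>. The two sign rules are the
  transpositions (12) and (23), which generate all permutations of the arguments; linearity in the
  second argument follows by skewness, in the third by the pairing.\<close>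

definition form3_like :: "(('a \<Rightarrow> 'a) \<Rightarrow> ('a \<Rightarrow> 'a) \<Rightarrow> 'w1) \<Rightarrow> bool" where
  "form3_like W \<longleftrightarrow> (\<forall>s t. s \<notin> Der D \<or> t \<notin> Der D \<longrightarrow> W s t = 0) \<and>
     (\<forall>s\<in>Der D. \<forall>s'\<in>Der D. \<forall>t\<in>Der D. W (s + s') t = W s t + W s' t) \<and>
     (\<forall>a. \<forall>s\<in>Der D. \<forall>t\<in>Der D. W (tsc a s) t = osc1 D a (W s t)) \<and>
     (\<forall>s\<in>Der D. \<forall>t\<in>Der D. W s t = - W t s) \<and>
     (\<forall>s\<in>Der D. \<forall>t\<in>Der D. \<forall>u\<in>Der D. pair D u (W s t) = - pair D t (W s u))"

lemma form2_like_form2_map: "form2_like (form2_map D \<eta>)"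
  unfolding form2_like_def
proof (intro conjI ballI allI impI)
  show "form2_map D \<eta> s = 0" if "s \<notin> Der D" for s using that by (simp add: form2_map_def)
  fix s assume s: "s \<in> Der D"
  show "form2_map D \<eta> (s + s') = form2_map D \<eta> s + form2_map D \<eta> s'" if "s' \<in> Der D" for s'
    using s that by (intro pair_separates) (simp only: form2_map_spec pair_add Der_plus E2_plus)
  show "form2_map D \<eta> (tsc a s) = osc1 D a (form2_map D \<eta> s)" for a
    using s by (intro pair_separates) (simp only: form2_map_spec pair_osc Der_tsc E2_tsc)
  show "pair D t (form2_map D \<eta> s) = - pair D s (form2_map D \<eta> t)" if t: "t \<in> Der D" for t
    using E2_swap[OF s t, of \<eta>] by (simp add: form2_map_spec[OF s t] form2_map_spec[OF t s])
qed

lemma form3_like_form3_map: "form3_like (form3_map D \<omega>)"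
  unfolding form3_like_def
proof (intro conjI ballI allI impI)
  show "form3_map D \<omega> s t = 0" if "s \<notin> Der D \<or> t \<notin> Der D" for s t using that by (auto simp: form3_map_def)
  fix s t assume s: "s \<in> Der D" and t: "t \<in> Der D"
  show "form3_map D \<omega> (s + s') t = form3_map D \<omega> s t + form3_map D \<omega> s' t" if "s' \<in> Der D" for s'
    using s t that by (intro pair_separates) (simp only: form3_map_spec pair_add Der_plus E3_plus)
  show "form3_map D \<omega> (tsc a s) t = osc1 D a (form3_map D \<omega> s t)" for a
    using s t by (intro pair_separates) (simp only: form3_map_spec pair_osc Der_tsc E3_tsc)
  show "form3_map D \<omega> s t = - form3_map D \<omega> t s"
    using s t by (intro pair_separates) (simp add: form3_map_spec pair_minus E3_swap12[of s t])
  show "pair D u (form3_map D \<omega> s t) = - pair D t (form3_map D \<omega> s u)" if u: "u \<in> Der D" for u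
    using E3_swap23[OF s t u, of \<omega>] by (simp add: form3_map_spec s t u)
qed

lemma form2_like_ex:
  assumes H: "form2_like H"
  shows "\<exists>\<eta>. form2_map D \<eta> = H"
proof -
  from H have H0: "\<And>s. s \<notin> Der D \<Longrightarrow> H s = 0"
    and H_add: "\<And>s s'. s \<in> Der D \<Longrightarrow> s' \<in> Der D \<Longrightarrow> H (s + s') = H s + H s'"
    and H_tsc: "\<And>a s. s \<in> Der D \<Longrightarrow> H (tsc a s) = osc1 D a (H s)"
    and H_skew: "\<And>s t. s \<in> Der D \<Longrightarrow> t \<in> Der D \<Longrightarrow> pair D t (H s) = - pair D s (H t)"
    unfolding form2_like_def by blast+
  define L where "L ts = pair D (ts ! 1) (H (ts ! 0))" for ts
  have "alt_on 2 (Der D) tsc (*) L"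
    unfolding alt_on_def
  proof (intro conjI allI impI)
    fix xs x y ys assume *: "set (xs @ x # y # ys) \<subseteq> Der D" "length xs + length ys + 1 = 2"
    then consider z where "xs = []" "ys = [z]" | z where "xs = [z]" "ys = []"
      by (cases xs; cases ys) auto
    then show "L (xs @ (x + y) # ys) = L (xs @ x # ys) + L (xs @ y # ys)"
      using * by cases (simp_all only: H_add L_def nth_Cons_0 One_nat_def nth_Cons_Suc append.simps list.set insert_subset pair_add pair_plus_left)
  next
    fix xs a x ys assume *: "set (xs @ x # ys) \<subseteq> Der D" "length xs + length ys + 1 = 2"
    then consider z where "xs = []" "ys = [z]" | z where "xs = [z]" "ys = []"
      by (cases xs; cases ys) auto
    then show "L (xs @ tsc a x # ys) = a * L (xs @ x # ys)"
      using * by cases (simp_all add: L_def H_tsc pair_osc pair_tsc)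
  next
    fix xs assume *: "set xs \<subseteq> Der D" "length xs = 2" "\<not> distinct xs"
    then obtain x where "xs = [x, x]" "x \<in> Der D" by (auto simp: length_2_conv)
    \<comment> \<open>Skewness yields vanishing on repeated arguments because 2 is
      invertible.\<close>
    moreover from this have "pair D x (H x) = 0" by (intro eq_minus_self H_skew)
    ultimately show "L xs = 0" by (simp add: L_def)
  qed
  from E2.ev_of_alt[OF this] have ev: "E2.ev [s, t] (E2.of_alt L) = pair D t (H s)" if "s \<in> Der D" "t \<in> Der D" for s t
    using that by (simp add: L_def)
  have "form2_map D (E2.of_alt L) s = H s" for s
  proof (cases "s \<in> Der D")
    case True
    then show ?thesis by (intro pair_separates) (simp add: form2_map_spec ev)
  qed (simp add: form2_map_def H0)
  then show ?thesis by blast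
qed

lemma form3_like_ex:
  assumes W: "form3_like W"
  shows "\<exists>\<omega>. form3_map D \<omega> = W"
proof -
  from W have W0: "\<And>s t. s \<notin> Der D \<or> t \<notin> Der D \<Longrightarrow> W s t = 0"
    and W_add: "\<And>s s' t. s \<in> Der D \<Longrightarrow> s' \<in> Der D \<Longrightarrow> t \<in> Der D \<Longrightarrow> W (s + s') t = W s t + W s' t"
    and W_tsc: "\<And>a s t. s \<in> Der D \<Longrightarrow> t \<in> Der D \<Longrightarrow> W (tsc a s) t = osc1 D a (W s t)"
    and W_12: "\<And>s t. s \<in> Der D \<Longrightarrow> t \<in> Der D \<Longrightarrow> W s t = - W t s"
    and W_23: "\<And>s t u. s \<in> Der D \<Longrightarrow> t \<in> Der D \<Longrightarrow> u \<in> Der D \<Longrightarrow> pair D u (W s t) = - pair D t (W s u)"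
    unfolding form3_like_def by blast+
  have W_add2: "W t (s + s') = W t s + W t s'" if "s \<in> Der D" "s' \<in> Der D" "t \<in> Der D" for s s' t
    using W_12[OF that(3) Der_plus[OF that(1,2)]] W_12[OF that(3,1)] W_12[OF that(3,2)] W_add[OF that] by simp
  have W_tsc2: "W t (tsc a s) = osc1 D a (W t s)" if "s \<in> Der D" "t \<in> Der D" for a s t
    using W_12[OF that(2) Der_tsc[OF that(1)], of a] W_12[OF that(2,1)] W_tsc[OF that] by simp
  have W_eq12: "W s s = 0" if s: "s \<in> Der D" for s
  proof (rule pair_separates)
    fix u assume u: "u \<in> Der D"
    have "pair D u (W s s) = - pair D u (W s s)"
      using W_12[OF s s] pair_minus[OF u, of "W s s"] by simp
    then have "pair D u (W s s) = 0" by (rule eq_minus_self)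
    then show "pair D u (W s s) = pair D u 0" using u by (simp add: pair_0)
  qed
  have W_eq23: "pair D t (W s t) = 0" if "s \<in> Der D" "t \<in> Der D" for s t
    by (rule eq_minus_self) (rule W_23[OF that that(2)])
  define L where "L ts = pair D (ts ! 2) (W (ts ! 0) (ts ! 1))" for ts
  have "alt_on 3 (Der D) tsc (*) L"
    unfolding alt_on_def
  proof (intro conjI allI impI)
    fix xs x y ys assume *: "set (xs @ x # y # ys) \<subseteq> Der D" "length xs + length ys + 1 = 3"
    then consider v w where "xs = []" "ys = [v, w]" | v w where "xs = [v]" "ys = [w]" | v w where "xs = [v, w]" "ys = []"
      by (cases xs; cases "tl xs"; cases ys; cases "tl ys") auto
    then show "L (xs @ (x + y) # ys) = L (xs @ x # ys) + L (xs @ y # ys)"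
      using * by cases (simp_all only: L_def nth_Cons_0 numeral_2_eq_2 One_nat_def nth_Cons_Suc append.simps list.set insert_subset
          W_add W_add2 pair_add pair_plus_left)
  next
    fix xs a x ys assume *: "set (xs @ x # ys) \<subseteq> Der D" "length xs + length ys + 1 = 3"
    then consider v w where "xs = []" "ys = [v, w]" | v w where "xs = [v]" "ys = [w]" | v w where "xs = [v, w]" "ys = []"
      by (cases xs; cases "tl xs"; cases ys; cases "tl ys") auto
    then show "L (xs @ tsc a x # ys) = a * L (xs @ x # ys)"
      using * by cases (simp_all add: L_def W_tsc W_tsc2 pair_osc pair_tsc)
  next
    fix xs assume *: "set xs \<subseteq> Der D" "length xs = 3" "\<not> distinct xs"
    then obtain s t u where xs: "xs = [s, t, u]" and T: "s \<in> Der D" "t \<in> Der D" "u \<in> Der D"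
      by (auto simp: length_3_conv)
    consider "s = t" | "t = u" | "s = u" using * xs by auto
    then show "L xs = 0"
    proof cases
      case 3
      then show ?thesis using xs T W_12[of s t] by (simp add: L_def W_eq23 pair_minus)
    qed (use xs T in \<open>simp_all add: L_def W_eq12 W_eq23 pair_0\<close>)
  qed
  from E3.ev_of_alt[OF this] have ev: "E3.ev [s, t, u] (E3.of_alt L) = pair D u (W s t)"
    if "s \<in> Der D" "t \<in> Der D" "u \<in> Der D" for s t u
    using that by (simp add: L_def)
  have "form3_map D (E3.of_alt L) s t = W s t" for s t
  proof (cases "s \<in> Der D \<and> t \<in> Der D")
    case True
    then show ?thesis by (intro pair_separates) (simp add: form3_map_spec ev)
  next
    case False
    then show ?thesis using W0[of s t] by (auto simp: form3_map_def)
  qed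
  then show ?thesis by blast
qed

lemma form2_map_inject: "form2_map D \<eta> = form2_map D \<eta>' \<Longrightarrow> \<eta> = \<eta>'"
proof (rule E2.ev_inject)
  fix ts assume eq: "form2_map D \<eta> = form2_map D \<eta>'" and "set ts \<subseteq> Der D \<and> length ts = 2"
  then obtain s t where "ts = [s, t]" "s \<in> Der D" "t \<in> Der D" by (auto simp: length_2_conv)
  then show "E2.ev ts \<eta> = E2.ev ts \<eta>'" using eq by (simp flip: form2_map_spec)
qed

lemma form2_map_add: "form2_map D (\<eta> + \<eta>') t = form2_map D \<eta> t + form2_map D \<eta>' t"
proof (cases "t \<in> Der D")
  case True
  then show ?thesis by (intro pair_separates) (simp add: form2_map_spec pair_add E2.ev_add)
qed (simp add: form2_map_def)

lemma form2_map_0: "form2_map D 0 t = 0"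
  using form2_map_add[of 0 0 t] by simp

lemma form3_map_add: "form3_map D (\<omega> + \<omega>') s t = form3_map D \<omega> s t + form3_map D \<omega>' s t"
proof (cases "s \<in> Der D \<and> t \<in> Der D")
  case True
  then show ?thesis by (intro pair_separates) (simp add: form3_map_spec pair_add E3.ev_add)
qed (auto simp add: form3_map_def)

lemma form3_map_0: "form3_map D 0 s t = 0"
  using form3_map_add[of 0 0 s t] by simp

text \<open>Pairing with \<open>v\<close> turns each of the three Lie derivatives into two terms;
  with the three bracket terms this gives all of the Cartan formula except the derivative along
  \<open>v\<close>, which is subtracted by hand. Brackets with \<open>v\<close> arrive in the last
  slot and move to the first by a cyclic, hence even, permutation.\<close>

lemma pair_d_Lie_form3_map:
  assumes "s \<in> Der D" "t \<in> Der D" "u \<in> Der D" "v \<in> Der D"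
  shows "pair D v (d_Lie D (form3_map D \<omega>) s t u) - v (E3.ev [s, t, u] \<omega>) = cartan3 (\<lambda>ts. E3.ev ts \<omega>) s t u v"
proof -
  have perm: "E3.ev [x, y, z] \<omega> = E3.ev [z, x, y] \<omega>" if "x \<in> Der D" "y \<in> Der D" "z \<in> Der D" for x y z
    using E3_swap23[OF that, of \<omega>] E3_swap12[OF that(1,3,2), of \<omega>] by simp
  have b: "E3.ev [x, y, bracket z v] \<omega> = E3.ev [bracket z v, x, y] \<omega>" if "x \<in> Der D" "y \<in> Der D" "z \<in> Der D" for x y z
    using that assms by (intro perm bracket_Der)
  show ?thesis
    using assms by (simp add: d_Lie_def cartan3_def pair_add pair_diff pair_lie form3_map_spec bracket_Der b)
qed

text \<open>Closedness in the shape in which it meets the last algebroid axiom: the derivative along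
  \<open>v\<close> in the Cartan formula is the pairing of \<open>v\<close> with an exact
  1-form.\<close>

lemma d3_eq_0_iff:
  "d3 D \<omega> = 0 \<longleftrightarrow> (\<forall>s\<in>Der D. \<forall>t\<in>Der D. \<forall>u\<in>Der D.
     d_Lie D (form3_map D \<omega>) s t u = dd D (pair D u (form3_map D \<omega> s t)))"
proof
  assume "d3 D \<omega> = 0"
  then have 0: "cartan3 (\<lambda>ts. E3.ev ts \<omega>) s t u v = 0" if "s \<in> Der D" "t \<in> Der D" "u \<in> Der D" "v \<in> Der D" for s t u v
    using ev_d3[OF that, of \<omega>] that by (simp add: E4.ev_0)
  show "\<forall>s\<in>Der D. \<forall>t\<in>Der D. \<forall>u\<in>Der D. d_Lie D (form3_map D \<omega>) s t u = dd D (pair D u (form3_map D \<omega> s t))"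
  proof (intro ballI pair_separates)
    fix s t u v assume "s \<in> Der D" "t \<in> Der D" "u \<in> Der D" "v \<in> Der D"
    then show "pair D v (d_Lie D (form3_map D \<omega>) s t u) = pair D v (dd D (pair D u (form3_map D \<omega> s t)))"
      using pair_d_Lie_form3_map[of s t u v \<omega>] 0[of s t u v] by (simp add: pair_dd form3_map_spec)
  qed
next
  assume *: "\<forall>s\<in>Der D. \<forall>t\<in>Der D. \<forall>u\<in>Der D. d_Lie D (form3_map D \<omega>) s t u = dd D (pair D u (form3_map D \<omega> s t))"
  show "d3 D \<omega> = 0"
  proof (rule E4.ev_inject)
    fix ts assume ts: "set ts \<subseteq> Der D \<and> length ts = 4"
    then obtain s t u v where v: "ts = [s, t, u, v]" "s \<in> Der D" "t \<in> Der D" "u \<in> Der D" "v \<in> Der D"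
      by (auto simp: length_4_conv)
    have "cartan3 (\<lambda>ts. E3.ev ts \<omega>) s t u v = 0"
      using pair_d_Lie_form3_map[of s t u v \<omega>] * v by (simp add: pair_dd form3_map_spec)
    then show "E4.ev ts (d3 D \<omega>) = E4.ev ts 0"
      using v by (simp add: ev_d3 E4.ev_0)
  qed
qed

text \<open>The part of the compatibility of a morphism with \<open>c\<close> that involves
  \<open>h\<close>. For \<open>h\<close> coming from a 2-form it is the contraction of minus its
  differential.\<close>

definition hom_curv :: "(('a \<Rightarrow> 'a) \<Rightarrow> 'w1) \<Rightarrow> ('a \<Rightarrow> 'a) \<Rightarrow> ('a \<Rightarrow> 'a) \<Rightarrow> 'w1" where
  "hom_curv h s t = half D (dd D (pair D s (h t))) - half D (dd D (pair D t (h s)))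
     - lie D s (h t) + lie D t (h s) + h (bracket s t)"

lemma pair_hom_curv:
  assumes "s \<in> Der D" "t \<in> Der D" "u \<in> Der D"
  shows "pair D u (hom_curv h s t) = hh * u (pair D s (h t)) - hh * u (pair D t (h s))
    - s (pair D u (h t)) + pair D (bracket s u) (h t) + t (pair D u (h s)) - pair D (bracket t u) (h s)
    + pair D u (h (bracket s t))"
  using assms by (simp add: hom_curv_def pair_add pair_diff pair_half pair_dd pair_lie)

text \<open>By skewness the two half-derivatives along \<open>u\<close> add up to a full one, the
  term of the Cartan formula that the Lie derivatives do not provide.\<close>

lemma pair_hom_curv_form2_map:
  assumes "s \<in> Der D" "t \<in> Der D" "u \<in> Der D"
  shows "pair D u (hom_curv (form2_map D \<eta>) s t) = - cartan2 (\<lambda>ts. E2.ev ts \<eta>) s t u"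
proof -
  have "E2.ev [t, s] \<eta> = - E2.ev [s, t] \<eta>" "E2.ev [t, bracket s u] \<eta> = - E2.ev [bracket s u, t] \<eta>"
    "E2.ev [s, bracket t u] \<eta> = - E2.ev [bracket t u, s] \<eta>"
    using assms by (auto intro!: E2_swap bracket_Der)
  then show ?thesis
    using assms hh_double[of "u (E2.ev [s, t] \<eta>)"]
    by (simp add: pair_hom_curv form2_map_spec bracket_Der cartan2_def Der_minus)
qed

text \<open>The minus sign in \<open>pair_hom_curv_form2_map\<close> makes a 2-form an arrow from
  \<open>\<omega>\<close> to \<open>\<omega>'\<close>, in the same direction as the morphism between
  the shifted algebroids.\<close>

lemma d2_eq_iff:
  "d2 D \<eta> = \<omega>' - \<omega> \<longleftrightarrow> (\<forall>s\<in>Der D. \<forall>t\<in>Der D.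
     form3_map D \<omega> s t = form3_map D \<omega>' s t + hom_curv (form2_map D \<eta>) s t)"
proof
  assume d: "d2 D \<eta> = \<omega>' - \<omega>"
  show "\<forall>s\<in>Der D. \<forall>t\<in>Der D. form3_map D \<omega> s t = form3_map D \<omega>' s t + hom_curv (form2_map D \<eta>) s t"
  proof (intro ballI pair_separates)
    fix s t u assume T: "s \<in> Der D" "t \<in> Der D" "u \<in> Der D"
    then show "pair D u (form3_map D \<omega> s t) = pair D u (form3_map D \<omega>' s t + hom_curv (form2_map D \<eta>) s t)"
      using ev_d2[OF T, of \<eta>, symmetric] unfolding d
      by (simp add: pair_add pair_hom_curv_form2_map form3_map_spec E3.ev_diff)
  qed
next
  assume *: "\<forall>s\<in>Der D. \<forall>t\<in>Der D. form3_map D \<omega> s t = form3_map D \<omega>' s t + hom_curv (form2_map D \<eta>) s t"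
  show "d2 D \<eta> = \<omega>' - \<omega>"
  proof (rule E3.ev_inject)
    fix ts assume ts: "set ts \<subseteq> Der D \<and> length ts = 3"
    then obtain s t u where v: "ts = [s, t, u]" "s \<in> Der D" "t \<in> Der D" "u \<in> Der D"
      by (auto simp: length_3_conv)
    have "pair D u (form3_map D \<omega> s t) = pair D u (form3_map D \<omega>' s t + hom_curv (form2_map D \<eta>) s t)"
      using * v by simp
    then show "E3.ev ts (d2 D \<eta>) = E3.ev ts (\<omega>' - \<omega>)"
      using v by (simp add: ev_d2 E3.ev_diff pair_add pair_hom_curv_form2_map form3_map_spec)
  qed
qed

end

section \<open>Vertex algebroids\<close>

context smooth_forms
begin

lemma lie_lie:
  assumes "s \<in> Der D" "t \<in> Der D"
  shows "lie D s (lie D t w) = lie D t (lie D s w) + lie D (bracket s t) w"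
proof (rule pair_separates)
  fix u assume u: "u \<in> Der D"
  have jac: "bracket s (bracket t u) = bracket t (bracket s u) + bracket (bracket s t) u"
    using assms u by (auto simp: bracket_def fun_eq_iff Der_diff)
  have "pair D (bracket s (bracket t u)) w = pair D (bracket t (bracket s u)) w + pair D (bracket (bracket s t) u) w"
    unfolding jac by (intro pair_plus_left bracket_Der assms u)
  then show "pair D u (lie D s (lie D t w)) = pair D u (lie D t (lie D s w) + lie D (bracket s t) w)"
    using assms u by (simp add: pair_lie pair_add bracket_Der Der_diff, simp add: bracket_def)
qed

abbreviation (input) TT where "TT V s t \<equiv> frm V (s, 0) (t, 0)"

text \<open>The conditions of \<open>is_valgd\<close> in which \<open>c\<close> does not occur; they
  are unaffected by a 3-form. The others are collected in \<open>valgd_curv\<close>.\<close>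

definition valgd_base :: "('a \<Rightarrow> ('a \<Rightarrow> 'a) \<Rightarrow> 'w1) \<Rightarrow>
    (('a \<Rightarrow> 'a) \<times> 'w1 \<Rightarrow> ('a \<Rightarrow> 'a) \<times> 'w1 \<Rightarrow> 'a) \<Rightarrow> bool" where
  "valgd_base \<gamma> f \<longleftrightarrow>
     bilinear_map_on UNIV (ksc D) (Der D) (ktsc D) (kosc D) \<gamma> \<and>
     (\<forall>a t. t \<notin> Der D \<longrightarrow> \<gamma> a t = 0) \<and>
     bilinear_map_on (Der D \<times> UNIV) (\<lambda>r (t, w). (ktsc D r t, kosc D r w))
       (Der D \<times> UNIV) (\<lambda>r (t, w). (ktsc D r t, kosc D r w)) (ksc D) f \<and>
     (\<forall>x y. x \<notin> Der D \<times> UNIV \<or> y \<notin> Der D \<times> UNIV \<longrightarrow> f x y = 0) \<and>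
     (\<forall>x y. f x y = f y x) \<and>
     (\<forall>w w'. f (0, w) (0, w') = 0) \<and>
     (\<forall>t\<in>Der D. \<forall>w. f (t, 0) (0, w) = pair D t w) \<and>
     (\<forall>a b. \<forall>t\<in>Der D. \<gamma> a (tsc b t) =
        \<gamma> (a * b) t - osc1 D a (\<gamma> b t) - osc1 D (t a) (dd D b) - osc1 D (t b) (dd D a)) \<and>
     (\<forall>a. \<forall>t1\<in>Der D. \<forall>t2\<in>Der D. f (tsc a t1, 0) (t2, 0) =
        a * f (t1, 0) (t2, 0) + f (t2, 0) (0, \<gamma> a t1) - t1 (t2 a))"

definition valgd_curv :: "('a \<Rightarrow> ('a \<Rightarrow> 'a) \<Rightarrow> 'w1) \<Rightarrow>
    (('a \<Rightarrow> 'a) \<times> 'w1 \<Rightarrow> ('a \<Rightarrow> 'a) \<times> 'w1 \<Rightarrow> 'a) \<Rightarrow> (('a \<Rightarrow> 'a) \<Rightarrow> ('a \<Rightarrow> 'a) \<Rightarrow> 'w1) \<Rightarrow> bool" where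
  "valgd_curv \<gamma> f c \<longleftrightarrow>
     bilinear_map_on (Der D) (ktsc D) (Der D) (ktsc D) (kosc D) c \<and>
     (\<forall>s t. s \<notin> Der D \<or> t \<notin> Der D \<longrightarrow> c s t = 0) \<and>
     (\<forall>s\<in>Der D. \<forall>t\<in>Der D. c s t = - c t s) \<and>
     (\<forall>a. \<forall>t1\<in>Der D. \<forall>t2\<in>Der D. c (tsc a t1) t2 =
        osc1 D a (c t1 t2) + \<gamma> a (bracket t1 t2) - \<gamma> (t2 a) t1 + lie D t2 (\<gamma> a t1)
        - half D (osc1 D (f (t1, 0) (t2, 0)) (dd D a)) + half D (dd D (t1 (t2 a)))
        - half D (dd D (f (t2, 0) (0, \<gamma> a t1)))) \<and>
     (\<forall>t1\<in>Der D. \<forall>t2\<in>Der D. \<forall>t3\<in>Der D. f (bracket t1 t2, 0) (t3, 0) + f (t2, 0) (bracket t1 t3, 0) =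
        t1 (f (t2, 0) (t3, 0)) - ksc D (1 / 2) (t2 (f (t1, 0) (t3, 0))) - ksc D (1 / 2) (t3 (f (t1, 0) (t2, 0)))
        + f (t2, 0) (0, c t1 t3) + f (t3, 0) (0, c t1 t2)) \<and>
     (\<forall>t1\<in>Der D. \<forall>t2\<in>Der D. \<forall>t3\<in>Der D. d_Lie D c t1 t2 t3 =
        - half D (dd D (f (bracket t1 t2, 0) (t3, 0) + f (bracket t1 t3, 0) (t2, 0) - f (bracket t2 t3, 0) (t1, 0)
          - t1 (f (t2, 0) (t3, 0)) + t2 (f (t1, 0) (t3, 0)) - 2 * f (t3, 0) (0, c t1 t2))))"

lemma is_valgd_iff: "is_valgd D V \<longleftrightarrow> valgd_base (gam V) (frm V) \<and> valgd_curv (gam V) (frm V) (cc V)"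
  unfolding is_valgd_def valgd_base_def valgd_curv_def Let_def
  by (rule iffI; elim conjE; intro conjI; assumption)

lemma
  assumes "is_valgd D V"
  shows frm_sym: "frm V x y = frm V y x"
    and frm_pair: "t \<in> Der D \<Longrightarrow> frm V (t, 0) (0, w) = pair D t w"
    and cc_off: "s \<notin> Der D \<or> t \<notin> Der D \<Longrightarrow> cc V s t = 0"
    and cc_skew: "s \<in> Der D \<Longrightarrow> t \<in> Der D \<Longrightarrow> cc V s t = - cc V t s"
    and gam_add: "t \<in> Der D \<Longrightarrow> gam V (a + b) t = gam V a t + gam V b t"
    and gam_ksc: "t \<in> Der D \<Longrightarrow> gam V (ksc D r a) t = kosc D r (gam V a t)"
    and gam_plus: "s \<in> Der D \<Longrightarrow> t \<in> Der D \<Longrightarrow> gam V a (s + t) = gam V a s + gam V a t"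
    and cc_plus: "s \<in> Der D \<Longrightarrow> s' \<in> Der D \<Longrightarrow> t \<in> Der D \<Longrightarrow> cc V (s + s') t = cc V s t + cc V s' t"
    and TT_plus: "s \<in> Der D \<Longrightarrow> s' \<in> Der D \<Longrightarrow> t \<in> Der D \<Longrightarrow> TT V (s + s') t = TT V s t + TT V s' t"
    and valgd_A1: "t \<in> Der D \<Longrightarrow> gam V a (tsc b t) =
        gam V (a * b) t - osc1 D a (gam V b t) - osc1 D (t a) (dd D b) - osc1 D (t b) (dd D a)"
    and valgd_A2: "s \<in> Der D \<Longrightarrow> t \<in> Der D \<Longrightarrow> TT V (tsc a s) t = a * TT V s t + pair D t (gam V a s) - s (t a)"
    and valgd_A3: "s \<in> Der D \<Longrightarrow> t \<in> Der D \<Longrightarrow> cc V (tsc a s) t =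
        osc1 D a (cc V s t) + gam V a (bracket s t) - gam V (t a) s + lie D t (gam V a s)
        - half D (osc1 D (TT V s t) (dd D a)) + half D (dd D (s (t a))) - half D (dd D (pair D t (gam V a s)))"
    and valgd_A4: "s \<in> Der D \<Longrightarrow> t \<in> Der D \<Longrightarrow> u \<in> Der D \<Longrightarrow> TT V (bracket s t) u + TT V t (bracket s u) =
        s (TT V t u) - hh * t (TT V s u) - hh * u (TT V s t) + pair D t (cc V s u) + pair D u (cc V s t)"
    and valgd_A5: "s \<in> Der D \<Longrightarrow> t \<in> Der D \<Longrightarrow> u \<in> Der D \<Longrightarrow> d_Lie D (cc V) s t u =
        - half D (dd D (TT V (bracket s t) u + TT V (bracket s u) t - TT V (bracket t u) s
          - s (TT V t u) + t (TT V s u) - 2 * pair D u (cc V s t)))"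
proof -
  have base: "valgd_base (gam V) (frm V)" and curv: "valgd_curv (gam V) (frm V) (cc V)"
    using assms by (auto simp: is_valgd_iff)
  note b = base[unfolded valgd_base_def] and c = curv[unfolded valgd_curv_def]
  show "frm V x y = frm V y x" using b by (elim conjE) blast
  show fp: "frm V (t, 0) (0, w) = pair D t w" if "t \<in> Der D" for t w using b that by (elim conjE) blast
  show "s \<notin> Der D \<or> t \<notin> Der D \<Longrightarrow> cc V s t = 0" using c by (elim conjE) blast
  show "s \<in> Der D \<Longrightarrow> t \<in> Der D \<Longrightarrow> cc V s t = - cc V t s" using c by (elim conjE) blast
  from b have g: "bilinear_map_on UNIV (ksc D) (Der D) (ktsc D) (kosc D) (gam V)" by (elim conjE)
  show "t \<in> Der D \<Longrightarrow> gam V (a + b) t = gam V a t + gam V b t"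
    "t \<in> Der D \<Longrightarrow> gam V (ksc D r a) t = kosc D r (gam V a t)"
    "s \<in> Der D \<Longrightarrow> t \<in> Der D \<Longrightarrow> gam V a (s + t) = gam V a s + gam V a t"
    using g unfolding bilinear_map_on_def linear_map_on_def by blast+
  from c have cb: "bilinear_map_on (Der D) (ktsc D) (Der D) (ktsc D) (kosc D) (cc V)" by (elim conjE)
  show "s \<in> Der D \<Longrightarrow> s' \<in> Der D \<Longrightarrow> t \<in> Der D \<Longrightarrow> cc V (s + s') t = cc V s t + cc V s' t"
    using cb unfolding bilinear_map_on_def linear_map_on_def by blast
  from b have fb: "bilinear_map_on (Der D \<times> UNIV) (\<lambda>r (t, w). (ktsc D r t, kosc D r w))
       (Der D \<times> UNIV) (\<lambda>r (t, w). (ktsc D r t, kosc D r w)) (ksc D) (frm V)" by (elim conjE)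
  have "frm V ((s, 0) + (s', 0)) (t, 0) = TT V s t + TT V s' t" if "s \<in> Der D" "s' \<in> Der D" "t \<in> Der D"
    using fb that unfolding bilinear_map_on_def linear_map_on_def by (simp only: mem_Sigma_iff UNIV_I simp_thms)
  then show "s \<in> Der D \<Longrightarrow> s' \<in> Der D \<Longrightarrow> t \<in> Der D \<Longrightarrow> TT V (s + s') t = TT V s t + TT V s' t"
    by (simp only: add_Pair add_0_left)
  show "t \<in> Der D \<Longrightarrow> gam V a (tsc b t) =
      gam V (a * b) t - osc1 D a (gam V b t) - osc1 D (t a) (dd D b) - osc1 D (t b) (dd D a)"
    using b by (elim conjE) blast
  have "s \<in> Der D \<Longrightarrow> t \<in> Der D \<Longrightarrow> TT V (tsc a s) t = a * TT V s t + frm V (t, 0) (0, gam V a s) - s (t a)"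
    using b by (elim conjE) blast
  then show "s \<in> Der D \<Longrightarrow> t \<in> Der D \<Longrightarrow> TT V (tsc a s) t = a * TT V s t + pair D t (gam V a s) - s (t a)"
    by (simp only: fp)
  have "s \<in> Der D \<Longrightarrow> t \<in> Der D \<Longrightarrow> cc V (tsc a s) t =
        osc1 D a (cc V s t) + gam V a (bracket s t) - gam V (t a) s + lie D t (gam V a s)
        - half D (osc1 D (TT V s t) (dd D a)) + half D (dd D (s (t a))) - half D (dd D (frm V (t, 0) (0, gam V a s)))"
    using c by (elim conjE) blast
  then show "s \<in> Der D \<Longrightarrow> t \<in> Der D \<Longrightarrow> cc V (tsc a s) t =
        osc1 D a (cc V s t) + gam V a (bracket s t) - gam V (t a) s + lie D t (gam V a s)
        - half D (osc1 D (TT V s t) (dd D a)) + half D (dd D (s (t a))) - half D (dd D (pair D t (gam V a s)))"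
    by (simp only: fp)
  have "s \<in> Der D \<Longrightarrow> t \<in> Der D \<Longrightarrow> u \<in> Der D \<Longrightarrow> TT V (bracket s t) u + TT V t (bracket s u) =
        s (TT V t u) - ksc D (1 / 2) (t (TT V s u)) - ksc D (1 / 2) (u (TT V s t))
        + frm V (t, 0) (0, cc V s u) + frm V (u, 0) (0, cc V s t)"
    using c by (elim conjE) blast
  then show "s \<in> Der D \<Longrightarrow> t \<in> Der D \<Longrightarrow> u \<in> Der D \<Longrightarrow> TT V (bracket s t) u + TT V t (bracket s u) =
        s (TT V t u) - hh * t (TT V s u) - hh * u (TT V s t) + pair D t (cc V s u) + pair D u (cc V s t)"
    by (simp only: fp ksc_half)
  have "s \<in> Der D \<Longrightarrow> t \<in> Der D \<Longrightarrow> u \<in> Der D \<Longrightarrow> d_Lie D (cc V) s t u =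
        - half D (dd D (TT V (bracket s t) u + TT V (bracket s u) t - TT V (bracket t u) s
          - s (TT V t u) + t (TT V s u) - 2 * frm V (u, 0) (0, cc V s t)))"
    using c by (elim conjE) blast
  then show "s \<in> Der D \<Longrightarrow> t \<in> Der D \<Longrightarrow> u \<in> Der D \<Longrightarrow> d_Lie D (cc V) s t u =
        - half D (dd D (TT V (bracket s t) u + TT V (bracket s u) t - TT V (bracket t u) s
          - s (TT V t u) + t (TT V s u) - 2 * pair D u (cc V s t)))"
    by (simp only: fp)
qed

lemma gam_minus:
  assumes "is_valgd D V" "t \<in> Der D"
  shows "gam V (- a) t = - gam V a t"
proof -
  have "gam V 0 t = 0" using gam_add[OF assms, of 0 0] by simp
  then show ?thesis using gam_add[OF assms, of a "- a"] by (simp add: eq_neg_iff_add_eq_0 add.commute)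
qed

lemma half_dd: "half D (dd D x) = dd D (hh * x)"
  unfolding half_osc hh_def by (simp only: dd_ksc ksc_mult[of _ x, symmetric])

lemma hh_2: "hh * (2 * x) = x"
  by (simp only: mult_2 distrib_left hh_double)

lemma kosc_eq: "kosc D r w = osc1 D (ksc D r 1) w"
  by (simp add: kosc_def)

text \<open>The rule for \<open>c\<close> at a multiple of a vector field changes by an A-linear
  term; in the invariance rule for the pairing the two new terms cancel by skewness in the last two
  arguments; the rule for \<open>d_Lie\<close> is where closedness is used.\<close>

lemma valgd_shift:
  assumes V: "is_valgd D V" and W: "form3_like W"
    and closed: "\<forall>s\<in>Der D. \<forall>t\<in>Der D. \<forall>u\<in>Der D. d_Lie D W s t u = dd D (pair D u (W s t))"
  shows "is_valgd D (V\<lparr>cc := \<lambda>s t. cc V s t + W s t\<rparr>)"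
proof -
  from W have W0: "\<And>s t. s \<notin> Der D \<or> t \<notin> Der D \<Longrightarrow> W s t = 0"
    and W_add: "\<And>s s' t. s \<in> Der D \<Longrightarrow> s' \<in> Der D \<Longrightarrow> t \<in> Der D \<Longrightarrow> W (s + s') t = W s t + W s' t"
    and W_tsc: "\<And>a s t. s \<in> Der D \<Longrightarrow> t \<in> Der D \<Longrightarrow> W (tsc a s) t = osc1 D a (W s t)"
    and W_12: "\<And>s t. s \<in> Der D \<Longrightarrow> t \<in> Der D \<Longrightarrow> W s t = - W t s"
    and W_23: "\<And>s t u. s \<in> Der D \<Longrightarrow> t \<in> Der D \<Longrightarrow> u \<in> Der D \<Longrightarrow> pair D u (W s t) = - pair D t (W s u)"
    unfolding form3_like_def by blast+
  have W_add2: "W t (s + s') = W t s + W t s'" if "s \<in> Der D" "s' \<in> Der D" "t \<in> Der D" for s s' t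
    using W_12[OF that(3) Der_plus[OF that(1,2)]] W_12[OF that(3,1)] W_12[OF that(3,2)] W_add[OF that] by simp
  have W_tsc2: "W t (tsc a s) = osc1 D a (W t s)" if "s \<in> Der D" "t \<in> Der D" for a s t
    using W_12[OF that(2) Der_tsc[OF that(1)], of a] W_12[OF that(2,1)] W_tsc[OF that] by simp
  let ?c = "\<lambda>s t. cc V s t + W s t"
  have base: "valgd_base (gam V) (frm V)" and curv: "valgd_curv (gam V) (frm V) (cc V)"
    using V by (auto simp: is_valgd_iff)
  have half_split: "half D (dd D (x - 2 * (p + w))) = half D (dd D (x - 2 * p)) - half D (dd D (2 * w))" for x p w
    by (simp add: half_osc dd_diff dd_add distrib_left O1.scale_right_diff_distrib O1.scale_right_distrib)
  note c = curv[unfolded valgd_curv_def] and fp = frm_pair[OF V]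
  have "valgd_curv (gam V) (frm V) ?c"
    unfolding valgd_curv_def
  proof (intro conjI ballI allI impI)
    from c have "bilinear_map_on (Der D) (ktsc D) (Der D) (ktsc D) (kosc D) (cc V)" by (elim conjE)
    then show "bilinear_map_on (Der D) (ktsc D) (Der D) (ktsc D) (kosc D) ?c"
      unfolding bilinear_map_on_def linear_map_on_def ktsc_eq kosc_eq
      by (simp add: W_add W_add2 W_tsc W_tsc2 O1.scale_right_distrib del: plus_fun_def)
    fix s t assume "s \<notin> Der D \<or> t \<notin> Der D"
    then show "?c s t = 0" using W0[of s t] cc_off[OF V, of s t] by simp
  next
    fix s t assume T: "s \<in> Der D" "t \<in> Der D"
    show "?c s t = - ?c t s" using W_12[OF T] cc_skew[OF V T] by simp
    show "?c (tsc a s) t = osc1 D a (?c s t) + gam V a (bracket s t) - gam V (t a) s + lie D t (gam V a s)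
        - half D (osc1 D (TT V s t) (dd D a)) + half D (dd D (s (t a)))
        - half D (dd D (frm V (t, 0) (0, gam V a s)))" for a
      unfolding fp[OF T(2)] valgd_A3[OF V T] W_tsc[OF T] O1.scale_right_distrib by (simp only: ac_simps add_diff_eq diff_add_eq)
    fix u assume u: "u \<in> Der D"
    show "TT V (bracket s t) u + TT V t (bracket s u) =
        s (TT V t u) - ksc D (1 / 2) (t (TT V s u)) - ksc D (1 / 2) (u (TT V s t))
        + frm V (t, 0) (0, ?c s u) + frm V (u, 0) (0, ?c s t)"
      unfolding valgd_A4[OF V T u] fp[OF T(2)] fp[OF u] ksc_half pair_add[OF T(2)] pair_add[OF u] W_23[OF T u] by simp
    have "d_Lie D ?c s t u = d_Lie D (cc V) s t u + d_Lie D W s t u"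
      unfolding d_Lie_def lie_add[OF T(1)] lie_add[OF T(2)] lie_add[OF u] by simp
    \<comment> \<open>The factor 2 in front of the last term of the axiom cancels against the half
      in front of the differential.\<close>
    also have "d_Lie D W s t u = half D (dd D (2 * pair D u (W s t)))"
      unfolding half_dd hh_2 using closed T u by blast
    finally show "d_Lie D ?c s t u =
        - half D (dd D (TT V (bracket s t) u + TT V (bracket s u) t - TT V (bracket t u) s
          - s (TT V t u) + t (TT V s u) - 2 * frm V (u, 0) (0, ?c s t)))"
      unfolding valgd_A5[OF V T u] fp[OF u] pair_add[OF u] half_split by simp
  qed
  then show ?thesis using base by (simp add: is_valgd_iff)
qed

section \<open>Existence of morphisms up to a closed 3-form\<close>

lemma is_valgd_hom_iff: "is_valgd_hom D V V' h \<longleftrightarrow>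
    linear_map_on (Der D) (ktsc D) (kosc D) h \<and> (\<forall>t. t \<notin> Der D \<longrightarrow> h t = 0) \<and>
    (\<forall>a. \<forall>t\<in>Der D. h (tsc a t) = osc1 D a (h t) - gam V' a t + gam V a t) \<and>
    (\<forall>s\<in>Der D. \<forall>t\<in>Der D. TT V s t = TT V' s t + pair D s (h t) + pair D t (h s)) \<and>
    (\<forall>s\<in>Der D. \<forall>t\<in>Der D. cc V s t = cc V' s t + hom_curv h s t)"
  unfolding is_valgd_hom_def Let_def hom_curv_def by (simp only: add_diff_eq add.assoc diff_add_eq)

text \<open>A map \<open>h\<close> satisfying the conditions on morphisms that do not involve \<open>c\<close> transports \<open>V\<close> to an
  algebroid that differs from \<open>V'\<close> only in the component \<open>c\<close>, by a closed 3-form.\<close>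

lemma hom_defect:
  assumes V: "is_valgd D V" and V': "is_valgd D V'"
    and lin: "linear_map_on (Der D) (ktsc D) (kosc D) h" and off: "\<And>t. t \<notin> Der D \<Longrightarrow> h t = 0"
    and g: "\<And>a t. t \<in> Der D \<Longrightarrow> h (tsc a t) = osc1 D a (h t) - gam V' a t + gam V a t"
    and TT: "\<And>s t. s \<in> Der D \<Longrightarrow> t \<in> Der D \<Longrightarrow> TT V s t = TT V' s t + pair D s (h t) + pair D t (h s)"
  obtains \<omega> where "d3 D \<omega> = 0" "is_valgd_hom D (V\<lparr>cc := \<lambda>s t. cc V s t + form3_map D \<omega> s t\<rparr>) V' h"
proof -
  \<comment> \<open>The choice is forced: a morphism from the shifted algebroid requires
    \<open>cc V + W = cc V' + hom_curv h\<close>.\<close>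
  define W where "W s t = (if s \<in> Der D \<and> t \<in> Der D then cc V' s t - cc V s t + hom_curv h s t else 0)" for s t
  have W: "W s t = cc V' s t - cc V s t + hom_curv h s t" if "s \<in> Der D" "t \<in> Der D" for s t
    using that by (simp add: W_def)
  have h_add: "h (s + t) = h s + h t" if "s \<in> Der D" "t \<in> Der D" for s t
    using lin that by (simp add: linear_map_on_def del: plus_fun_def)
  have h_swap: "h (bracket s t) = - h (bracket t s)" if "s \<in> Der D" "t \<in> Der D" for s t
  proof -
    have "bracket s t + bracket t s = 0" by (auto simp: bracket_def fun_eq_iff)
    moreover have "h 0 = 0" using h_add[OF Der_zero Der_zero] by simp
    ultimately have "h (bracket s t) + h (bracket t s) = 0"
      using h_add[OF bracket_Der[OF that] bracket_Der[OF that(2,1)]] by metis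
    then show ?thesis by (simp add: eq_neg_iff_add_eq_0)
  qed
  note pairs = pair_add pair_diff pair_minus pair_osc pair_dd pair_half pair_lie
  have like: "form3_like W"
    unfolding form3_like_def
  proof (intro conjI ballI allI impI)
    show "W s t = 0" if "s \<notin> Der D \<or> t \<notin> Der D" for s t using that by (auto simp: W_def)
    fix s t assume s: "s \<in> Der D" and t: "t \<in> Der D"
    show "W (s + s') t = W s t + W s' t" if s': "s' \<in> Der D" for s'
    proof (rule pair_separates)
      fix u assume u: "u \<in> Der D"
      show "pair D u (W (s + s') t) = pair D u (W s t + W s' t)"
        unfolding W[OF Der_plus[OF s s'] t] W[OF s t] W[OF s' t] cc_plus[OF V s s' t] cc_plus[OF V' s s' t]
        using s s' t u
        by (simp only: pairs pair_hom_curv Der_plus h_add bracket_plus bracket_Der pair_plus_left Der_add)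
          (simp add: plus_fun_def algebra_simps)
    qed
    show "W (tsc a s) t = osc1 D a (W s t)" for a
    proof (rule pair_separates)
      fix u assume u: "u \<in> Der D"
      note T = s t u
      \<comment> \<open>Since [a s, t] = a [s, t] - t(a) s, the rule for \<open>h\<close> on
        multiples yields exactly the values of \<open>gam\<close> that occur in
        \<open>valgd_A3\<close>.\<close>
      have h1: "h (bracket (tsc a s) t) =
          osc1 D a (h (bracket s t)) - gam V' a (bracket s t) + gam V a (bracket s t)
          - osc1 D (t a) (h s) + gam V' (t a) s - gam V (t a) s"
        using T by (simp only: bracket_tsc h_add Der_tsc bracket_Der g gam_minus[OF V] gam_minus[OF V'] O1.scale_minus_left) simp
      have c: "pair D u (cc V (tsc a s) t) = a * pair D u (cc V s t) + pair D u (gam V a (bracket s t))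
          - pair D u (gam V (t a) s) + (t (pair D u (gam V a s)) - pair D (bracket t u) (gam V a s))
          - hh * (TT V s t * u a) + hh * u (s (t a)) - hh * u (pair D t (gam V a s))"
        unfolding valgd_A3[OF V s t] using T by (simp only: pairs)
      have c': "pair D u (cc V' (tsc a s) t) = a * pair D u (cc V' s t) + pair D u (gam V' a (bracket s t))
          - pair D u (gam V' (t a) s) + (t (pair D u (gam V' a s)) - pair D (bracket t u) (gam V' a s))
          - hh * (TT V' s t * u a) + hh * u (s (t a)) - hh * u (pair D t (gam V' a s))"
        unfolding valgd_A3[OF V' s t] using T by (simp only: pairs)
      have k: "pair D u (hom_curv h (tsc a s) t) = hh * u (a * pair D s (h t))
          - hh * u (a * pair D t (h s) - pair D t (gam V' a s) + pair D t (gam V a s))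
          - a * s (pair D u (h t)) + (a * pair D (bracket s u) (h t) - u a * pair D s (h t))
          + t (a * pair D u (h s) - pair D u (gam V' a s) + pair D u (gam V a s))
          - (a * pair D (bracket t u) (h s) - pair D (bracket t u) (gam V' a s) + pair D (bracket t u) (gam V a s))
          + (a * pair D u (h (bracket s t)) - pair D u (gam V' a (bracket s t)) + pair D u (gam V a (bracket s t))
          - t a * pair D u (h s) + pair D u (gam V' (t a) s) - pair D u (gam V (t a) s))"
      proof -
        have "pair D (bracket (tsc a s) u) (h t) = a * pair D (bracket s u) (h t) - u a * pair D s (h t)"
          using T by (simp only: bracket_tsc pair_plus_left Der_tsc bracket_Der pair_tsc) simp
        moreover have "tsc a s x = a * s x" for x by (simp add: tsc_def)
        ultimately show ?thesis
          using T by (simp only: pair_hom_curv Der_tsc h1 g pairs pair_tsc bracket_Der)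
      qed
      \<comment> \<open>The values of \<open>gam V\<close> and \<open>gam V'\<close> cancel in
        pairs. The terms with \<open>u a\<close> cancel because the difference of the two pairings,
        which \<open>valgd_A3\<close> multiplies by one half, is given by \<open>TT\<close> in terms
        of \<open>h\<close>.\<close>
      show "pair D u (W (tsc a s) t) = pair D u (osc1 D a (W s t))"
        unfolding W[OF Der_tsc[OF s] t] W[OF s t] pair_osc[OF u] pair_add[OF u] pair_diff[OF u] c c' k TT[OF s t]
          pair_hom_curv[OF s t u]
        by (rule double_cancel)
          (simp add: Der_mult[OF u] Der_mult[OF t] Der_add[OF u] Der_add[OF t] Der_diff[OF u] Der_diff[OF t]
            algebra_simps hh_double hh_double')
    qed
    show "W s t = - W t s"
      unfolding W[OF s t] W[OF t s] hom_curv_def cc_skew[OF V s t] cc_skew[OF V' s t] h_swap[OF s t] by simp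
    show "pair D u (W s t) = - pair D t (W s u)" if u: "u \<in> Der D" for u
    proof -
      \<comment> \<open>\<open>valgd_A4\<close> expresses the part of \<open>c\<close> symmetric in
        its last two arguments through the pairing, and \<open>TT\<close> compares the two pairings;
        so the symmetric part of \<open>W\<close> becomes an expression in \<open>h\<close> alone,
        which vanishes.\<close>
      have c: "pair D u (cc V s t) = TT V (bracket s t) u + TT V t (bracket s u) - s (TT V t u)
          + hh * t (TT V s u) + hh * u (TT V s t) - pair D t (cc V s u)"
        using valgd_A4[OF V s t u] by (simp add: algebra_simps)
      have c': "pair D u (cc V' s t) = TT V' (bracket s t) u + TT V' t (bracket s u) - s (TT V' t u)
          + hh * t (TT V' s u) + hh * u (TT V' s t) - pair D t (cc V' s u)"
        using valgd_A4[OF V' s t u] by (simp add: algebra_simps)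
      show ?thesis
        unfolding W[OF s t] W[OF s u] pair_add[OF u] pair_add[OF t] pair_diff[OF u] pair_diff[OF t] c c'
          TT[OF bracket_Der[OF s t] u] TT[OF t bracket_Der[OF s u]] TT[OF t u] TT[OF s t] TT[OF s u]
          pair_hom_curv[OF s t u] pair_hom_curv[OF s u t] pair_bracket_swap[OF t u]
        by (rule double_cancel)
          (simp add: Der_add[OF u] Der_add[OF t] Der_add[OF s] algebra_simps hh_double hh_double')
    qed
  qed
  have closed: "d_Lie D W s t u = dd D (pair D u (W s t))" if s: "s \<in> Der D" and t: "t \<in> Der D" and u: "u \<in> Der D" for s t u
  proof -
    note T = s t u and B = bracket_Der[OF s t] bracket_Der[OF s u] bracket_Der[OF t u]
    \<comment> \<open>\<open>hom_curv h\<close> is the differential of the function-valued cochain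
      \<open>K\<close> minus the Chevalley-Eilenberg coboundary of \<open>h\<close>.\<close>
    define K where "K s t = hh * pair D s (h t) - hh * pair D t (h s)" for s t
    \<comment> \<open>The Chevalley-Eilenberg coboundary of \<open>K\<close>. It commutes with
      \<open>dd D\<close> and squares to zero on \<open>h\<close>, whence
      \<open>d_Lie D (hom_curv h)\<close> is \<open>dd D \<kappa>\<close>; the squaring to zero is
      \<open>lie_lie\<close> and the Jacobi identity.\<close>
    define \<kappa> where "\<kappa> = s (K t u) - t (K s u) + u (K s t) - K (bracket s t) u + K (bracket s u) t - K (bracket t u) s"
    have curv: "hom_curv h s t = dd D (K s t) - lie D s (h t) + lie D t (h s) + h (bracket s t)" for s t
      by (simp add: hom_curv_def K_def half_dd dd_diff)
    have "bracket (bracket s u) t = bracket (bracket s t) u + bracket (bracket t u) s"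
      using T by (auto simp: bracket_def fun_eq_iff Der_diff)
    then have jac: "h (bracket (bracket s u) t) = h (bracket (bracket s t) u) + h (bracket (bracket t u) s)"
      using h_add[OF bracket_Der[OF B(1) u] bracket_Der[OF B(3) s]] by metis
    have curv_closed: "d_Lie D (hom_curv h) s t u = dd D \<kappa>"
      unfolding d_Lie_def curv \<kappa>_def jac
      by (simp only: lie_add lie_diff lie_dd T B dd_add dd_diff lie_lie[OF s t] lie_lie[OF s u] lie_lie[OF t u]) simp
    define X where "X V = TT V (bracket s t) u + TT V (bracket s u) t - TT V (bracket t u) s
          - s (TT V t u) + t (TT V s u) - 2 * pair D u (cc V s t)" for V :: "('a, 'w1) valgd"
    have "d_Lie D W s t u = d_Lie D (cc V') s t u - d_Lie D (cc V) s t u + d_Lie D (hom_curv h) s t u"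
      unfolding d_Lie_def W[OF s t] W[OF s u] W[OF t u] W[OF B(1) u] W[OF B(2) t] W[OF B(3) s]
      by (simp only: lie_add lie_diff T) simp
    also have "\<dots> = dd D (hh * X V - hh * X V' + \<kappa>)"
      unfolding valgd_A5[OF V T] valgd_A5[OF V' T] curv_closed X_def[symmetric] half_dd dd_add dd_diff by simp
    \<comment> \<open>What remains is scalar: \<open>valgd_A5\<close> has made
      \<open>d_Lie D W\<close> exact, and the primitive found is the value of \<open>W\<close> on
      the three vector fields once \<open>TT\<close> eliminates one of the two pairings.\<close>
    also have "hh * X V - hh * X V' + \<kappa> = pair D u (W s t)"
      unfolding W[OF s t] pair_add[OF u] pair_diff[OF u] pair_hom_curv[OF T] X_def \<kappa>_def K_def
        TT[OF B(1) u] TT[OF B(2) t] TT[OF B(3) s] TT[OF t u] TT[OF s u] right_diff_distrib distrib_left hh_2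
      by (rule double_cancel)
        (simp add: Der_add[OF u] Der_add[OF t] Der_add[OF s] Der_diff[OF u] Der_diff[OF t] Der_diff[OF s]
          Der_hh[OF u] Der_hh[OF t] Der_hh[OF s] algebra_simps hh_double hh_double')
    finally show ?thesis .
  qed
  obtain \<omega> where \<omega>: "form3_map D \<omega> = W" using form3_like_ex[OF like] by blast
  show thesis
  proof (rule that)
    show "d3 D \<omega> = 0" unfolding d3_eq_0_iff \<omega> using closed by blast
    show "is_valgd_hom D (V\<lparr>cc := \<lambda>s t. cc V s t + form3_map D \<omega> s t\<rparr>) V' h"
      unfolding is_valgd_hom_iff \<omega> using lin off g TT by (auto simp: W)
  qed
qed

text \<open>Every A-linear functional on vector fields is represented by a 1-form; this will turn a
  bilinear form on T into a map from T to 1-forms.\<close>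

lemma pair_expand_linear:
  assumes add: "\<And>s t. s \<in> Der D \<Longrightarrow> t \<in> Der D \<Longrightarrow> L (s + t) = L s + L t"
    and scale: "\<And>a t. t \<in> Der D \<Longrightarrow> L (tsc a t) = a * L t"
    and t: "t \<in> Der D"
  shows "pair D t (\<Sum>i<n. osc1 D (L (tb i)) (dd D (yb i))) = L t"
proof -
  have L0: "L 0 = 0" using add[OF Der_zero Der_zero] by simp
  \<comment> \<open>Additivity of \<open>L\<close> is known only on derivations, so each partial sum
    has to be recognised as a derivation.\<close>
  have *: "L (\<Sum>i<m. tsc (t (yb i)) (tb i)) = (\<Sum>i<m. t (yb i) * L (tb i))" if "m \<le> n" for m
    using that
  proof (induct m)
    case (Suc m)
    then have "(\<Sum>i<m. tsc (t (yb i)) (tb i)) \<in> Der D"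
      by (intro TS.subspace_sum[OF subspace_Der] Der_tsc tb) auto
    then show ?case using Suc by (simp only: sum.lessThan_Suc add Der_tsc scale tb Suc_le_lessD Suc_leD)
  qed (simp add: L0)
  have "pair D t (\<Sum>i<n. osc1 D (L (tb i)) (dd D (yb i))) = (\<Sum>i<n. t (yb i) * L (tb i))"
    by (simp add: pair_sum[OF t] pair_osc[OF t] pair_dd[OF t] mult.commute)
  also have "\<dots> = L (\<Sum>i<n. tsc (t (yb i)) (tb i))" by (simp add: *)
  also have "\<dots> = L t" by (simp flip: Der_expand[OF t])
  finally show ?thesis .
qed

text \<open>Since \<open>T\<close> is projective, the cocycle \<open>\<gamma>' - \<gamma>\<close> is the coboundary of some \<open>h\<^sub>1: T \<rightarrow> \<Omega>\<close>.  The symmetric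
  defect \<open>B\<close> of \<open>h\<^sub>1\<close> on the pairings is then \<open>A\<close>-bilinear and is absorbed by adding \<open>B/2\<close>.\<close>

lemma ex_hom_up_to_form:
  assumes V: "is_valgd D V" and V': "is_valgd D V'"
  obtains h \<omega> where "d3 D \<omega> = 0" "is_valgd_hom D (V\<lparr>cc := \<lambda>s t. cc V s t + form3_map D \<omega> s t\<rparr>) V' h"
proof -
  define \<delta> where "\<delta> a t = gam V' a t - gam V a t" for a t
  \<comment> \<open>The terms of \<open>valgd_A1\<close> that contain \<open>dd D\<close> are the
    same for both algebroids, so the difference satisfies the plain cocycle identity.\<close>
  have \<delta>_mult: "\<delta> (a * b) t = \<delta> a (tsc b t) + osc1 D a (\<delta> b t)" if "t \<in> Der D" for a b t
    unfolding \<delta>_def valgd_A1[OF V that] valgd_A1[OF V' that] by (simp add: O1.scale_right_diff_distrib)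
  have \<delta>_add: "\<delta> (a + b) t = \<delta> a t + \<delta> b t" if "t \<in> Der D" for a b t
    unfolding \<delta>_def gam_add[OF V that] gam_add[OF V' that] by simp
  have \<delta>_ksc: "\<delta> (ksc D r a) t = kosc D r (\<delta> a t)" if "t \<in> Der D" for r a t
    unfolding \<delta>_def gam_ksc[OF V that] gam_ksc[OF V' that] kosc_def by (simp add: O1.scale_right_diff_distrib)
  have \<delta>_plus: "\<delta> a (s + t) = \<delta> a s + \<delta> a t" if "s \<in> Der D" "t \<in> Der D" for a s t
    unfolding \<delta>_def gam_plus[OF V that] gam_plus[OF V' that] by simp
  have \<delta>_expand: "\<delta> a t = (\<Sum>i<n. \<delta> a (tsc (t (yb i)) (tb i)))" if t: "t \<in> Der D" for a t
  proof -
    have \<delta>0: "\<delta> a 0 = 0" using \<delta>_plus[OF Der_zero Der_zero, of a] by simp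
    have "\<delta> a (\<Sum>i<m. tsc (t (yb i)) (tb i)) = (\<Sum>i<m. \<delta> a (tsc (t (yb i)) (tb i)))" if "m \<le> n" for m
      using that
    proof (induct m)
      case (Suc m)
      then have "(\<Sum>i<m. tsc (t (yb i)) (tb i)) \<in> Der D"
        by (intro TS.subspace_sum[OF subspace_Der] Der_tsc tb) auto
      then show ?case using Suc by (simp only: sum.lessThan_Suc \<delta>_plus Der_tsc tb Suc_le_lessD Suc_leD)
    qed (simp add: \<delta>0)
    from this[OF order_refl] show ?thesis by (simp flip: Der_expand[OF t])
  qed
  \<comment> \<open>Obtained by prescribing the value 0 on each \<open>tb i\<close> and extending
    along \<open>Der_expand\<close> by the desired rule for multiples, whose defect is
    \<open>\<delta>\<close>.\<close>
  define h1 where "h1 t = (if t \<in> Der D then - (\<Sum>i<n. \<delta> (t (yb i)) (tb i)) else 0)" for t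
  have h1_add: "h1 (s + t) = h1 s + h1 t" if "s \<in> Der D" "t \<in> Der D" for s t
    using that Der_plus[OF that] by (simp add: h1_def \<delta>_add tb sum.distrib)
  have h1_ktsc: "h1 (ktsc D r t) = kosc D r (h1 t)" if "t \<in> Der D" for r t
  proof -
    have "ktsc D r t \<in> Der D" using that by (simp add: ktsc_eq Der_tsc)
    then show ?thesis using that
      by (simp add: h1_def) (simp add: ktsc_def \<delta>_ksc tb kosc_def O1.scale_sum_right)
  qed
  have h1_tsc: "h1 (tsc a t) = osc1 D a (h1 t) - \<delta> a t" if t: "t \<in> Der D" for a t
  proof -
    have "h1 (tsc a t) = - (\<Sum>i<n. \<delta> (a * t (yb i)) (tb i))"
      using t by (simp add: h1_def Der_tsc) (simp add: tsc_def)
    \<comment> \<open>The cocycle identity is applied to \<open>a\<close> and each coordinate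
      \<open>t (yb i)\<close>; the first sum then reassembles to
      \<open>\<delta> a t\<close>.\<close>
    also have "\<dots> = - (\<Sum>i<n. \<delta> a (tsc (t (yb i)) (tb i))) - osc1 D a (\<Sum>i<n. \<delta> (t (yb i)) (tb i))"
      by (simp add: \<delta>_mult tb sum.distrib O1.scale_sum_right)
    finally show ?thesis using t by (simp add: h1_def flip: \<delta>_expand)
  qed
  \<comment> \<open>A-bilinear because the failure of the two pairings to be so differs, by
    \<open>valgd_A2\<close>, by a pairing with \<open>\<delta>\<close>, and this is the defect of
    \<open>h1\<close> on multiples.\<close>
  define B where "B s t = TT V s t - TT V' s t - pair D s (h1 t) - pair D t (h1 s)" for s t
  have B_sym: "B s t = B t s" for s t
    unfolding B_def frm_sym[OF V, of "(s, 0)"] frm_sym[OF V', of "(s, 0)"] by simp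
  have B_add: "B (s + s') t = B s t + B s' t" if "s \<in> Der D" "s' \<in> Der D" "t \<in> Der D" for s s' t
    unfolding B_def TT_plus[OF V that] TT_plus[OF V' that] h1_add[OF that(1,2)] pair_add[OF that(3)]
      pair_plus_left[OF that(1,2)] by simp
  have B_tsc: "B (tsc a s) t = a * B s t" if "s \<in> Der D" "t \<in> Der D" for a s t
    unfolding B_def valgd_A2[OF V that] valgd_A2[OF V' that] h1_tsc[OF that(1)] pair_tsc[OF that(1)] \<delta>_def
      pair_diff[OF that(2)] pair_osc[OF that(2)]
    by (simp add: algebra_simps)
  define Bh where "Bh s = (\<Sum>i<n. osc1 D (B s (tb i)) (dd D (yb i)))" for s
  have pair_Bh: "pair D t (Bh s) = B s t" if "s \<in> Der D" "t \<in> Der D" for s t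
    unfolding Bh_def
  proof (rule pair_expand_linear[where L="B s"])
    show "B s (t + t') = B s t + B s t'" if "t \<in> Der D" "t' \<in> Der D" for t t'
      unfolding B_sym[of s] by (rule B_add[OF that \<open>s \<in> Der D\<close>])
    show "B s (tsc a t) = a * B s t" if "t \<in> Der D" for a t
      unfolding B_sym[of s] by (rule B_tsc[OF that \<open>s \<in> Der D\<close>])
  qed (rule that)
  have Bh_add: "Bh (s + t) = Bh s + Bh t" if "s \<in> Der D" "t \<in> Der D" for s t
    using that by (intro pair_separates) (simp only: pair_add pair_Bh Der_plus B_add)
  have Bh_tsc: "Bh (tsc a s) = osc1 D a (Bh s)" if "s \<in> Der D" for a s
    using that by (intro pair_separates) (simp only: pair_osc pair_Bh Der_tsc B_tsc)
  \<comment> \<open>\<open>Bh\<close> is A-linear, so the correction leaves the rule for multiples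
    intact. On the pairings it enters once for each argument, and by symmetry of \<open>B\<close>
    the two halves give \<open>B\<close>.\<close>
  define h where "h t = (if t \<in> Der D then h1 t + half D (Bh t) else 0)" for t
  have h: "h t = h1 t + half D (Bh t)" if "t \<in> Der D" for t using that by (simp add: h_def)
  have h_add: "h (s + t) = h s + h t" if "s \<in> Der D" "t \<in> Der D" for s t
    unfolding h[OF that(1)] h[OF that(2)] h[OF Der_plus[OF that]] h1_add[OF that] Bh_add[OF that]
    by (simp add: half_osc O1.scale_right_distrib)
  have h_ktsc: "h (ktsc D r t) = kosc D r (h t)" if "t \<in> Der D" for r t
  proof -
    have "ktsc D r t \<in> Der D" using that by (simp add: ktsc_eq Der_tsc)
    then have "h (ktsc D r t) = kosc D r (h1 t) + half D (osc1 D (ksc D r 1) (Bh t))"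
      using that by (simp add: h h1_ktsc) (simp add: ktsc_eq Bh_tsc)
    also have "\<dots> = kosc D r (h t)"
      using that by (simp add: h half_osc kosc_def O1.scale_right_distrib mult.commute)
    finally show ?thesis .
  qed
  show thesis
  proof (rule hom_defect[OF V V'])
    show "linear_map_on (Der D) (ktsc D) (kosc D) h"
      unfolding linear_map_on_def using h_add h_ktsc by blast
    show "h t = 0" if "t \<notin> Der D" for t using that by (simp add: h_def)
    show "h (tsc a t) = osc1 D a (h t) - gam V' a t + gam V a t" if "t \<in> Der D" for a t
      unfolding h[OF that] h[OF Der_tsc[OF that]] h1_tsc[OF that] Bh_tsc[OF that] \<delta>_def
      by (simp add: half_osc O1.scale_right_distrib mult.commute)
    show "TT V s t = TT V' s t + pair D s (h t) + pair D t (h s)" if "s \<in> Der D" "t \<in> Der D" for s t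
      unfolding h[OF that(1)] h[OF that(2)] pair_add[OF that(1)] pair_add[OF that(2)] pair_half[OF that(1)]
        pair_half[OF that(2)] pair_Bh[OF that] pair_Bh[OF that(2,1)] B_sym[of t s]
      using hh_double[of "B s t"] by (simp add: B_def algebra_simps)
  qed (rule that)
qed

section \<open>Composition of morphisms and their interaction with forms\<close>

lemma hom_0: "is_valgd D V \<Longrightarrow> is_valgd_hom D V V (\<lambda>t. 0)"
  unfolding is_valgd_hom_iff hom_curv_def linear_map_on_def kosc_def
  by (auto simp: pair_0 lie_0 half_osc dd_0)

text \<open>Additivity in the map is what makes composition of morphisms a sum and inversion a
  change of sign.\<close>

lemma hom_curv_add:
  "s \<in> Der D \<Longrightarrow> t \<in> Der D \<Longrightarrow> hom_curv (\<lambda>t. g t + h t) s t = hom_curv g s t + hom_curv h s t"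
  by (simp add: hom_curv_def pair_add lie_add half_osc dd_add O1.scale_right_distrib)

lemma hom_curv_minus:
  assumes "s \<in> Der D" "t \<in> Der D"
  shows "hom_curv (\<lambda>t. - h t) s t = - hom_curv h s t"
  using assms by (simp add: hom_curv_def pair_minus lie_minus half_osc dd_minus O1.scale_minus_right)

lemma hom_add:
  assumes g: "is_valgd_hom D V V' g" and h: "is_valgd_hom D V' V'' h"
  shows "is_valgd_hom D V V'' (\<lambda>t. h t + g t)"
  using g h unfolding is_valgd_hom_iff linear_map_on_def kosc_def
  by (auto simp: hom_curv_add pair_add O1.scale_right_distrib simp del: plus_fun_def)

lemma hom_minus:
  assumes h: "is_valgd_hom D V V' h"
  shows "is_valgd_hom D V' V (\<lambda>t. - h t)"
  using h unfolding is_valgd_hom_iff linear_map_on_def kosc_def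
  by (auto simp: hom_curv_minus pair_minus O1.scale_minus_right simp del: plus_fun_def)

text \<open>The map of a 2-form is A-linear and skew, so neither \<open>gam\<close> nor the pairings
  notice it; the change in \<open>c\<close> is governed by \<open>d2_eq_iff\<close>.\<close>

lemma hom_shift:
  assumes h: "is_valgd_hom D V V' h" and \<eta>: "d2 D \<eta> = \<omega>' - \<omega>"
  shows "is_valgd_hom D (V\<lparr>cc := \<lambda>s t. cc V s t + form3_map D \<omega> s t\<rparr>)
    (V'\<lparr>cc := \<lambda>s t. cc V' s t + form3_map D \<omega>' s t\<rparr>) (\<lambda>t. h t + form2_map D \<eta> t)"
proof -
  have H0: "\<And>s. s \<notin> Der D \<Longrightarrow> form2_map D \<eta> s = 0"
    and H_add: "\<And>s s'. s \<in> Der D \<Longrightarrow> s' \<in> Der D \<Longrightarrow> form2_map D \<eta> (s + s') = form2_map D \<eta> s + form2_map D \<eta> s'"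
    and H_tsc: "\<And>a s. s \<in> Der D \<Longrightarrow> form2_map D \<eta> (tsc a s) = osc1 D a (form2_map D \<eta> s)"
    and H_skew: "\<And>s t. s \<in> Der D \<Longrightarrow> t \<in> Der D \<Longrightarrow> pair D t (form2_map D \<eta> s) = - pair D s (form2_map D \<eta> t)"
    using form2_like_form2_map[of \<eta>] unfolding form2_like_def by blast+
  show ?thesis
    unfolding is_valgd_hom_iff
  proof (intro conjI allI ballI impI)
    show "linear_map_on (Der D) (ktsc D) (kosc D) (\<lambda>t. h t + form2_map D \<eta> t)"
    proof -
      have "form2_map D \<eta> (ktsc D r t) = kosc D r (form2_map D \<eta> t)" if "t \<in> Der D" for r t
        using that by (simp only: ktsc_eq H_tsc kosc_eq)
      moreover have "kosc D r (v + w) = kosc D r v + kosc D r w" for r v w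
        by (simp add: kosc_eq O1.scale_right_distrib)
      ultimately show ?thesis
        using h unfolding is_valgd_hom_iff linear_map_on_def by (simp add: H_add del: plus_fun_def)
    qed
    show "h t + form2_map D \<eta> t = 0" if "t \<notin> Der D" for t
      using h that H0 by (simp add: is_valgd_hom_iff)
    show "h (tsc a t) + form2_map D \<eta> (tsc a t) = osc1 D a (h t + form2_map D \<eta> t)
        - gam (V'\<lparr>cc := \<lambda>s t. cc V' s t + form3_map D \<omega>' s t\<rparr>) a t
        + gam (V\<lparr>cc := \<lambda>s t. cc V s t + form3_map D \<omega> s t\<rparr>) a t" if "t \<in> Der D" for a t
      using h that by (simp add: is_valgd_hom_iff H_tsc O1.scale_right_distrib)
    fix s t assume T: "s \<in> Der D" "t \<in> Der D"
    show "TT (V\<lparr>cc := \<lambda>s t. cc V s t + form3_map D \<omega> s t\<rparr>) s t =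
        TT (V'\<lparr>cc := \<lambda>s t. cc V' s t + form3_map D \<omega>' s t\<rparr>) s t
        + pair D s (h t + form2_map D \<eta> t) + pair D t (h s + form2_map D \<eta> s)"
      using h T H_skew[OF T] by (simp add: is_valgd_hom_iff pair_add)
    have "form3_map D \<omega> s t = form3_map D \<omega>' s t + hom_curv (form2_map D \<eta>) s t"
      using \<eta> T unfolding d2_eq_iff by blast
    then show "cc (V\<lparr>cc := \<lambda>s t. cc V s t + form3_map D \<omega> s t\<rparr>) s t =
        cc (V'\<lparr>cc := \<lambda>s t. cc V' s t + form3_map D \<omega>' s t\<rparr>) s t + hom_curv (\<lambda>t. h t + form2_map D \<eta> t) s t"
      using h T by (simp add: is_valgd_hom_iff hom_curv_add)
  qed
qed

text \<open>Both ends have the same \<open>gam\<close> and the same pairing, so the morphism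
  conditions reduce to A-linearity and skewness of \<open>h\<close>; hence \<open>h\<close> comes
  from a 2-form, and the condition on \<open>c\<close> fixes its differential.\<close>

lemma hom_shift_full:
  assumes h: "is_valgd_hom D (V\<lparr>cc := \<lambda>s t. cc V s t + form3_map D \<omega> s t\<rparr>)
    (V\<lparr>cc := \<lambda>s t. cc V s t + form3_map D \<omega>' s t\<rparr>) h"
  shows "\<exists>\<eta>. d2 D \<eta> = \<omega>' - \<omega> \<and> form2_map D \<eta> = h"
proof -
  have skew: "pair D t (h s) = - pair D s (h t)" if "s \<in> Der D" "t \<in> Der D" for s t
  proof -
    have "frm V (s, 0) (t, 0) = frm V (s, 0) (t, 0) + pair D s (h t) + pair D t (h s)"
      using h that unfolding is_valgd_hom_iff by simp
    then show ?thesis by (simp add: add.assoc eq_neg_iff_add_eq_0 add.commute)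
  qed
  have "form2_like h"
    unfolding form2_like_def
  proof (intro conjI)
    show "\<forall>s\<in>Der D. \<forall>t\<in>Der D. pair D t (h s) = - pair D s (h t)" using skew by blast
  qed (use h in \<open>simp_all add: is_valgd_hom_iff linear_map_on_def del: plus_fun_def\<close>)
  then obtain \<eta> where \<eta>: "form2_map D \<eta> = h" using form2_like_ex by blast
  moreover have "d2 D \<eta> = \<omega>' - \<omega>"
    unfolding d2_eq_iff \<eta> using h unfolding is_valgd_hom_iff by (simp add: add.assoc)
  ultimately show ?thesis by blast
qed

end

section \<open>Fully faithful and essentially surjective functors\<close>

text \<open>A fully faithful and essentially surjective functor has a quasi-inverse: choose for
  every \<open>x\<close> an object \<open>g x\<close> and an isomorphism \<open>e x\<close> from
  \<open>F (g x)\<close> to \<open>x\<close>, conjugate arrows by these, and pull back along the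
  bijections on arrows.\<close>

lemma is_equivalenceI:
  assumes C: "is_category C" and B: "is_category B" and F: "is_functor C B F"
    and ff: "\<And>a b. a \<in> Obj C \<Longrightarrow> b \<in> Obj C \<Longrightarrow>
      bij_betw (fmap F a b) (Hom C a b) (Hom B (fobj F a) (fobj F b))"
    and es: "\<And>x. x \<in> Obj B \<Longrightarrow> \<exists>a\<in>Obj C. \<exists>e. is_iso B (fobj F a) x e"
  shows "is_equivalence C B F"
proof -
  note cat = C[unfolded is_category_def] B[unfolded is_category_def]
  have Fo: "fobj F a \<in> Obj B" and Fi: "fmap F a a (Idn C a) = Idn B (fobj F a)" if "a \<in> Obj C" for a
    using F that unfolding is_functor_def by auto
  have Fh: "fmap F a b f \<in> Hom B (fobj F a) (fobj F b)" if "a \<in> Obj C" "b \<in> Obj C" "f \<in> Hom C a b" for a b f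
    using F that unfolding is_functor_def by blast
  have Fc: "fmap F a c (Cmp C a b c g f) = Cmp B (fobj F a) (fobj F b) (fobj F c) (fmap F b c g) (fmap F a b f)"
    if "a \<in> Obj C" "b \<in> Obj C" "c \<in> Obj C" "f \<in> Hom C a b" "g \<in> Hom C b c" for a b c f g
    using F that unfolding is_functor_def by blast
  have Ci: "Idn C a \<in> Hom C a a" if "a \<in> Obj C" for a using cat(1) that by blast
  have Cc: "Cmp C a b c g f \<in> Hom C a c"
    if "a \<in> Obj C" "b \<in> Obj C" "c \<in> Obj C" "f \<in> Hom C a b" "g \<in> Hom C b c" for a b c f g
    using cat(1) that by blast
  have Bi: "Idn B a \<in> Hom B a a" if "a \<in> Obj B" for a using cat(2) that by blast
  have Bc: "Cmp B a b c g f \<in> Hom B a c"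
    if "a \<in> Obj B" "b \<in> Obj B" "c \<in> Obj B" "f \<in> Hom B a b" "g \<in> Hom B b c" for a b c f g
    using cat(2) that by blast
  have Bid: "Cmp B a a b f (Idn B a) = f" "Cmp B a b b (Idn B b) f = f"
    if "a \<in> Obj B" "b \<in> Obj B" "f \<in> Hom B a b" for a b f using cat(2) that by blast+
  have Ba: "Cmp B a c d h (Cmp B a b c g f) = Cmp B a b d (Cmp B b c d h g) f"
    if "a \<in> Obj B" "b \<in> Obj B" "c \<in> Obj B" "d \<in> Obj B" "f \<in> Hom B a b" "g \<in> Hom B b c" "h \<in> Hom B c d"
    for a b c d f g h using cat(2) that by blast
  have inj: "f = f'" if "a \<in> Obj C" "b \<in> Obj C" "f \<in> Hom C a b" "f' \<in> Hom C a b" "fmap F a b f = fmap F a b f'" for a b f f'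
    using ff[OF that(1,2)] that(3-5) by (auto simp: bij_betw_def inj_on_def)
  define \<psi> where "\<psi> a b = inv_into (Hom C a b) (fmap F a b)" for a b
  have \<psi>: "\<psi> a b u \<in> Hom C a b" "fmap F a b (\<psi> a b u) = u"
    if "a \<in> Obj C" "b \<in> Obj C" "u \<in> Hom B (fobj F a) (fobj F b)" for a b u
    using ff[OF that(1,2)] that(3) unfolding \<psi>_def bij_betw_def
    by (auto intro: inv_into_into f_inv_into_f)
  have "\<exists>a e e'. a \<in> Obj C \<and> e \<in> Hom B (fobj F a) x \<and> e' \<in> Hom B x (fobj F a) \<and>
      Cmp B (fobj F a) x (fobj F a) e' e = Idn B (fobj F a) \<and> Cmp B x (fobj F a) x e e' = Idn B x"
    if "x \<in> Obj B" for x
    using es[OF that] unfolding is_iso_def by blast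
  then obtain g e e' where g: "\<And>x. x \<in> Obj B \<Longrightarrow> g x \<in> Obj C"
    and e: "\<And>x. x \<in> Obj B \<Longrightarrow> e x \<in> Hom B (fobj F (g x)) x" "\<And>x. x \<in> Obj B \<Longrightarrow> e' x \<in> Hom B x (fobj F (g x))"
    and ee: "\<And>x. x \<in> Obj B \<Longrightarrow> Cmp B (fobj F (g x)) x (fobj F (g x)) (e' x) (e x) = Idn B (fobj F (g x))"
      "\<And>x. x \<in> Obj B \<Longrightarrow> Cmp B x (fobj F (g x)) x (e x) (e' x) = Idn B x"
    by metis
  let ?g = "\<lambda>x. fobj F (g x)"
  have Fg: "?g x \<in> Obj B" if "x \<in> Obj B" for x using Fo[OF g[OF that]] .
  \<comment> \<open>The arrow \<open>f\<close> conjugated by the chosen isomorphisms;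
    \<open>eK\<close> is then the naturality of \<open>e\<close>.\<close>
  define K where "K x y f = Cmp B (?g x) y (?g y) (e' y) (Cmp B (?g x) x y f (e x))" for x y f
  have K: "K x y f \<in> Hom B (?g x) (?g y)" if "x \<in> Obj B" "y \<in> Obj B" "f \<in> Hom B x y" for x y f
    unfolding K_def using that by (intro Bc e Fg)
  have eK: "Cmp B (?g x) (?g y) y (e y) (K x y f) = Cmp B (?g x) x y f (e x)"
    if "x \<in> Obj B" "y \<in> Obj B" "f \<in> Hom B x y" for x y f
  proof -
    have fe: "Cmp B (?g x) x y f (e x) \<in> Hom B (?g x) y" using that by (intro Bc e Fg)
    have "Cmp B (?g x) (?g y) y (e y) (K x y f) =
        Cmp B (?g x) y y (Cmp B y (?g y) y (e y) (e' y)) (Cmp B (?g x) x y f (e x))"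
      unfolding K_def using that fe by (intro Ba e Fg)
    then show ?thesis using that fe by (simp add: ee Bid Fg)
  qed
  \<comment> \<open>\<open>K x y f\<close> is the only arrow making the naturality square of
    \<open>e\<close> commute; compatibility with identities and composition follows from
    this.\<close>
  have K_unique: "k = K x y f" if "x \<in> Obj B" "y \<in> Obj B" "f \<in> Hom B x y" "k \<in> Hom B (?g x) (?g y)"
    "Cmp B (?g x) (?g y) y (e y) k = Cmp B (?g x) x y f (e x)" for x y f k
  proof -
    have "k = Cmp B (?g x) (?g y) (?g y) (Cmp B (?g y) y (?g y) (e' y) (e y)) k"
      using that by (simp add: ee Bid Fg)
    also have "\<dots> = Cmp B (?g x) y (?g y) (e' y) (Cmp B (?g x) (?g y) y (e y) k)"
      using that by (intro Ba[symmetric] e Fg)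
    finally show ?thesis by (simp add: that(5) K_def)
  qed
  define G where "G = \<lparr>fobj = g, fmap = (\<lambda>x y f. \<psi> (g x) (g y) (K x y f))\<rparr>"
  have G_simps: "fobj G = g" "fmap G x y f = \<psi> (g x) (g y) (K x y f)" for x y f by (simp_all add: G_def)
  have FG: "fmap F (g x) (g y) (fmap G x y f) = K x y f" if "x \<in> Obj B" "y \<in> Obj B" "f \<in> Hom B x y" for x y f
    unfolding G_simps using that by (intro \<psi>(2) g K)
  have Gh: "fmap G x y f \<in> Hom C (g x) (g y)" if "x \<in> Obj B" "y \<in> Obj B" "f \<in> Hom B x y" for x y f
    unfolding G_simps using that by (intro \<psi>(1) g K)
  have fun_G: "is_functor B C G"
    unfolding is_functor_def
  proof (intro conjI ballI)
    fix x assume x: "x \<in> Obj B"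
    show "fobj G x \<in> Obj C" using g[OF x] by (simp add: G_simps)
    note Gi = Gh[OF x x Bi[OF x]]
    have "Idn B (?g x) = K x x (Idn B x)"
      using x by (intro K_unique Bi Fg) (simp_all add: Bid e Fg)
    then have "fmap F (g x) (g x) (fmap G x x (Idn B x)) = fmap F (g x) (g x) (Idn C (g x))"
      using FG[OF x x Bi[OF x]] Fi[OF g[OF x]] by simp
    from inj[OF g[OF x] g[OF x] Gi Ci[OF g[OF x]] this]
    show "fmap G x x (Idn B x) = Idn C (fobj G x)" by (simp add: G_simps(1))
  next
    fix x y f assume "x \<in> Obj B" "y \<in> Obj B" "f \<in> Hom B x y"
    then show "fmap G x y f \<in> Hom C (fobj G x) (fobj G y)" unfolding G_simps(1) by (rule Gh)
  next
    fix x y z f h assume x: "x \<in> Obj B" and y: "y \<in> Obj B" and z: "z \<in> Obj B"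
      and f: "f \<in> Hom B x y" and h: "h \<in> Hom B y z"
    have hf: "Cmp B x y z h f \<in> Hom B x z" using x y z f h by (rule Bc)
    have "Cmp B (?g x) (?g z) z (e z) (Cmp B (?g x) (?g y) (?g z) (K y z h) (K x y f)) =
        Cmp B (?g x) (?g y) z (Cmp B (?g y) (?g z) z (e z) (K y z h)) (K x y f)"
      using x y z f h by (intro Ba e K Fg)
    also have "\<dots> = Cmp B (?g x) (?g y) z (Cmp B (?g y) y z h (e y)) (K x y f)"
      using y z h by (simp add: eK)
    also have "\<dots> = Cmp B (?g x) y z h (Cmp B (?g x) (?g y) y (e y) (K x y f))"
      using x y z f h by (intro Ba[symmetric] e K Fg)
    also have "\<dots> = Cmp B (?g x) y z h (Cmp B (?g x) x y f (e x))"
      using x y f by (simp add: eK)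
    also have "\<dots> = Cmp B (?g x) x z (Cmp B x y z h f) (e x)"
      using x y z f h by (intro Ba e Fg)
    finally have "Cmp B (?g x) (?g y) (?g z) (K y z h) (K x y f) = K x z (Cmp B x y z h f)"
      using x y z f h by (intro K_unique Bc[of "?g x" "?g y" "?g z"] K Fg hf)
    then have "fmap F (g x) (g z) (fmap G x z (Cmp B x y z h f)) =
        fmap F (g x) (g z) (Cmp C (g x) (g y) (g z) (fmap G y z h) (fmap G x y f))"
      using x y z f h hf by (simp add: FG Fc Gh g)
    from inj[OF g[OF x] g[OF z] Gh[OF x z hf] Cc[OF g[OF x] g[OF y] g[OF z] Gh[OF x y f] Gh[OF y z h]] this]
    show "fmap G x z (Cmp B x y z h f) = Cmp C (fobj G x) (fobj G y) (fobj G z) (fmap G y z h) (fmap G x y f)"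
      by (simp add: G_simps(1))
  qed
  \<comment> \<open>The preimage of the chosen isomorphism at \<open>fobj F a\<close>. Invertibility
    and naturality are checked after applying the faithful \<open>F\<close>.\<close>
  define s where "s a = \<psi> (g (fobj F a)) a (e (fobj F a))" for a
  have s: "s a \<in> Hom C (g (fobj F a)) a" "fmap F (g (fobj F a)) a (s a) = e (fobj F a)" if "a \<in> Obj C" for a
    using \<psi>[OF g[OF Fo[OF that]] that e(1)[OF Fo[OF that]]] unfolding s_def by auto
  have "is_natural_iso C C (comp_functor G F) id_functor s"
    unfolding is_natural_iso_def comp_functor_def id_functor_def cat_functor.simps G_simps(1)
  proof (intro conjI ballI)
    fix a assume a: "a \<in> Obj C"
    let ?x = "fobj F a"
    define r where "r = \<psi> a (g ?x) (e' ?x)"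
    have r: "r \<in> Hom C a (g ?x)" "fmap F a (g ?x) r = e' ?x"
      using \<psi>[OF a g[OF Fo[OF a]] e(2)[OF Fo[OF a]]] unfolding r_def by auto
    have "Cmp C (g ?x) a (g ?x) r (s a) = Idn C (g ?x)"
      using a r s by (intro inj[of "g ?x" "g ?x"] Cc Ci g Fo) (simp_all add: Fc g Fo ee Fi)
    moreover have "Cmp C a (g ?x) a (s a) r = Idn C a"
      using a r s by (intro inj[of a a] Cc Ci g Fo) (simp_all add: Fc g Fo ee Fi)
    ultimately show "is_iso C (g ?x) a (s a)"
      unfolding is_iso_def using r s[OF a] by blast
  next
    fix a b f assume a: "a \<in> Obj C" and b: "b \<in> Obj C" and f: "f \<in> Hom C a b"
    let ?x = "fobj F a" and ?y = "fobj F b"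
    note o = g[OF Fo[OF a]] g[OF Fo[OF b]] and Gf = Gh[OF Fo[OF a] Fo[OF b] Fh[OF a b f]]
    show "Cmp C (g ?x) (g ?y) b (s b) (fmap G ?x ?y (fmap F a b f)) = Cmp C (g ?x) a b f (s a)"
    proof (rule inj[OF o(1) b])
      show "fmap F (g ?x) b (Cmp C (g ?x) (g ?y) b (s b) (fmap G ?x ?y (fmap F a b f))) =
          fmap F (g ?x) b (Cmp C (g ?x) a b f (s a))"
        unfolding Fc[OF o b Gf s(1)[OF b]] Fc[OF o(1) a b s(1)[OF a] f] s(2)[OF a] s(2)[OF b]
          FG[OF Fo[OF a] Fo[OF b] Fh[OF a b f]]
        by (rule eK[OF Fo[OF a] Fo[OF b] Fh[OF a b f]])
    qed (intro Cc o a b f s Gf)+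
  qed
  moreover have "is_natural_iso B B (comp_functor F G) id_functor e"
    unfolding is_natural_iso_def comp_functor_def id_functor_def cat_functor.simps G_simps(1)
  proof (intro conjI ballI)
    show "is_iso B (?g x) x (e x)" if "x \<in> Obj B" for x
      unfolding is_iso_def using e ee that by blast
    show "Cmp B (?g x) (?g y) y (e y) (fmap F (g x) (g y) (fmap G x y f)) = Cmp B (?g x) x y f (e x)"
      if "x \<in> Obj B" "y \<in> Obj B" "f \<in> Hom B x y" for x y f
      using that by (simp add: FG eK)
  qed
  ultimately show ?thesis unfolding is_equivalence_def using F fun_G by blast
qed


section \<open>The Torseur structure\<close>

context smooth_forms
begin

lemma Alg_simps: "Obj (Alg D) = {V. is_valgd D V}" "Hom (Alg D) V V' = {h. is_valgd_hom D V V' h}"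
  "Idn (Alg D) V = (\<lambda>t. 0)" "Cmp (Alg D) V V' V'' h' h = (\<lambda>t. h' t + h t)"
  by (simp_all add: Alg_def)

lemma Omega23_simps:
  "Obj (carr (Omega23 D)) = {\<omega>. d3 D \<omega> = 0}" "Hom (carr (Omega23 D)) \<omega> \<omega>' = {\<eta>. d2 D \<eta> = \<omega>' - \<omega>}"
  "Idn (carr (Omega23 D)) \<omega> = 0" "Cmp (carr (Omega23 D)) \<omega> \<omega>' \<omega>'' \<eta>' \<eta> = \<eta>' + \<eta>"
  "gplus (Omega23 D) \<omega> \<omega>' = \<omega> + \<omega>'" "fmap (plus_fun (Omega23 D)) x y (\<eta>, \<eta>') = \<eta> + \<eta>'"
  "fobj (neg_fun (Omega23 D)) \<omega> = - \<omega>" "fmap (neg_fun (Omega23 D)) \<omega> \<omega>' \<eta> = - \<eta>"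
  "zero_obj (Omega23 D) = 0"
  by (simp_all add: Omega23_def)

lemma dotplus_simps:
  "fobj (dotplus D) (V, \<omega>) = V\<lparr>cc := \<lambda>s t. cc V s t + form3_map D \<omega> s t\<rparr>"
  "fmap (dotplus D) x y (h, \<eta>) = (\<lambda>t. h t + form2_map D \<eta> t)"
  by (simp_all add: dotplus_def)

lemma prod_category_simps:
  "Obj (prod_category C B) = Obj C \<times> Obj B" "Hom (prod_category C B) (a, a') (b, b') = Hom C a b \<times> Hom B a' b'"
  "Idn (prod_category C B) (a, a') = (Idn C a, Idn B a')"
  "Cmp (prod_category C B) (a, a') (b, b') (c, c') (g, g') (f, f') = (Cmp C a b c g f, Cmp B a' b' c' g' f')"
  by (simp_all add: prod_category_def)

lemma is_category_Alg: "is_category (Alg D)"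
  unfolding is_category_def Alg_simps
  by (auto simp: hom_0 add.assoc intro: hom_add)

lemma is_groupoid_Alg: "is_groupoid (Alg D)"
  unfolding is_groupoid_def
proof (intro conjI is_category_Alg ballI)
  fix V V' h assume "h \<in> Hom (Alg D) V V'"
  then have "(\<lambda>t. - h t) \<in> Hom (Alg D) V' V" "h \<in> Hom (Alg D) V V'"
    by (simp_all add: Alg_simps hom_minus)
  then show "is_iso (Alg D) V V' h"
    unfolding is_iso_def by (intro conjI bexI[of _ "\<lambda>t. - h t"]) (simp_all add: Alg_simps)
qed

lemma d2_add: "d2 D (\<eta> + \<eta>') = d2 D \<eta> + d2 D \<eta>'" and d2_0: "d2 D 0 = 0" and d2_minus: "d2 D (- \<eta>) = - d2 D \<eta>"
  using additive_d2 by (simp_all add: additive.add additive.zero additive.minus)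

lemma d3_add: "d3 D (\<omega> + \<omega>') = d3 D \<omega> + d3 D \<omega>'" and d3_0: "d3 D 0 = 0" and d3_minus: "d3 D (- \<omega>) = - d3 D \<omega>"
  using additive_d3 by (simp_all add: additive.add additive.zero additive.minus)

lemma is_category_Omega23: "is_category (carr (Omega23 D))"
  unfolding is_category_def Omega23_simps by (auto simp: d2_add d2_0 add.assoc)

lemma is_groupoid_Omega23: "is_groupoid (carr (Omega23 D))"
  unfolding is_groupoid_def
proof (intro conjI is_category_Omega23 ballI)
  fix \<omega> \<omega>' \<eta> assume "\<eta> \<in> Hom (carr (Omega23 D)) \<omega> \<omega>'"
  then show "is_iso (carr (Omega23 D)) \<omega> \<omega>' \<eta>"
    unfolding is_iso_def by (intro conjI bexI[of _ "- \<eta>"]) (simp_all add: Omega23_simps d2_minus)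
qed

lemma abelian_group_Omega23: "abelian_group_in_categories (Omega23 D)"
  unfolding abelian_group_in_categories_def Let_def is_functor_def
  by (auto simp: is_category_Omega23 prod_category_simps Omega23_simps d2_add d2_minus d3_add d3_minus d3_0 ac_simps)

lemma is_valgd_dotplus: "is_valgd D V \<Longrightarrow> d3 D \<omega> = 0 \<Longrightarrow> is_valgd D (fobj (dotplus D) (V, \<omega>))"
  unfolding dotplus_simps d3_eq_0_iff by (intro valgd_shift form3_like_form3_map)

text \<open>An equality of records, not just an isomorphism: \<open>form3_map\<close> is additive in
  the form at all arguments, being 0 off the derivations.\<close>

lemma dotplus_assoc:
  "fobj (dotplus D) (fobj (dotplus D) (V, \<omega>), \<omega>') = fobj (dotplus D) (V, \<omega> + \<omega>')"
  by (simp add: dotplus_simps form3_map_add add.assoc)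

lemma dotplus_0: "fobj (dotplus D) (V, 0) = V"
  by (simp add: dotplus_simps form3_map_0)

lemma is_valgd_hom_dotplus:
  "is_valgd_hom D V V' h \<Longrightarrow> d2 D \<eta> = \<omega>' - \<omega> \<Longrightarrow>
    is_valgd_hom D (fobj (dotplus D) (V, \<omega>)) (fobj (dotplus D) (V', \<omega>')) (\<lambda>t. h t + form2_map D \<eta> t)"
  unfolding dotplus_simps by (rule hom_shift)

lemma is_functor_dotplus: "is_functor (prod_category (Alg D) (carr (Omega23 D))) (Alg D) (dotplus D)"
  unfolding is_functor_def
  by (auto simp: prod_category_simps Alg_simps Omega23_simps is_valgd_dotplus is_valgd_hom_dotplus
      dotplus_simps(2) form2_map_0 form2_map_add ac_simps)

lemma is_iso_Alg_id: "is_valgd D V \<Longrightarrow> is_iso (Alg D) V V (\<lambda>t. 0)"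
  unfolding is_iso_def by (auto simp: Alg_simps hom_0)

text \<open>By \<open>dotplus_assoc\<close> and \<open>dotplus_0\<close> source and target of each
  constraint coincide, so identities serve, and pentagon and triangles become equations between zero
  maps.\<close>

lemma is_Action_dotplus:
  "is_Action (Alg D) (Omega23 D) (dotplus D)
      (\<lambda>V \<omega> \<omega>'. Idn (Alg D) (fobj (dotplus D) (V, gplus (Omega23 D) \<omega> \<omega>')))
      (\<lambda>V. Idn (Alg D) V)"
  unfolding is_Action_def Let_def is_natural_iso_def
  by (auto simp: is_category_Alg abelian_group_Omega23 is_functor_dotplus prod_category_simps Alg_simps
      Omega23_simps dotplus_assoc dotplus_0 is_valgd_dotplus d3_add is_iso_Alg_id dotplus_simps(2)
      form2_map_0 form2_map_add id_functor_def ac_simps)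

text \<open>Faithful by \<open>form2_map_inject\<close>, full by \<open>hom_shift_full\<close>,
  essentially surjective by \<open>ex_hom_up_to_form\<close> together with invertibility of all
  morphisms.\<close>

lemma is_equivalence_dotplus:
  assumes V: "is_valgd D V"
  shows "is_equivalence (carr (Omega23 D)) (Alg D)
     \<lparr>fobj = (\<lambda>a. fobj (dotplus D) (V, a)),
      fmap = (\<lambda>a b u. fmap (dotplus D) (V, a) (V, b) (Idn (Alg D) V, u))\<rparr>" (is "is_equivalence _ _ ?F")
proof (rule is_equivalenceI[OF is_category_Omega23 is_category_Alg])
  show "is_functor (carr (Omega23 D)) (Alg D) ?F"
    unfolding is_functor_def
    using V is_valgd_hom_dotplus[OF hom_0[OF V]]
    by (auto simp: Alg_simps Omega23_simps is_valgd_dotplus dotplus_simps(2) form2_map_0 form2_map_add)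
next
  fix \<omega> \<omega>' assume "\<omega> \<in> Obj (carr (Omega23 D))" "\<omega>' \<in> Obj (carr (Omega23 D))"
  have F: "fmap ?F \<omega> \<omega>' \<eta> = form2_map D \<eta>" for \<eta>
    by (simp add: Alg_simps dotplus_simps(2))
  show "bij_betw (fmap ?F \<omega> \<omega>') (Hom (carr (Omega23 D)) \<omega> \<omega>') (Hom (Alg D) (fobj ?F \<omega>) (fobj ?F \<omega>'))"
    unfolding bij_betw_def
  proof (intro conjI equalityI subsetI)
    show "inj_on (fmap ?F \<omega> \<omega>') (Hom (carr (Omega23 D)) \<omega> \<omega>')"
      unfolding F inj_on_def using form2_map_inject by blast
    show "h \<in> Hom (Alg D) (fobj ?F \<omega>) (fobj ?F \<omega>')" if "h \<in> fmap ?F \<omega> \<omega>' ` Hom (carr (Omega23 D)) \<omega> \<omega>'" for h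
      using that is_valgd_hom_dotplus[OF hom_0[OF V]] unfolding F by (auto simp: Alg_simps Omega23_simps)
    show "h \<in> fmap ?F \<omega> \<omega>' ` Hom (carr (Omega23 D)) \<omega> \<omega>'" if h: "h \<in> Hom (Alg D) (fobj ?F \<omega>) (fobj ?F \<omega>')" for h
    proof -
      obtain \<eta> where "d2 D \<eta> = \<omega>' - \<omega>" "form2_map D \<eta> = h"
        using h hom_shift_full[of V \<omega> \<omega>' h] by (auto simp: Alg_simps dotplus_simps)
      then show ?thesis unfolding F by (auto simp: Omega23_simps)
    qed
  qed
next
  fix V' assume "V' \<in> Obj (Alg D)"
  then have V': "is_valgd D V'" by (simp add: Alg_simps)
  obtain h \<omega> where \<omega>: "d3 D \<omega> = 0" and h: "is_valgd_hom D (fobj (dotplus D) (V, \<omega>)) V' h"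
    using ex_hom_up_to_form[OF V V'] unfolding dotplus_simps by blast
  have "is_iso (Alg D) (fobj (dotplus D) (V, \<omega>)) V' h"
    using is_groupoid_Alg V V' \<omega> h unfolding is_groupoid_def by (simp add: Alg_simps is_valgd_dotplus)
  then show "\<exists>\<omega>\<in>Obj (carr (Omega23 D)). \<exists>e. is_iso (Alg D) (fobj ?F \<omega>) V' e"
    using \<omega> by (auto simp: Omega23_simps)
qed

end

theorem theoremI1:
  fixes D :: "('k::field_char_0, 'a::comm_ring_1, 'w1::ab_group_add, 'w2::ab_group_add,
                'w3::ab_group_add, 'w4::ab_group_add) forms"
  assumes "forms_of_algebra D"
    and "smooth_algebra (ksc D)"
  shows "is_groupoid (Alg D) \<and> is_groupoid (carr (Omega23 D)) \<and>
    (\<forall>V \<omega>. fobj (dotplus D) (V, \<omega>) =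
       V\<lparr>cc := (\<lambda>t1 t2. cc V t1 t2 + form3_map D \<omega> t1 t2)\<rparr>) \<and>
    is_Torseur (Alg D) (Omega23 D) (dotplus D)
      (\<lambda>V \<omega> \<omega>'. Idn (Alg D) (fobj (dotplus D) (V, gplus (Omega23 D) \<omega> \<omega>')))
      (\<lambda>V. Idn (Alg D) V)"
proof -
  interpret algebra_forms D by unfold_locales fact
  \<comment> \<open>Smoothness enters only through this dual basis.\<close>
  obtain n tb yb where "\<And>i. i < n \<Longrightarrow> tb i \<in> Der D"
    "\<And>b. dd D b = (\<Sum>i<(n::nat). osc1 D (tb i b) (dd D (yb i)))"
    using smooth_dual_basis[OF assms(2)] by blast
  then interpret smooth_forms D n tb yb by unfold_locales
  show ?thesis
    unfolding is_Torseur_def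
    using is_groupoid_Alg is_groupoid_Omega23 dotplus_simps(1) is_Action_dotplus is_equivalence_dotplus
    by (auto simp: Alg_simps(1))
qed

end
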